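(* Let $A\in\mathbb{R}^{n,n}$ be a Schur matrix (i.e. $zI_n-A$ is nonsingular for all $z\in\mathbb{C}$ with $|z|\ge1$), and let $B_1\in\mathbb{R}^{n,k}$, $B_2\in\mathbb{R}^{n,q}$, $Q=Q'\in\mathbb{R}^{n+k+q,n+k+q}$. Let $\sigma(x,v,w)=[x;v;w]'Q[x;v;w]$, $B=[B_1,\ B_2]$, and for $|z|=1$ let $$\Pi(z)=\begin{bmatrix}(zI_n-A)^{-1}B\\ I_{k+q}\end{bmatrix}'Q\begin{bmatrix}(zI_n-A)^{-1}B\\ I_{k+q}\end{bmatrix}=\begin{bmatrix}\Pi_{11}(z)&\Pi_{12}(z)\\ \Pi_{21}(z)&\Pi_{22}(z)\end{bmatrix},\quad \Pi_{11}(z)\in\mathbb{C}^{k,k},\ \Pi_{22}(z)\in\mathbb{C}^{q,q}.$$ Assume there exist $\epsilon>0$ and $z_0\in\mathbb{T}=\{|z|=1\}$ such that $$\begin{bmatrix}\Pi_{11}(z)&\epsilon\Pi_{12}(z)\\ \epsilon\Pi_{21}(z)&-\Pi_{22}(z)\end{bmatrix}\ge0\ \ \forall z\in\mathbb{T},\qquad \Pi_{11}(z_0)>0,\quad \Pi_{22}(z_0)<0.$$ For $a\in\mathbb{R}^n$ define $g:\ell^2_k\times\ell^2_q\to\mathbb{R}$ by $g(v,w)=\sum_{t=0}^\infty\sigma(x(t),v(t),w(t))$, where $x(t+1)=Ax(t)+B_1v(t)+B_2w(t)$, $x(0)=a$. Then for every $a\in\mathbb{R}^n$: (a) the functions $g_v(w)=\inf_{v\in\ell^2_k}g(v,w)$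 and $g_w(v)=\sup_{w\in\ell^2_q}g(v,w)$ are (finite and) continuous in the standard norm topologies of $\ell^2_q$ and $\ell^2_k$ respectively; (b) $\inf_{v\in\ell^2_k}\sup_{w\in\ell^2_q}g(v,w)=\sup_{w\in\ell^2_q}\inf_{v\in\ell^2_k}g(v,w)$.
   Context: $\ell^2_m$ is the real Hilbert space of sequences $u:\mathbb{Z}_+\to\mathbb{R}^m$ with $\sum_{t\ge0}|u(t)|^2<\infty$, with the norm $(\sum|u(t)|^2)^{1/2}$. $M'$ denotes conjugate transpose; $[x;v;w]$ is the stacked column vector. For Hermitian matrices, $\ge0$, $>0$, $<0$ denote positive semidefinite, positive definite, negative definite. *)

theory Defs
  imports "HOL-Analysis.Analysis"
begin

definition cmat :: "real^('m::finite)^('n::finite) \<Rightarrow> complex^'m^'n" where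
  "cmat M = (\<chi> i j. complex_of_real (M$i$j))"

definition ctrans :: "complex^('m::finite)^('n::finite) \<Rightarrow> complex^'n^'m" where
  "ctrans M = (\<chi> i j. cnj (M$j$i))"

definition cquad :: "complex^('n::finite)^'n \<Rightarrow> complex^'n \<Rightarrow> complex" where
  "cquad M u = (\<Sum>i\<in>UNIV. cnj (u$i) * (M *v u)$i)"

definition hermitian :: "complex^('n::finite)^'n \<Rightarrow> bool" where
  "hermitian M \<longleftrightarrow> ctrans M = M"

definition psd :: "complex^('n::finite)^'n \<Rightarrow> bool" where
  "psd M \<longleftrightarrow> hermitian M \<and> (\<forall>u. Im (cquad M u) = 0 \<and> Re (cquad M u) \<ge> 0)"

definition posdef :: "complex^('n::finite)^'n \<Rightarrow> bool" where
  "posdef M \<longleftrightarrow> hermitian M \<and> (\<forall>u. u \<noteq> 0 \<longrightarrow> Im (cquad M u) = 0 \<and> Re (cquad M u) > 0)"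

definition negdef :: "complex^('n::finite)^'n \<Rightarrow> bool" where
  "negdef M \<longleftrightarrow> hermitian M \<and> (\<forall>u. u \<noteq> 0 \<longrightarrow> Im (cquad M u) = 0 \<and> Re (cquad M u) < 0)"

definition schur :: "real^('n::finite)^'n \<Rightarrow> bool" where
  "schur A \<longleftrightarrow> (\<forall>z::complex. cmod z \<ge> 1 \<longrightarrow> invertible (mat z - cmat A))"

definition hcat :: "real^('k::finite)^('n::finite) \<Rightarrow> real^('q::finite)^'n \<Rightarrow> real^('k+'q)^'n" where
  "hcat B1 B2 = (\<chi> i j. case j of Inl a \<Rightarrow> B1$i$a | Inr b \<Rightarrow> B2$i$b)"

definition Pi_mat ::
  "real^('n::finite)^'n \<Rightarrow> real^('k::finite)^'n \<Rightarrow> real^('q::finite)^'n \<Rightarrow> real^('n+'k+'q)^('n+'k+'q) \<Rightarrow> complex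
     \<Rightarrow> complex^('k+'q)^('k+'q)" where
  "Pi_mat A B1 B2 Q z =
     (let G = matrix_inv (mat z - cmat A) ** cmat (hcat B1 B2);
          M = (\<chi> r c. case r of Inl i \<Rightarrow> G$i$c | Inr j \<Rightarrow> (if j = c then 1 else 0))
              :: complex^('k+'q)^('n+'k+'q)
      in ctrans M ** cmat Q ** M)"

definition Pi11 :: "complex^(('k::finite)+('q::finite))^('k+'q) \<Rightarrow> complex^'k^'k" where
  "Pi11 P = (\<chi> i j. P $ Inl i $ Inl j)"
definition Pi22 :: "complex^(('k::finite)+('q::finite))^('k+'q) \<Rightarrow> complex^'q^'q" where
  "Pi22 P = (\<chi> i j. P $ Inr i $ Inr j)"

definition Pi_mod :: "real \<Rightarrow> complex^(('k::finite)+('q::finite))^('k+'q) \<Rightarrow> complex^('k+'q)^('k+'q)" where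
  "Pi_mod \<epsilon> P = (\<chi> r c. case r of
        Inl i \<Rightarrow> (case c of Inl j \<Rightarrow> P$r$c | Inr j \<Rightarrow> complex_of_real \<epsilon> * P$r$c)
      | Inr i \<Rightarrow> (case c of Inl j \<Rightarrow> complex_of_real \<epsilon> * P$r$c | Inr j \<Rightarrow> - P$r$c))"

definition stack :: "real^('n::finite) \<Rightarrow> real^('k::finite) \<Rightarrow> real^('q::finite) \<Rightarrow> real^('n+'k+'q)" where
  "stack x v w = (\<chi> i. case i of Inl a \<Rightarrow> x$a | Inr (Inl b) \<Rightarrow> v$b | Inr (Inr c) \<Rightarrow> w$c)"

definition sigma :: "real^(('n::finite)+('k::finite)+('q::finite))^('n+'k+'q) \<Rightarrow> real^'n \<Rightarrow> real^'k \<Rightarrow> real^'q \<Rightarrow> real" where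
  "sigma Q x v w = stack x v w \<bullet> (Q *v stack x v w)"

definition l2 :: "(nat \<Rightarrow> real^('m::finite)) set" where
  "l2 = {u. summable (\<lambda>t. (norm (u t))\<^sup>2)}"

definition l2dist :: "(nat \<Rightarrow> real^('m::finite)) \<Rightarrow> (nat \<Rightarrow> real^'m) \<Rightarrow> real" where
  "l2dist u u' = sqrt (\<Sum>t. (norm (u t - u' t))\<^sup>2)"

fun traj :: "real^('n::finite)^'n \<Rightarrow> real^('k::finite)^'n \<Rightarrow> real^('q::finite)^'n \<Rightarrow> real^'n
             \<Rightarrow> (nat \<Rightarrow> real^'k) \<Rightarrow> (nat \<Rightarrow> real^'q) \<Rightarrow> nat \<Rightarrow> real^'n" where
  "traj A B1 B2 a v w 0 = a"
| "traj A B1 B2 a v w (Suc t) = A *v traj A B1 B2 a v w t + B1 *v v t + B2 *v w t"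

definition gfun :: "real^('n::finite)^'n \<Rightarrow> real^('k::finite)^'n \<Rightarrow> real^('q::finite)^'n \<Rightarrow> real^('n+'k+'q)^('n+'k+'q)
             \<Rightarrow> real^'n \<Rightarrow> (nat \<Rightarrow> real^'k) \<Rightarrow> (nat \<Rightarrow> real^'q) \<Rightarrow> real" where
  "gfun A B1 B2 Q a v w = (\<Sum>t. sigma Q (traj A B1 B2 a v w t) (v t) (w t))"

end

theory Submission
  imports Defs "HOL-Complex_Analysis.Complex_Analysis"
    "HOL-Computational_Algebra.Fundamental_Theorem_Algebra"
begin

text \<open>For \<open>x(0) = 0\<close> the cost is a quadratic form with diagonal parts \<open>p(v) \<ge> 0\<close> and \<open>- r(w) \<le> 0\<close>;
  by Parseval the frequency condition bounds the cross term by \<open>\<epsilon>\<^sup>2 S(v, w)\<^sup>2 \<le> p(v) r(w)\<close>. The forms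
  \<open>p\<close> and \<open>r\<close> need not be coercive, because \<open>\<Pi>\<^sub>1\<^sub>1\<close> and \<open>\<Pi>\<^sub>2\<^sub>2\<close> may degenerate on the circle. However, their
  determinants are rational and not identically zero, so that \<open>\<Pi>\<^sub>1\<^sub>1(z) \<ge> c |\<Prod>(z - \<alpha>\<^sub>i)|\<^sup>2\<close> with
  \<open>|\<alpha>\<^sub>i| \<le> 1\<close>; inverting the factors one after another in the time domain yields
  \<open>|v(t)| \<le> L (1 + t)\<^sup>m p(v)\<^sup>1\<^sup>/\<^sup>2\<close>. The response to the initial state decays exponentially, which
  makes the linear terms of the cost bounded for the seminorms \<open>p\<^sup>1\<^sup>/\<^sup>2\<close> and \<open>r\<^sup>1\<^sup>/\<^sup>2\<close>. With respect to
  these seminorms the game is strongly convex-concave. Finiteness and continuity are then immediate,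
  and a near-minimiser \<open>v\<close> of \<open>sup\<^sub>w g\<close> together with a near-maximiser \<open>w\<close> of \<open>g(v, \<cdot>)\<close> is an
  approximate saddle point.\<close>

no_notation fps_nth (infixl "$" 75)

section \<open>Quadratic games on sequence spaces\<close>

text \<open>Without coercivity, optimal strategies need not exist in \<open>l2\<close> and
  near-optimal ones need not stay bounded there, so weak compactness gives no saddle point.
  Boundedness survives only in the seminorms; this is why the abstract game asks for bounds of
  \<open>l\<close> and \<open>m\<close> by \<open>p\<close> and \<open>r\<close>, and why it proves
  continuity for a topology coarser than the norm topology. The number \<epsilon> may be tiny: it
  enters as \<open>\<kappa> = 1 / \<epsilon>\<^sup>2\<close>, and no smallness of \<kappa> is asked
  for, because the diagonal parts have opposite signs and maximising over \<open>w\<close> can only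
  add convexity in \<open>v\<close>. Definiteness at the single point \<open>z0\<close> excludes an
  identically vanishing determinant. A zero on the circle is the critical case: inverting its factor
  gives a filter with a pole of modulus one, hence polynomial growth. Parseval's identity is proved
  for absolutely summable sequences. The form inequalities are therefore shown for these first and
  reach \<open>l2\<close> by truncating the inputs.\<close>

text \<open>A quadratic in \<open>s\<close> that never becomes negative has no positive
  discriminant. The Cauchy-Schwarz type estimates for the forms come from this, as do the derivative
  bounds at near-optimal points; \<open>c = 0\<close> is included because the forms may
  degenerate.\<close>

lemma discriminant_le:
  fixes a b c :: real
  assumes "\<And>s. 0 \<le> a + 2 * s * b + s\<^sup>2 * c" "0 \<le> c"
  shows "b\<^sup>2 \<le> a * c"
proof (cases "c = 0")
  case True
  have "b = 0"
  proof (rule ccontr)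
    assume b: "b \<noteq> 0"
    \<comment> \<open>At this \<open>s\<close> the right-hand side equals -1.\<close>
    have "0 \<le> a + 2 * (- (a + 1) / (2 * b)) * b"
      using assms(1)[of "- (a + 1) / (2 * b)"] True by simp
    with b show False by (simp add: field_simps)
  qed
  with True show ?thesis by simp
next
  case False
  with assms(2) have c: "c > 0" by simp
  have "0 \<le> a + 2 * (- b / c) * b + (- b / c)\<^sup>2 * c" by (rule assms(1))
  also have "\<dots> = a - b\<^sup>2 / c" using c by (simp add: field_simps power2_eq_square)
  finally show ?thesis using c by (simp add: field_simps)
qed

lemma abs_le_sqrt_mult:
  fixes a b x :: real
  assumes "x\<^sup>2 \<le> a * b" shows "\<bar>x\<bar> \<le> sqrt a * sqrt b"
  using assms by (metis real_sqrt_abs real_sqrt_le_mono real_sqrt_mult)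

lemma twice_le_add_of_square_le:
  fixes a b x :: real
  assumes "x\<^sup>2 \<le> a * b" "0 \<le> a" "0 \<le> b" shows "\<bar>2 * x\<bar> \<le> a + b"
proof (rule power2_le_imp_le)
  have "(a + b)\<^sup>2 - 4 * (a * b) = (a - b)\<^sup>2" by (simp add: power2_eq_square algebra_simps)
  then have "4 * (a * b) \<le> (a + b)\<^sup>2" using zero_le_power2[of "a - b"] by linarith
  then show "\<bar>2 * x\<bar>\<^sup>2 \<le> (a + b)\<^sup>2" using assms(1) by (simp add: power_mult_distrib)
qed (use assms in auto)

text \<open>The players move in sets of sequences closed under linear combinations, since function types
  carry no vector space structure in the library; \<open>pb\<close> and \<open>rb\<close> are the polar forms of \<open>p\<close> and \<open>r\<close>.\<close>

locale quad_game =
  fixes X :: "(nat \<Rightarrow> 'v::real_vector) set" and Y :: "(nat \<Rightarrow> 'w::real_vector) set"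
    and p l :: "(nat \<Rightarrow> 'v) \<Rightarrow> real" and pb :: "(nat \<Rightarrow> 'v) \<Rightarrow> (nat \<Rightarrow> 'v) \<Rightarrow> real"
    and r m :: "(nat \<Rightarrow> 'w) \<Rightarrow> real" and rb :: "(nat \<Rightarrow> 'w) \<Rightarrow> (nat \<Rightarrow> 'w) \<Rightarrow> real"
    and S :: "(nat \<Rightarrow> 'v) \<Rightarrow> (nat \<Rightarrow> 'w) \<Rightarrow> real"
    and c \<kappa> K :: real
  assumes X0: "(\<lambda>t. 0) \<in> X" and Y0: "(\<lambda>t. 0) \<in> Y"
    and X_add: "\<And>v h s. v \<in> X \<Longrightarrow> h \<in> X \<Longrightarrow> (\<lambda>t. v t + s *\<^sub>R h t) \<in> X"
    and Y_add: "\<And>v h s. v \<in> Y \<Longrightarrow> h \<in> Y \<Longrightarrow> (\<lambda>t. v t + s *\<^sub>R h t) \<in> Y"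
    and p_nonneg: "\<And>v. v \<in> X \<Longrightarrow> 0 \<le> p v"
    and r_nonneg: "\<And>w. w \<in> Y \<Longrightarrow> 0 \<le> r w"
    and p_expand: "\<And>v h s. v \<in> X \<Longrightarrow> h \<in> X \<Longrightarrow>
          p (\<lambda>t. v t + s *\<^sub>R h t) = p v + 2 * s * pb v h + s\<^sup>2 * p h"
    and r_expand: "\<And>v h s. v \<in> Y \<Longrightarrow> h \<in> Y \<Longrightarrow>
          r (\<lambda>t. v t + s *\<^sub>R h t) = r v + 2 * s * rb v h + s\<^sup>2 * r h"
    and S_lin1: "\<And>v h s w. v \<in> X \<Longrightarrow> h \<in> X \<Longrightarrow> w \<in> Y \<Longrightarrow>
          S (\<lambda>t. v t + s *\<^sub>R h t) w = S v w + s * S h w"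
    and S_lin2: "\<And>w h s v. w \<in> Y \<Longrightarrow> h \<in> Y \<Longrightarrow> v \<in> X \<Longrightarrow>
          S v (\<lambda>t. w t + s *\<^sub>R h t) = S v w + s * S v h"
    and l_lin: "\<And>v h s. v \<in> X \<Longrightarrow> h \<in> X \<Longrightarrow> l (\<lambda>t. v t + s *\<^sub>R h t) = l v + s * l h"
    and m_lin: "\<And>v h s. v \<in> Y \<Longrightarrow> h \<in> Y \<Longrightarrow> m (\<lambda>t. v t + s *\<^sub>R h t) = m v + s * m h"
    and \<kappa>_nonneg: "0 \<le> \<kappa>" and K_nonneg: "0 \<le> K"
    and S_bound: "\<And>v w. v \<in> X \<Longrightarrow> w \<in> Y \<Longrightarrow> (S v w)\<^sup>2 \<le> \<kappa> * p v * r w"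
    and l_bound: "\<And>v. v \<in> X \<Longrightarrow> (l v)\<^sup>2 \<le> K * p v"
    and m_bound: "\<And>w. w \<in> Y \<Longrightarrow> (m w)\<^sup>2 \<le> K * r w"
begin

definition g :: "(nat \<Rightarrow> 'v) \<Rightarrow> (nat \<Rightarrow> 'w) \<Rightarrow> real" where
  "g v w = p v + 2 * S v w - r w + 2 * l v + 2 * m w + c"

definition inf_val :: "(nat \<Rightarrow> 'w) \<Rightarrow> real" where
  "inf_val w = Inf ((\<lambda>v. g v w) ` X)"

text \<open>Exchanging the players turns the cost into \<open>- g\<close>. The bounds involve only
  squares of \<open>S\<close>, \<open>l\<close> and \<open>m\<close>, so they survive the change of
  sign. The constant \<open>c\<close> is no argument of the locale predicate; the interpretation
  further down sets it to \<open>- c\<close>.\<close>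

lemma dual: "quad_game Y X r (\<lambda>w. - m w) rb p (\<lambda>v. - l v) pb (\<lambda>w v. - S v w) \<kappa> K"
  by (rule quad_game.intro)
    (use X0 Y0 X_add Y_add p_nonneg r_nonneg p_expand r_expand S_lin1 S_lin2 l_lin m_lin
      \<kappa>_nonneg K_nonneg S_bound l_bound m_bound in \<open>auto simp: mult.commute mult.left_commute\<close>)

text \<open>Expanding at \<open>v = h = 0\<close> with \<open>s = 1\<close> and with
  \<open>s = 2\<close> gives two independent linear equations for \<open>p\<close> and
  \<open>pb\<close> at zero.\<close>

lemma p_zero: "p (\<lambda>t. 0) = 0"
  using p_expand[OF X0 X0, of 1] p_expand[OF X0 X0, of 2] by simp

lemma l_zero: "l (\<lambda>t. 0) = 0"
  using l_lin[OF X0 X0, of 1] by simp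

lemma S_zero: "w \<in> Y \<Longrightarrow> S (\<lambda>t. 0) w = 0"
  using S_lin1[OF X0 X0, of w 1] by simp

lemma S_abs_le:
  assumes "v \<in> X" "w \<in> Y" shows "\<bar>S v w\<bar> \<le> sqrt \<kappa> * sqrt (p v) * sqrt (r w)"
  using abs_le_sqrt_mult[OF S_bound[OF assms]] by (simp add: real_sqrt_mult)

lemma l_abs_le: "v \<in> X \<Longrightarrow> \<bar>l v\<bar> \<le> sqrt K * sqrt (p v)"
  by (rule abs_le_sqrt_mult[OF l_bound])

lemma m_abs_le: "w \<in> Y \<Longrightarrow> \<bar>m w\<bar> \<le> sqrt K * sqrt (r w)"
  by (rule abs_le_sqrt_mult[OF m_bound])

lemma rb_abs_le:
  assumes "w \<in> Y" "y \<in> Y" shows "\<bar>rb w y\<bar> \<le> sqrt (r w) * sqrt (r y)"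
proof (rule abs_le_sqrt_mult, rule discriminant_le)
  show "0 \<le> r w + 2 * s * rb w y + s\<^sup>2 * r y" for s
    using r_expand[OF assms, of s] r_nonneg[OF Y_add[OF assms, of s]] by simp
qed (rule r_nonneg[OF assms(2)])

text \<open>Coercivity in the seminorm \<open>sqrt (p v)\<close>: the cross term and the linear term
  grow only linearly in it. Completing the square then bounds the infimum.\<close>

lemma g_lower:
  assumes "v \<in> X" "w \<in> Y"
  shows "p v - 2 * (sqrt \<kappa> * sqrt (r w) + sqrt K) * sqrt (p v) + g (\<lambda>t. 0) w \<le> g v w"
  using S_abs_le[OF assms] l_abs_le[OF assms(1)] p_zero l_zero S_zero[OF assms(2)]
  by (auto simp: g_def algebra_simps)

lemma g_bdd_below:
  assumes "w \<in> Y"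
  shows "g (\<lambda>t. 0) w - (sqrt \<kappa> * sqrt (r w) + sqrt K)\<^sup>2 \<le> inf_val w"
    and "bdd_below ((\<lambda>v. g v w) ` X)"
proof -
  define L where "L = sqrt \<kappa> * sqrt (r w) + sqrt K"
  have *: "g (\<lambda>t. 0) w - L\<^sup>2 \<le> g v w" if "v \<in> X" for v
  proof -
    have "0 \<le> (sqrt (p v) - L)\<^sup>2" by simp
    also have "\<dots> = p v - 2 * L * sqrt (p v) + L\<^sup>2"
      using p_nonneg[OF that] by (simp add: power2_diff algebra_simps)
    finally show ?thesis using g_lower[OF that assms] by (simp add: L_def)
  qed
  then show "bdd_below ((\<lambda>v. g v w) ` X)" by (auto intro!: bdd_belowI2)
  show "g (\<lambda>t. 0) w - (sqrt \<kappa> * sqrt (r w) + sqrt K)\<^sup>2 \<le> inf_val w"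
    unfolding inf_val_def L_def[symmetric] using X0 * by (intro cINF_greatest) auto
qed

lemma inf_val_le: "v \<in> X \<Longrightarrow> w \<in> Y \<Longrightarrow> inf_val w \<le> g v w"
  unfolding inf_val_def by (rule cINF_lower[OF g_bdd_below(2)])

lemma near_minimizer:
  assumes "w \<in> Y" "0 < e"
  obtains v where "v \<in> X" "g v w < inf_val w + e"
proof -
  have "\<exists>y\<in>(\<lambda>v. g v w) ` X. y < inf_val w + e"
    using cInf_lessD[of "(\<lambda>v. g v w) ` X" "inf_val w + e"] X0 assms(2)
    by (auto simp: inf_val_def)
  then show thesis using that by auto
qed

lemma INF_ereal: "w \<in> Y \<Longrightarrow> (INF v\<in>X. ereal (g v w)) = ereal (inf_val w)"
  using ereal_Inf'[OF g_bdd_below(2), of w] X0 by (fastforce simp: inf_val_def image_image)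

text \<open>The zero input competes, so \<open>q = sqrt (p v)\<close> satisfies
  \<open>q * q - 2 * L * q \<le> 1\<close>. The slack 1 is arbitrary; what matters is that the bound
  depends on \<open>w\<close> only through \<open>r w\<close>.\<close>

lemma near_minimizer_bounded:
  assumes "v \<in> X" "w \<in> Y" "g v w \<le> inf_val w + 1"
  shows "sqrt (p v) \<le> 2 * (sqrt \<kappa> * sqrt (r w) + sqrt K) + 1"
proof (rule ccontr)
  define L where "L = sqrt \<kappa> * sqrt (r w) + sqrt K"
  define q where "q = sqrt (p v)"
  have L: "0 \<le> L" using \<kappa>_nonneg K_nonneg r_nonneg[OF assms(2)] by (simp add: L_def)
  assume "\<not> ?thesis"
  then have q: "2 * L + 1 < q" by (simp add: L_def q_def)
  have qq: "p v = q * q" using p_nonneg[OF assms(1)] by (simp add: q_def)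
  have "p v - 2 * L * q \<le> 1"
    using g_lower[OF assms(1,2)] assms(3) inf_val_le[OF X0 assms(2)] by (simp add: L_def q_def)
  then have "(q - 2 * L) * q \<le> 1" by (simp add: qq algebra_simps)
  moreover have "1 * 1 < (q - 2 * L) * q" using q L by (intro mult_strict_mono) auto
  ultimately show False by simp
qed

text \<open>The assumption \<open>r y \<le> 1\<close> lets the quadratic term be absorbed into
  \<open>sqrt (r y)\<close>, so the whole change is linear in the seminorm of
  \<open>y\<close>.\<close>

lemma g_increment:
  assumes "v \<in> X" "w \<in> Y" "y \<in> Y" "sqrt (p v) \<le> M" "r y \<le> 1"
  shows "\<bar>g v (\<lambda>t. w t + y t) - g v w\<bar>
    \<le> (2 * sqrt \<kappa> * M + 2 * sqrt (r w) + 1 + 2 * sqrt K) * sqrt (r y)"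
proof -
  let ?q = "sqrt (r y)"
  have q: "0 \<le> ?q" "?q \<le> 1" using r_nonneg[OF assms(3)] assms(5) by auto
  have "r y = ?q * ?q" using r_nonneg[OF assms(3)] by simp
  also have "\<dots> \<le> 1 * ?q" using q by (intro mult_right_mono) auto
  finally have r: "r y \<le> ?q" by simp
  have S: "\<bar>S v y\<bar> \<le> sqrt \<kappa> * M * ?q"
    using S_abs_le[OF assms(1,3)] mult_left_mono[OF assms(4), of "sqrt \<kappa> * ?q"] q \<kappa>_nonneg
    by (simp add: mult.commute mult.left_commute)
  have "g v (\<lambda>t. w t + y t) - g v w = 2 * S v y - 2 * rb w y - r y + 2 * m y"
    using S_lin2[OF assms(2,3,1), of 1] r_expand[OF assms(2,3), of 1] m_lin[OF assms(2,3), of 1]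
    by (simp add: g_def)
  then show ?thesis
    using S rb_abs_le[OF assms(2,3)] m_abs_le[OF assms(3)] r r_nonneg[OF assms(3)]
    by (simp add: algebra_simps abs_if split: if_splits)
qed

text \<open>Near-minimisers for \<open>w\<close> and for a nearby \<open>w'\<close> lie in one
  common \<open>p\<close>-ball, on which \<open>g\<close> varies little between \<open>w\<close> and
  \<open>w'\<close>. Testing each of them at the other point gives the two inequalities.\<close>

lemma inf_val_continuous:
  assumes w: "w \<in> Y" and e: "0 < e"
  obtains \<eta> where "0 < \<eta>"
    "\<forall>w'. w' \<in> Y \<longrightarrow> r (\<lambda>t. w' t - w t) < \<eta> \<longrightarrow> \<bar>inf_val w' - inf_val w\<bar> < e"
proof -
  define R where "R = sqrt (r w) + 1"
  define M where "M = 2 * (sqrt \<kappa> * R + sqrt K) + 1"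
  define N where "N = 2 * sqrt \<kappa> * M + 2 * sqrt (r w) + 1 + 2 * sqrt K"
  have R: "0 \<le> R" using r_nonneg[OF w] by (simp add: R_def)
  have M: "0 \<le> M" using R \<kappa>_nonneg K_nonneg by (simp add: M_def)
  have N: "1 \<le> N" using M \<kappa>_nonneg K_nonneg r_nonneg[OF w] by (simp add: N_def)
  \<comment> \<open>The first entry of the minimum supplies \<open>r y \<le> 1\<close> for
    \<open>g_increment\<close>, the second makes the increment smaller than \<open>e / 2\<close>.
    The square appears because closeness is measured by \<open>r\<close>, not by its root.\<close>
  define \<eta> where "\<eta> = (min 1 (e / (2 * N)))\<^sup>2"
  have "0 < \<eta>" using e N unfolding \<eta>_def by (intro zero_less_power) simp
  moreover have "\<bar>inf_val w' - inf_val w\<bar> < e" if w': "w' \<in> Y" and close: "r (\<lambda>t. w' t - w t) < \<eta>" for w'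
  proof -
    define y where "y = (\<lambda>t. w' t - w t)"
    have y: "y \<in> Y" using Y_add[OF w' w, of "-1"] by (simp add: y_def)
    have ry: "sqrt (r y) < min 1 (e / (2 * N))"
      using close e N r_nonneg[OF y] unfolding \<eta>_def y_def[symmetric] by (intro real_less_lsqrt) auto
    have r1: "r y \<le> 1" using ry by simp
    have w'_eq: "w' = (\<lambda>t. w t + y t)" by (simp add: y_def)
    have small: "N * sqrt (r y) < e / 2" using ry N by (simp add: field_simps)
    have "r w' \<le> R\<^sup>2"
    proof -
      have "r w' = r w + 2 * rb w y + r y" using r_expand[OF w y, of 1] w'_eq by simp
      also have "\<dots> \<le> (sqrt (r w))\<^sup>2 + 2 * (sqrt (r w) * sqrt (r y)) + (sqrt (r y))\<^sup>2"
        using rb_abs_le[OF w y] r_nonneg w y by simp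
      also have "\<dots> = (sqrt (r w) + sqrt (r y))\<^sup>2" by (simp add: power2_sum)
      also have "\<dots> \<le> R\<^sup>2" using ry r_nonneg[OF w] r_nonneg[OF y] by (intro power_mono) (auto simp: R_def)
      finally show ?thesis .
    qed
    then have rw': "sqrt (r w') \<le> R" using R by (simp add: real_le_lsqrt r_nonneg[OF w'])
    have rw: "sqrt (r w) \<le> R" by (simp add: R_def)
    have bound: "sqrt (p v) \<le> M" if "v \<in> X" "u \<in> Y" "sqrt (r u) \<le> R" "g v u \<le> inf_val u + 1" for v u
    proof -
      have "sqrt \<kappa> * sqrt (r u) \<le> sqrt \<kappa> * R" using that(3) \<kappa>_nonneg by (intro mult_left_mono) auto
      then show ?thesis using near_minimizer_bounded[OF that(1,2,4)] by (simp add: M_def)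
    qed
    have diff: "\<bar>g v w' - g v w\<bar> < e / 2" if "v \<in> X" "sqrt (p v) \<le> M" for v
      using g_increment[OF that(1) w y that(2) r1] small by (simp add: N_def w'_eq)
    \<comment> \<open>Slack at most 1 to remain in the \<open>p\<close>-ball, at most
      \<open>e / 2\<close> for the final estimate.\<close>
    have e1: "0 < min 1 (e / 2)" using e by simp
    obtain v where v: "v \<in> X" "g v w < inf_val w + min 1 (e / 2)" using near_minimizer[OF w e1] .
    obtain v' where v': "v' \<in> X" "g v' w' < inf_val w' + min 1 (e / 2)" using near_minimizer[OF w' e1] .
    have "inf_val w' < inf_val w + e"
      using diff[OF v(1) bound[OF v(1) w rw]] v inf_val_le[OF v(1) w'] by linarith
    moreover have "inf_val w < inf_val w' + e"
      using diff[OF v'(1) bound[OF v'(1) w' rw']] v' inf_val_le[OF v'(1) w] by linarith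
    ultimately show ?thesis by linarith
  qed
  ultimately show thesis by (intro that) auto
qed

text \<open>Here \<open>w\<close> nearly maximises \<open>g v\<close> for a near-minimiser \<open>v\<close> of the upper envelope. Near-maximality
  bounds the derivative \<open>E\<close> in \<open>w\<close> by \<open>r\<close>; feeding this into the envelope along the line
  \<open>v + s h\<close> bounds the derivative \<open>D\<close> in \<open>v\<close> by \<open>p\<close>, so \<open>v\<close> nearly minimises \<open>g (\<cdot>) w\<close>.\<close>

lemma minimax_aux:
  assumes bdd: "bdd_below ((\<lambda>v. Sup (g v ` Y)) ` X)"
    and ub: "\<And>v. v \<in> X \<Longrightarrow> bdd_above (g v ` Y)"
    and \<delta>: "0 < \<delta>"
  obtains w where "w \<in> Y"
    "Inf ((\<lambda>v. Sup (g v ` Y)) ` X) - (4 + 6 * \<kappa>) * \<delta> \<le> inf_val w"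
proof -
  let ?\<psi> = "\<lambda>v. Sup (g v ` Y)"
  define M where "M = Inf (?\<psi> ` X)"
  have M_le: "M \<le> ?\<psi> v" if "v \<in> X" for v
    unfolding M_def using bdd that by (rule cINF_lower)
  have g_le: "g v w \<le> ?\<psi> v" if "v \<in> X" "w \<in> Y" for v w
    using that ub by (auto intro: cSUP_upper)
  have "\<exists>y\<in>?\<psi> ` X. y < M + \<delta>"
    using cInf_lessD[of "?\<psi> ` X" "M + \<delta>"] X0 \<delta> by (auto simp: M_def)
  then obtain v where v: "v \<in> X" "?\<psi> v < M + \<delta>" by auto
  have "\<exists>y\<in>g v ` Y. ?\<psi> v - \<delta> < y"
    using less_cSupD[of "g v ` Y" "?\<psi> v - \<delta>"] Y0 \<delta> by auto
  then obtain w where w: "w \<in> Y" "?\<psi> v - \<delta> < g v w" by auto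
  \<comment> \<open>\<open>2 * E\<close> and \<open>2 * D\<close> are the directional derivatives of
    \<open>g\<close> at the pair \<open>v\<close>, \<open>w\<close> in the second and in the first
    argument.\<close>
  define E where "E y = S v y - rb w y + m y" for y
  define D where "D h = pb v h + S h w + l h" for h
  \<comment> \<open>Along the line \<open>w + s y\<close> the cost is a concave quadratic that
    exceeds its value at \<open>s = 0\<close> by less than \<delta>.\<close>
  have E: "(E y)\<^sup>2 \<le> \<delta> * r y" if y: "y \<in> Y" for y
  proof -
    have "0 \<le> \<delta> + 2 * s * (- E y) + s\<^sup>2 * r y" for s
    proof -
      have "g v (\<lambda>t. w t + s *\<^sub>R y t) = g v w + 2 * s * E y - s\<^sup>2 * r y"
        by (simp add: g_def E_def S_lin2[OF w(1) y v(1)] r_expand[OF w(1) y] m_lin[OF w(1) y] algebra_simps)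
      then show ?thesis using g_le[OF v(1) Y_add[OF w(1) y, of s]] w(2) by simp
    qed
    from discriminant_le[OF this r_nonneg[OF y]] show ?thesis by simp
  qed
  have D: "(D h)\<^sup>2 \<le> 3 * \<delta> * ((1 + 2 * \<kappa>) * p h)" if h: "h \<in> X" for h
  proof (rule discriminant_le)
    fix s
    let ?vh = "\<lambda>t. v t + s *\<^sub>R h t"
    have vh: "?vh \<in> X" by (rule X_add[OF v(1) h])
    \<comment> \<open>A quadratic majorant of the upper envelope along \<open>v + s h\<close>. Its
      curvature exceeds \<open>p h\<close> by \<open>2 * \<kappa> * p h\<close>, the price of
      maximising the mixed term against half of \<open>r y\<close>.\<close>
    have "?\<psi> ?vh \<le> g v w + 2 * \<delta> + 2 * s * D h + s\<^sup>2 * ((1 + 2 * \<kappa>) * p h)"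
    proof (rule cSUP_least)
      fix w' assume w': "w' \<in> Y"
      define y where "y = (\<lambda>t. w' t - w t)"
      have y: "y \<in> Y" using Y_add[OF w' w(1), of "-1"] by (simp add: y_def)
      have w'_eq: "w' = (\<lambda>t. w t + 1 *\<^sub>R y t)" by (simp add: y_def)
      have "g ?vh w' = g v w + 2 * E y - r y + 2 * (s * S h y) + 2 * s * D h + s\<^sup>2 * p h"
        unfolding w'_eq g_def E_def D_def S_lin2[OF w(1) y vh] r_expand[OF w(1) y] m_lin[OF w(1) y]
          S_lin1[OF v(1) h w(1)] S_lin1[OF v(1) h y] l_lin[OF v(1) h] p_expand[OF v(1) h]
        by (simp add: algebra_simps)
      \<comment> \<open>The term \<open>- r y\<close> pays one half for \<open>E\<close> and one
        half for the mixed term; hence the factors 2 in \<open>2 * \<delta>\<close> and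
        \<open>2 * s\<^sup>2 * \<kappa>\<close>.\<close>
      moreover have "\<bar>2 * E y\<bar> \<le> 2 * \<delta> + r y / 2"
        by (rule twice_le_add_of_square_le) (use E[OF y] \<delta> r_nonneg[OF y] in auto)
      moreover have "\<bar>2 * (s * S h y)\<bar> \<le> 2 * s\<^sup>2 * \<kappa> * p h + r y / 2"
        by (rule twice_le_add_of_square_le)
          (use mult_left_mono[OF S_bound[OF h y], of "s\<^sup>2"] \<kappa>_nonneg p_nonneg[OF h] r_nonneg[OF y]
            in \<open>auto simp: power_mult_distrib mult_ac\<close>)
      ultimately show "g ?vh w' \<le> g v w + 2 * \<delta> + 2 * s * D h + s\<^sup>2 * ((1 + 2 * \<kappa>) * p h)"
        by (simp add: algebra_simps abs_if split: if_splits)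
    qed (use Y0 in auto)
    \<comment> \<open>\<open>3 * \<delta>\<close> consists of the \<open>2 * \<delta>\<close> just
      obtained and the slack of \<open>v\<close> as a near-minimiser.\<close>
    moreover have "g v w \<le> ?\<psi> v" by (rule g_le[OF v(1) w(1)])
    ultimately show "0 \<le> 3 * \<delta> + 2 * s * D h + s\<^sup>2 * ((1 + 2 * \<kappa>) * p h)"
      using M_le[OF vh] v(2) by simp
  qed (use \<kappa>_nonneg p_nonneg[OF h] in auto)
  \<comment> \<open>The expansion in \<open>h\<close> is exact, so the convex term
    \<open>p h\<close> can absorb the derivative \<open>D\<close>.\<close>
  have "g v w - 3 * \<delta> * (1 + 2 * \<kappa>) \<le> inf_val w"
    unfolding inf_val_def
  proof (rule cINF_greatest)
    fix v' assume v': "v' \<in> X"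
    define h where "h = (\<lambda>t. v' t - v t)"
    have h: "h \<in> X" using X_add[OF v' v(1), of "-1"] by (simp add: h_def)
    have v'_eq: "v' = (\<lambda>t. v t + 1 *\<^sub>R h t)" by (simp add: h_def)
    have "g v' w = g v w + 2 * D h + p h"
      unfolding v'_eq g_def D_def S_lin1[OF v(1) h w(1)] l_lin[OF v(1) h] p_expand[OF v(1) h]
      by (simp add: algebra_simps)
    moreover have "\<bar>2 * D h\<bar> \<le> 3 * \<delta> * (1 + 2 * \<kappa>) + p h"
      by (rule twice_le_add_of_square_le) (use D[OF h] \<delta> \<kappa>_nonneg p_nonneg[OF h] in auto)
    ultimately show "g v w - 3 * \<delta> * (1 + 2 * \<kappa>) \<le> g v' w" by linarith
  qed (use X0 in auto)
  \<comment> \<open>\<open>4 + 6 * \<kappa>\<close> adds \<open>3 * (1 + 2 * \<kappa>)\<close> and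
    1, the slack of \<open>w\<close> as a near-maximiser.\<close>
  then have "M - (4 + 6 * \<kappa>) * \<delta> \<le> inf_val w"
    using w(2) M_le[OF v(1)] by (simp add: algebra_simps)
  with w(1) show thesis by (intro that) (auto simp: M_def)
qed

end

section \<open>The maximising player and the minimax equality\<close>

context quad_game
begin

interpretation dual: quad_game Y X r "\<lambda>w. - m w" rb p "\<lambda>v. - l v" pb "\<lambda>w v. - S v w" "- c" \<kappa> K
  by (rule dual)

lemma dual_g: "dual.g w v = - g v w"
  by (simp add: dual.g_def g_def)

definition sup_val :: "(nat \<Rightarrow> 'v) \<Rightarrow> real" where
  "sup_val v = Sup (g v ` Y)"

lemma sup_val_eq: "sup_val v = - dual.inf_val v"
  by (simp add: sup_val_def dual.inf_val_def dual_g Inf_real_def image_image)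

lemma SUP_ereal: "v \<in> X \<Longrightarrow> (SUP w\<in>Y. ereal (g v w)) = ereal (sup_val v)"
  using dual.INF_ereal[of v]
  by (simp add: dual_g sup_val_eq ereal_INF_uminus_eq ereal_uminus_eq_reorder flip: uminus_ereal.simps)

lemma sup_val_continuous:
  assumes "v \<in> X" and "0 < e"
  obtains \<eta> where "0 < \<eta>"
    "\<forall>v'. v' \<in> X \<longrightarrow> p (\<lambda>t. v' t - v t) < \<eta> \<longrightarrow> \<bar>sup_val v' - sup_val v\<bar> < e"
proof -
  obtain \<eta> where "0 < \<eta>" and
    \<eta>: "\<forall>v'. v' \<in> X \<longrightarrow> p (\<lambda>t. v' t - v t) < \<eta> \<longrightarrow> \<bar>dual.inf_val v' - dual.inf_val v\<bar> < e"
    using dual.inf_val_continuous[OF assms] .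
  show thesis
  proof (rule that[OF \<open>0 < \<eta>\<close>], intro allI impI)
    fix v' assume "v' \<in> X" "p (\<lambda>t. v' t - v t) < \<eta>"
    with \<eta> have "\<bar>dual.inf_val v' - dual.inf_val v\<bar> < e" by blast
    then show "\<bar>sup_val v' - sup_val v\<bar> < e" unfolding sup_val_eq by linarith
  qed
qed

text \<open>Weak duality holds for every game. For the converse, \<open>minimax_aux\<close> supplies
  for each tolerance a \<open>w\<close> whose lower envelope nearly reaches the upper value, so
  approximate saddle points suffice.\<close>

lemma minimax:
  "(INF v\<in>X. SUP w\<in>Y. ereal (g v w)) = (SUP w\<in>Y. INF v\<in>X. ereal (g v w))"
proof (rule antisym)
  have ub: "bdd_above (g v ` Y)" if "v \<in> X" for v
    using dual.g_bdd_below(2)[OF that] unfolding dual_g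
    by (simp add: bdd_below_uminus_image)
  \<comment> \<open>Uniform in \<open>v\<close>: the reply \<open>w = 0\<close> already secures this
    much.\<close>
  have lower: "inf_val (\<lambda>t. 0) \<le> sup_val v" if "v \<in> X" for v
    using inf_val_le[OF that Y0] cSUP_upper[OF Y0 ub[OF that]] by (simp add: sup_val_def)
  have bdd: "bdd_below (sup_val ` X)" using lower by (rule bdd_belowI2)
  define M where "M = Inf (sup_val ` X)"
  have eq: "(INF v\<in>X. SUP w\<in>Y. ereal (g v w)) = ereal M"
    using ereal_Inf'[OF bdd, symmetric] X0
    by (simp add: M_def SUP_ereal image_image ex_in_conv[symmetric] exI[of _ "\<lambda>t. 0"] cong: image_cong_simp)
  show "(INF v\<in>X. SUP w\<in>Y. ereal (g v w)) \<le> (SUP w\<in>Y. INF v\<in>X. ereal (g v w))"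
    unfolding eq
  proof (rule ereal_le_epsilon2)
    fix e :: real assume "0 < e"
    then have "0 < e / (4 + 6 * \<kappa>)" using \<kappa>_nonneg by simp
    from minimax_aux[OF _ ub this] bdd obtain w where w: "w \<in> Y"
      "M - (4 + 6 * \<kappa>) * (e / (4 + 6 * \<kappa>)) \<le> inf_val w"
      by (auto simp: M_def sup_val_def[abs_def])
    have "4 + 6 * \<kappa> \<noteq> 0" using \<kappa>_nonneg by linarith
    with w have "ereal M \<le> ereal (inf_val w) + ereal e" by simp
    also have "\<dots> \<le> (SUP w\<in>Y. INF v\<in>X. ereal (g v w)) + ereal e"
      using w(1) by (intro add_right_mono SUP_upper2[OF w(1)]) (simp add: INF_ereal)
    finally show "ereal M \<le> (SUP w\<in>Y. INF v\<in>X. ereal (g v w)) + ereal e" .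
  qed
next
  show "(SUP w\<in>Y. INF v\<in>X. ereal (g v w)) \<le> (INF v\<in>X. SUP w\<in>Y. ereal (g v w))"
    by (intro SUP_least INF_greatest) (rule order_trans[OF INF_lower SUP_upper])
qed

end

section \<open>Rational functions and semidefinite matrices on the unit circle\<close>

text \<open>Only values on the circle are constrained. This admits conjugation, and with it the
  conjugate transpose inside \<open>Pi_mat\<close>, which is not rational on the whole
  plane.\<close>

definition circle_rational :: "(complex \<Rightarrow> complex) \<Rightarrow> bool" where
  "circle_rational f \<longleftrightarrow> (\<exists>p d. \<forall>z. cmod z = 1 \<longrightarrow> poly d z \<noteq> 0 \<and> f z = poly p z / poly d z)"

lemma circle_rationalI:
  "(\<And>z. cmod z = 1 \<Longrightarrow> poly d z \<noteq> 0 \<and> f z = poly p z / poly d z) \<Longrightarrow> circle_rational f"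
  unfolding circle_rational_def by blast

lemma circle_rational_cong:
  assumes "circle_rational f" "\<And>z. cmod z = 1 \<Longrightarrow> f z = g z"
  shows "circle_rational g"
  using assms unfolding circle_rational_def by metis

lemma circle_rational_const: "circle_rational (\<lambda>z. c)"
  by (rule circle_rationalI[of 1 _ "[:c:]"]) simp

lemma circle_rational_ident: "circle_rational (\<lambda>z. z)"
  by (rule circle_rationalI[of 1 _ "[:0, 1:]"]) simp

lemma circle_rational_add:
  assumes "circle_rational f" "circle_rational g"
  shows "circle_rational (\<lambda>z. f z + g z)"
proof -
  from assms obtain p d p' d' where
    "\<forall>z. cmod z = 1 \<longrightarrow> poly d z \<noteq> 0 \<and> f z = poly p z / poly d z"
    "\<forall>z. cmod z = 1 \<longrightarrow> poly d' z \<noteq> 0 \<and> g z = poly p' z / poly d' z"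
    unfolding circle_rational_def by blast
  then show ?thesis
    by (intro circle_rationalI[of "d * d'" _ "p * d' + p' * d"]) (auto simp: field_simps)
qed

lemma circle_rational_mult:
  assumes "circle_rational f" "circle_rational g"
  shows "circle_rational (\<lambda>z. f z * g z)"
proof -
  from assms obtain p d p' d' where
    "\<forall>z. cmod z = 1 \<longrightarrow> poly d z \<noteq> 0 \<and> f z = poly p z / poly d z"
    "\<forall>z. cmod z = 1 \<longrightarrow> poly d' z \<noteq> 0 \<and> g z = poly p' z / poly d' z"
    unfolding circle_rational_def by blast
  then show ?thesis
    by (intro circle_rationalI[of "d * d'" _ "p * p'"]) auto
qed

lemma circle_rational_inverse:
  assumes "circle_rational f" "\<And>z. cmod z = 1 \<Longrightarrow> f z \<noteq> 0"
  shows "circle_rational (\<lambda>z. inverse (f z))"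
proof -
  from assms(1) obtain p d where
    "\<forall>z. cmod z = 1 \<longrightarrow> poly d z \<noteq> 0 \<and> f z = poly p z / poly d z"
    unfolding circle_rational_def by blast
  with assms(2) show ?thesis
    by (intro circle_rationalI[of p _ d]) auto
qed

lemma circle_rational_minus: "circle_rational f \<Longrightarrow> circle_rational (\<lambda>z. - f z)"
  using circle_rational_mult[OF circle_rational_const[of "-1"]] by fastforce

lemma circle_rational_sum:
  "(\<And>i. i \<in> I \<Longrightarrow> circle_rational (f i)) \<Longrightarrow> circle_rational (\<lambda>z. \<Sum>i\<in>I. f i z)"
  by (induction I rule: infinite_finite_induct)
    (auto intro: circle_rational_const circle_rational_add)

lemma circle_rational_prod:
  "(\<And>i. i \<in> I \<Longrightarrow> circle_rational (f i)) \<Longrightarrow> circle_rational (\<lambda>z. \<Prod>i\<in>I. f i z)"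
  by (induction I rule: infinite_finite_induct)
    (auto intro: circle_rational_const circle_rational_mult)

lemma circle_rational_cnj:
  assumes "circle_rational f" shows "circle_rational (\<lambda>z. cnj (f z))"
proof -
  \<comment> \<open>On the unit circle \<open>cnj z = 1 / z\<close>.\<close>
  have "circle_rational cnj"
    by (rule circle_rational_cong[OF circle_rational_inverse[OF circle_rational_ident]])
      (auto simp: inverse_eq_divide divide_conv_cnj)
  then have poly: "circle_rational (\<lambda>z. cnj (poly p z))" for p
    by (induction p)
      (auto intro!: circle_rational_const circle_rational_add circle_rational_mult)
  from assms obtain p d where
    pd: "\<forall>z. cmod z = 1 \<longrightarrow> poly d z \<noteq> 0 \<and> f z = poly p z / poly d z"
    unfolding circle_rational_def by blast
  then have "circle_rational (\<lambda>z. cnj (poly p z) * inverse (cnj (poly d z)))"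
    by (intro circle_rational_mult circle_rational_inverse poly) auto
  then show ?thesis
    by (rule circle_rational_cong) (use pd in \<open>auto simp: divide_inverse\<close>)
qed

lemmas circle_rational_intros =
  circle_rational_const circle_rational_ident circle_rational_add circle_rational_mult
  circle_rational_minus circle_rational_sum circle_rational_prod circle_rational_cnj

lemma circle_rational_det:
  fixes M :: "complex \<Rightarrow> complex^'n^'n"
  assumes "\<And>i j. circle_rational (\<lambda>z. M z $ i $ j)"
  shows "circle_rational (\<lambda>z. det (M z))"
  unfolding det_def by (intro circle_rational_intros assms)

lemma matrix_inv_inverse:
  assumes "invertible M"
  shows "M ** matrix_inv M = mat 1" "matrix_inv M ** M = mat 1"
  using someI_ex[OF assms[unfolded invertible_def]] by (simp_all add: matrix_inv_def)

text \<open>Cramer's rule for the system whose solution is column \<open>j\<close> of the inverse.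
  The explicit quotient shows rationality of the frequency matrix and, later, holomorphy of the
  resolvent.\<close>

lemma matrix_inv_entry:
  fixes M :: "complex^'n^'n"
  assumes "invertible M"
  shows "matrix_inv M $ i $ j = det (\<chi> r c. if c = i then axis j 1 $ r else M $ r $ c) / det M"
proof -
  let ?x = "matrix_inv M *v axis j 1"
  have "M *v ?x = axis j 1"
    by (simp add: matrix_vector_mul_assoc matrix_inv_inverse[OF assms])
  then have "?x = (\<chi> k. det (\<chi> r c. if c = k then axis j 1 $ r else M $ r $ c) / det M)"
    using cramer[of M ?x "axis j 1"] assms by (simp add: invertible_det_nz)
  moreover have "matrix_inv M $ i $ j = ?x $ i"
    by (simp add: matrix_vector_mult_def axis_def if_distrib cong: if_cong)
  ultimately show ?thesis by simp
qed

lemma circle_rational_matrix_inv: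
  fixes M :: "complex \<Rightarrow> complex^'n^'n"
  assumes "\<And>i j. circle_rational (\<lambda>z. M z $ i $ j)"
    and inv: "\<And>z. cmod z = 1 \<Longrightarrow> invertible (M z)"
  shows "circle_rational (\<lambda>z. matrix_inv (M z) $ i $ j)"
proof -
  have "circle_rational
    (\<lambda>z. det (\<chi> r c. if c = i then axis j 1 $ r else M z $ r $ c) * inverse (det (M z)))"
  proof (intro circle_rational_mult circle_rational_inverse circle_rational_det assms(1))
    show "circle_rational (\<lambda>z. (\<chi> r c. if c = i then axis j 1 $ r else M z $ r $ c) $ r $ c)" for r c
      by (cases "c = i") (auto intro: circle_rational_const assms(1))
  qed (use inv in \<open>auto simp: invertible_det_nz\<close>)
  then show ?thesis
    by (rule circle_rational_cong) (auto simp: matrix_inv_entry[OF inv] divide_inverse)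
qed

lemma circle_rational_bounded:
  assumes "circle_rational f"
  obtains C where "\<And>z. cmod z = 1 \<Longrightarrow> cmod (f z) \<le> C"
proof -
  from assms obtain p d where
    pd: "\<forall>z. cmod z = 1 \<longrightarrow> poly d z \<noteq> 0 \<and> f z = poly p z / poly d z"
    unfolding circle_rational_def by blast
  have "continuous_on (sphere 0 1) (\<lambda>z. poly p z / poly d z)"
    using pd by (intro continuous_intros) auto
  then have "bounded ((\<lambda>z. poly p z / poly d z) ` sphere 0 1)"
    by (intro compact_imp_bounded compact_continuous_image compact_sphere)
  then obtain C where "\<forall>x\<in>(\<lambda>z. poly p z / poly d z) ` sphere 0 1. cmod x \<le> C"
    unfolding bounded_iff by blast
  with pd show thesis by (intro that[of C]) auto
qed

text \<open>Roots off the closed unit disc only contribute a factor bounded away from zero on the circle.\<close>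

lemma poly_circle_lower:
  fixes p :: "complex poly"
  assumes "p \<noteq> 0"
  obtains c as where "0 < c" "\<And>a. a \<in> set as \<Longrightarrow> cmod a \<le> 1"
    "\<And>z. cmod z = 1 \<Longrightarrow> c * cmod (\<Prod>a\<leftarrow>as. z - a) \<le> cmod (poly p z)"
proof -
  have "\<exists>c>0. \<exists>as. (\<forall>a\<in>set as. cmod a \<le> 1) \<and>
      (\<forall>z. cmod z = 1 \<longrightarrow> c * cmod (\<Prod>a\<leftarrow>as. z - a) \<le> cmod (\<Prod>x\<in>#A. z - x))" for A
  proof (induction A)
    case empty
    show ?case by (rule exI[of _ 1], simp, rule exI[of _ "[]"], simp)
  next
    case (add x A)
    then obtain c as where *: "0 < c" "\<forall>a\<in>set as. cmod a \<le> 1"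
      "\<forall>z. cmod z = 1 \<longrightarrow> c * cmod (\<Prod>a\<leftarrow>as. z - a) \<le> cmod (\<Prod>x\<in>#A. z - x)" by blast
    show ?case
    proof (cases "cmod x \<le> 1")
      case True
      have "c * cmod (\<Prod>a\<leftarrow>x # as. z - a) \<le> cmod (\<Prod>x\<in>#add_mset x A. z - x)" if "cmod z = 1" for z
        using mult_left_mono[OF *(3)[rule_format, OF that], of "cmod (z - x)"]
        by (simp add: norm_mult mult_ac)
      with True * show ?thesis by (intro exI[of _ c] conjI exI[of _ "x # as"]) auto
    next
      case False
      define c' where "c' = (cmod x - 1) * c"
      have "c' * cmod (\<Prod>a\<leftarrow>as. z - a) \<le> cmod (\<Prod>x\<in>#add_mset x A. z - x)" if "cmod z = 1" for z
      proof -
        have "cmod x - 1 \<le> cmod (z - x)"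
          using norm_triangle_ineq2[of x z] that by (simp add: norm_minus_commute)
        then have "(cmod x - 1) * (c * cmod (\<Prod>a\<leftarrow>as. z - a)) \<le> cmod (z - x) * cmod (\<Prod>x\<in>#A. z - x)"
          using *(1,3) that by (intro mult_mono) auto
        then show ?thesis by (simp add: c'_def norm_mult mult_ac)
      qed
      with False * show ?thesis by (intro exI[of _ c'] conjI exI[of _ as]) (auto simp: c'_def)
    qed
  qed
  moreover obtain A where A: "p = smult (lead_coeff p) (\<Prod>x\<in>#A. [:-x, 1:])"
    using complex_poly_decompose_multiset[of p] by metis
  ultimately obtain c as where *: "0 < c" "\<forall>a\<in>set as. cmod a \<le> 1"
    "\<forall>z. cmod z = 1 \<longrightarrow> c * cmod (\<Prod>a\<leftarrow>as. z - a) \<le> cmod (\<Prod>x\<in>#A. z - x)" by blast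
  have "poly p z = lead_coeff p * (\<Prod>x\<in>#A. z - x)" for z
  proof -
    have "poly (\<Prod>x\<in>#A. [:-x, 1:]) z = (\<Prod>x\<in>#A. z - x)"
      by (induction A) (auto simp: algebra_simps)
    with A show ?thesis by (metis poly_smult)
  qed
  then have "cmod (lead_coeff p) * c * cmod (\<Prod>a\<leftarrow>as. z - a) \<le> cmod (poly p z)" if "cmod z = 1" for z
    using mult_left_mono[OF *(3)[rule_format, OF that], of "cmod (lead_coeff p)"]
    by (simp add: norm_mult mult_ac)
  moreover have "0 < cmod (lead_coeff p) * c" using assms *(1) by simp
  ultimately show thesis using *(2) by (intro that) auto
qed

text \<open>One nonzero value on the circle makes the numerator a nonzero polynomial, to which
  \<open>poly_circle_lower\<close> applies; compactness bounds the denominator from above.\<close>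

lemma circle_rational_lower:
  assumes "circle_rational f" "cmod z0 = 1" "f z0 \<noteq> 0"
  obtains c as where "0 < c" "\<And>a. a \<in> set as \<Longrightarrow> cmod a \<le> 1"
    "\<And>z. cmod z = 1 \<Longrightarrow> c * cmod (\<Prod>a\<leftarrow>as. z - a) \<le> cmod (f z)"
proof -
  from assms obtain p d where
    pd: "\<forall>z. cmod z = 1 \<longrightarrow> poly d z \<noteq> 0 \<and> f z = poly p z / poly d z"
    unfolding circle_rational_def by blast
  have "p \<noteq> 0" using pd assms(2,3) by auto
  then obtain c as where c: "0 < c" "\<And>a. a \<in> set as \<Longrightarrow> cmod a \<le> 1"
    "\<And>z. cmod z = 1 \<Longrightarrow> c * cmod (\<Prod>a\<leftarrow>as. z - a) \<le> cmod (poly p z)"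
    using poly_circle_lower by blast
  have "circle_rational (poly d)" by (rule circle_rationalI[of 1 _ d]) simp
  then obtain C where C: "\<And>z. cmod z = 1 \<Longrightarrow> cmod (poly d z) \<le> C"
    using circle_rational_bounded by blast
  have "0 < cmod (poly d z0)" using pd assms(2) by simp
  with C[OF assms(2)] have "0 < C" by linarith
  have "c / C * cmod (\<Prod>a\<leftarrow>as. z - a) \<le> cmod (f z)" if z: "cmod z = 1" for z
  proof -
    have "c * cmod (\<Prod>a\<leftarrow>as. z - a) / C \<le> cmod (poly p z) / cmod (poly d z)"
      using c(3)[OF z] C[OF z] pd z by (intro frac_le) auto
    then show ?thesis using pd z by (simp add: norm_divide)
  qed
  with c \<open>0 < C\<close> show thesis by (intro that[of "c / C" as]) auto
qed

section \<open>Sesquilinear forms and lower bounds for semidefinite matrices\<close>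

definition sesq :: "complex^'n^'m \<Rightarrow> complex^'m \<Rightarrow> complex^'n \<Rightarrow> complex" where
  "sesq M x y = (\<Sum>i\<in>UNIV. cnj (x $ i) * (M *v y) $ i)"

lemma cquad_eq_sesq: "cquad M u = sesq M u u"
  by (simp add: cquad_def sesq_def)

lemma sesq_add_right: "sesq M x (y + y') = sesq M x y + sesq M x y'"
  by (simp add: sesq_def matrix_vector_right_distrib algebra_simps sum.distrib)

lemma sesq_add_left: "sesq M (x + x') y = sesq M x y + sesq M x' y"
  by (simp add: sesq_def algebra_simps sum.distrib)

lemma sesq_scaleR_right: "sesq M x (c *\<^sub>R y) = c *\<^sub>R sesq M x y"
  by (simp add: sesq_def matrix_vector_mult_def scaleR_conv_of_real[where 'a=complex] sum_distrib_left mult_ac)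

lemma sesq_scaleR_left: "sesq M (c *\<^sub>R x) y = c *\<^sub>R sesq M x y"
  by (simp add: sesq_def scaleR_conv_of_real[where 'a=complex] sum_distrib_left mult_ac)

lemma sesq_hermitian:
  assumes "hermitian M" shows "sesq M y x = cnj (sesq M x y)"
proof -
  have M: "cnj (M $ i $ j) = M $ j $ i" for i j
    using assms by (auto simp: hermitian_def ctrans_def vec_eq_iff)
  have "cnj (sesq M x y) = (\<Sum>i\<in>UNIV. \<Sum>j\<in>UNIV. x $ i * (M $ j $ i * cnj (y $ j)))"
    by (simp add: sesq_def matrix_vector_mult_def sum_distrib_left M)
  also have "\<dots> = sesq M y x"
    by (subst sum.swap) (simp add: sesq_def matrix_vector_mult_def sum_distrib_left mult_ac)
  finally show ?thesis ..
qed

lemma norm_power2_vec: "(norm y)\<^sup>2 = (\<Sum>i\<in>UNIV. (norm (y $ i))\<^sup>2)"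
  by (simp add: norm_vec_def L2_set_def sum_nonneg)

lemma sesq_image: "sesq M (M *v u) u = complex_of_real ((norm (M *v u))\<^sup>2)"
  by (simp add: sesq_def norm_power2_vec complex_norm_square mult.commute del: of_real_power)

lemma sesq_norm_le:
  fixes M :: "complex^'n^'m" and K :: real
  assumes "\<And>i j. cmod (M $ i $ j) \<le> K"
  shows "cmod (sesq M x y) \<le> CARD('m) * CARD('n) * K * (norm x * norm y)"
proof -
  have "cmod (sesq M x y) = cmod (\<Sum>i\<in>UNIV. \<Sum>j\<in>UNIV. cnj (x $ i) * (M $ i $ j * y $ j))"
    by (simp add: sesq_def matrix_vector_mult_def sum_distrib_left)
  also have "\<dots> \<le> (\<Sum>(i::'m)\<in>UNIV. \<Sum>(j::'n)\<in>UNIV. norm x * (K * norm y))"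
    by (intro sum_norm_le)
      (auto simp: norm_mult intro!: mult_mono assms Finite_Cartesian_Product.norm_nth_le order.trans[OF norm_ge_zero assms])
  finally show ?thesis by (simp add: mult_ac)
qed

text \<open>Obtained by testing positivity on \<open>u - M u / L\<close>.\<close>

lemma psd_image_bound:
  fixes M :: "complex^'n^'n" and K :: real
  assumes "psd M" "\<And>i j. cmod (M $ i $ j) \<le> K" "0 < K"
  shows "(norm (M *v u))\<^sup>2 \<le> (CARD('n))\<^sup>2 * K * Re (cquad M u)"
proof -
  define y where "y = M *v u"
  \<comment> \<open>By \<open>sesq_norm_le\<close>, \<open>L\<close> bounds the form:
    \<open>cmod (sesq M y y) \<le> L * (norm y)\<^sup>2\<close>.\<close>
  define L where "L = (CARD('n))\<^sup>2 * K"
  have L: "0 < L" using assms(3) by (simp add: L_def)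
  have herm: "hermitian M" using assms(1) by (simp add: psd_def)
  have yu: "Re (sesq M y u) = (norm y)\<^sup>2" "Re (sesq M u y) = (norm y)\<^sup>2"
    using sesq_hermitian[OF herm, of u y] by (simp_all add: y_def sesq_image)
  have "Re (sesq M y y) \<le> L * (norm y)\<^sup>2"
    using order_trans[OF complex_Re_le_cmod sesq_norm_le[OF assms(2), of y y]]
    by (simp add: L_def power2_eq_square mult_ac)
  moreover have "0 \<le> Re (cquad M (u + (- (1 / L)) *\<^sub>R y))"
    using assms(1) by (simp add: psd_def)
  moreover have "Re (cquad M (u + (- (1 / L)) *\<^sub>R y))
      = Re (cquad M u) - 2 * ((norm y)\<^sup>2 / L) + (1 / L)\<^sup>2 * Re (sesq M y y)"
    using yu unfolding cquad_eq_sesq sesq_add_left sesq_add_right sesq_scaleR_left sesq_scaleR_right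
    using L by (simp add: power2_eq_square field_simps)
  moreover have "(1 / L)\<^sup>2 * (L * (norm y)\<^sup>2) = (norm y)\<^sup>2 / L"
    using L by (simp add: power2_eq_square)
  ultimately have "(norm y)\<^sup>2 / L \<le> Re (cquad M u)"
    using mult_left_mono[of "Re (sesq M y y)" "L * (norm y)\<^sup>2" "(1 / L)\<^sup>2"] by simp
  then have "(norm y)\<^sup>2 \<le> L * Re (cquad M u)" using L by (simp add: field_simps)
  then show ?thesis by (simp add: L_def y_def)
qed

lemma det_norm_le:
  fixes M :: "complex^'n^'n" and K :: real
  assumes "\<And>i j. cmod (M $ i $ j) \<le> K"
  shows "cmod (det M) \<le> fact CARD('n) * K ^ CARD('n)"
proof -
  have "cmod (det M) \<le> (\<Sum>p\<in>{p. p permutes (UNIV :: 'n set)}. K ^ CARD('n))"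
    unfolding det_def
  proof (intro sum_norm_le)
    fix p :: "'n \<Rightarrow> 'n"
    have "cmod (of_int (sign p) * (\<Prod>i\<in>UNIV. M $ i $ p i)) = (\<Prod>i\<in>UNIV. cmod (M $ i $ p i))"
      by (simp add: norm_mult prod_norm sign_def)
    also have "\<dots> \<le> (\<Prod>i\<in>(UNIV :: 'n set). K)" by (intro prod_mono) (auto intro: assms)
    finally show "cmod (of_int (sign p) * (\<Prod>i\<in>UNIV. M $ i $ p i)) \<le> K ^ CARD('n)" by simp
  qed
  then show ?thesis by (simp add: card_permutations[OF refl finite])
qed

text \<open>Cramer's rule expresses each component of \<open>det M * u\<close> as a determinant with
  one column replaced by \<open>M *v u\<close>. The result bounds \<open>M *v u\<close> from below
  and remains uniform as \<open>det M\<close> tends to zero.\<close>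

lemma det_mult_norm_le:
  fixes M :: "complex^'n^'n" and K :: real
  assumes "\<And>i j. cmod (M $ i $ j) \<le> K" "1 \<le> K"
  shows "cmod (det M) * norm u \<le> CARD('n) * (fact CARD('n) * K ^ CARD('n)) * norm (M *v u)"
proof (cases "M *v u = 0")
  case True
  have "u = 0" if "det M \<noteq> 0"
  proof -
    from that have "matrix_inv M *v (M *v u) = u"
      by (simp add: matrix_vector_mul_assoc matrix_inv_inverse invertible_det_nz)
    with True show "u = 0" by simp
  qed
  then show ?thesis by (cases "det M = 0") (auto simp: True)
next
  case False
  define y where "y = M *v u"
  define D where "D = fact CARD('n) * K ^ CARD('n)"
  have y: "0 < norm y" using False by (simp add: y_def)
  \<comment> \<open>Normalised so that the replaced column has entries at most 1, hence at most
    \<open>K\<close>, and \<open>det_norm_le\<close> covers the whole matrix.\<close>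
  let ?x = "inverse (norm y) *\<^sub>R u"
  have "cmod (u $ k) * cmod (det M) \<le> D * norm y" for k
  proof -
    have "M *v ?x = inverse (norm y) *\<^sub>R y" 
      by (simp add: y_def matrix_vector_mult_def vec_eq_iff scaleR_sum_right)
    moreover have "cmod ((inverse (norm y) *\<^sub>R y) $ i) \<le> 1" for i
      using Finite_Cartesian_Product.norm_nth_le y by (simp add: field_simps)
    ultimately have "cmod (det (\<chi> i j. if j = k then (M *v ?x) $ i else M $ i $ j)) \<le> D"
      unfolding D_def using assms by (intro det_norm_le) (auto intro: order_trans)
    then have "cmod (?x $ k * det M) \<le> D" by (simp only: cramer_lemma)
    then show ?thesis using y by (simp add: norm_mult field_simps)
  qed
  then have "(\<Sum>k\<in>UNIV. cmod (u $ k) * cmod (det M)) \<le> (\<Sum>(k::'n)\<in>UNIV. D * norm y)"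
    by (rule sum_mono)
  moreover have "norm u * cmod (det M) \<le> (\<Sum>k\<in>UNIV. cmod (u $ k)) * cmod (det M)"
    by (intro mult_right_mono) (auto simp: norm_vec_def intro: L2_set_le_sum)
  ultimately show ?thesis by (simp add: D_def y_def sum_distrib_right sum_distrib_left mult_ac)
qed

lemma det_zero_kernel:
  fixes M :: "complex^'n^'n"
  assumes "det M = 0"
  obtains u where "u \<noteq> 0" "M *v u = 0"
  using assms matrix_left_invertible_ker[of M] invertible_det_nz[of M] invertible_left_inverse[of M]
  by blast

lemma posdef_det_nz: "posdef M \<Longrightarrow> det M \<noteq> 0"
  by (auto elim!: det_zero_kernel simp: posdef_def cquad_def)

text \<open>\<open>det_mult_norm_le\<close> compares \<open>cmod (det M) * norm u\<close> with
  \<open>norm (M *v u)\<close>, and \<open>psd_image_bound\<close> compares the square of the latter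
  with the form. So the form dominates a multiple of the squared determinant, which is rational and
  nonzero at \<open>z0\<close>.\<close>

lemma circle_psd_lower:
  fixes M :: "complex \<Rightarrow> complex^'n^'n"
  assumes rat: "\<And>i j. circle_rational (\<lambda>z. M z $ i $ j)"
    and psd: "\<And>z. cmod z = 1 \<Longrightarrow> psd (M z)"
    and z0: "cmod z0 = 1" "posdef (M z0)"
  obtains c as where "0 < c" "\<And>a. a \<in> set as \<Longrightarrow> cmod a \<le> 1"
    "\<And>z u. cmod z = 1 \<Longrightarrow> c * (cmod (\<Prod>a\<leftarrow>as. z - a) * norm u)\<^sup>2 \<le> Re (cquad (M z) u)"
proof -
  have "\<forall>i j. \<exists>C. \<forall>z. cmod z = 1 \<longrightarrow> cmod (M z $ i $ j) \<le> C"
    using circle_rational_bounded[OF rat] by metis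
  then obtain C where C: "\<And>i j z. cmod z = 1 \<Longrightarrow> cmod (M z $ i $ j) \<le> C i j" by metis
  \<comment> \<open>The summand 1 secures \<open>1 \<le> K\<close>, which
    \<open>det_mult_norm_le\<close> asks for.\<close>
  define K where "K = 1 + (\<Sum>i\<in>UNIV. \<Sum>j\<in>UNIV. \<bar>C i j\<bar>)"
  have K: "1 \<le> K" by (simp add: K_def sum_nonneg)
  have MK: "cmod (M z $ i $ j) \<le> K" if "cmod z = 1" for z i j
  proof -
    have "\<bar>C i j\<bar> \<le> (\<Sum>j\<in>UNIV. \<bar>C i j\<bar>)" by (rule member_le_sum) auto
    also have "\<dots> \<le> (\<Sum>i\<in>UNIV. \<Sum>j\<in>UNIV. \<bar>C i j\<bar>)"
      by (rule member_le_sum[of i UNIV "\<lambda>i. \<Sum>j\<in>UNIV. \<bar>C i j\<bar>"]) (auto intro: sum_nonneg)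
    finally show ?thesis using C[OF that, of i j] by (simp add: K_def)
  qed
  obtain c as where c: "0 < c" "\<And>a. a \<in> set as \<Longrightarrow> cmod a \<le> 1"
    "\<And>z. cmod z = 1 \<Longrightarrow> c * cmod (\<Prod>a\<leftarrow>as. z - a) \<le> cmod (det (M z))"
    using circle_rational_lower[OF circle_rational_det[OF rat] z0(1) posdef_det_nz[OF z0(2)]] by blast
  define D where "D = CARD('n) * (fact CARD('n) * K ^ CARD('n))"
  define L where "L = (CARD('n))\<^sup>2 * K"
  have D: "0 < D" and L: "0 < L" using K by (auto simp: D_def L_def)
  have "c\<^sup>2 / (D\<^sup>2 * L) * (cmod (\<Prod>a\<leftarrow>as. z - a) * norm u)\<^sup>2 \<le> Re (cquad (M z) u)"
    if z: "cmod z = 1" for z u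
  proof -
    have "c * cmod (\<Prod>a\<leftarrow>as. z - a) * norm u \<le> cmod (det (M z)) * norm u"
      using c(3)[OF z] by (intro mult_right_mono) auto
    also have "\<dots> \<le> D * norm (M z *v u)"
      unfolding D_def using MK[OF z] K by (intro det_mult_norm_le) auto
    finally have "(c * (cmod (\<Prod>a\<leftarrow>as. z - a) * norm u))\<^sup>2 \<le> (D * norm (M z *v u))\<^sup>2"
      using c(1) by (intro power_mono) (auto simp: mult_ac)
    also have "\<dots> \<le> D\<^sup>2 * (L * Re (cquad (M z) u))"
      unfolding L_def power_mult_distrib using psd_image_bound[OF psd[OF z] MK[OF z]] K
      by (intro mult_left_mono) auto
    finally show ?thesis using D L by (simp add: power_mult_distrib field_simps)
  qed
  with c D L show thesis by (intro that[of "c\<^sup>2 / (D\<^sup>2 * L)" as]) auto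
qed

section \<open>Parseval's identity and growth of sequences\<close>

text \<open>Negative powers are taken so that advancing a sequence in time multiplies its transform
  by \<open>z\<close>, matching the factor \<open>z I - A\<close> of the transfer matrix.\<close>

definition ztrans :: "(nat \<Rightarrow> complex) \<Rightarrow> complex \<Rightarrow> complex" where
  "ztrans a z = (\<Sum>t. a t * inverse z ^ t)"

lemma ztrans_sums:
  assumes "summable (\<lambda>t. cmod (a t))" "cmod z = 1"
  shows "(\<lambda>t. a t * inverse z ^ t) sums ztrans a z"
  unfolding ztrans_def
  by (rule summable_sums, rule summable_norm_cancel)
    (use assms in \<open>simp add: norm_mult norm_power norm_inverse\<close>)

lemma has_integral_cis:
  fixes k :: int
  shows "((\<lambda>\<theta>. cis (of_int k * \<theta>)) has_integral (if k = 0 then 2 * pi else 0)) {0..2 * pi}"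
proof (cases "k = 0")
  case True
  then show ?thesis using has_integral_const_real[of "1 :: complex" 0 "2 * pi"]
    by (simp add: scaleR_conv_of_real)
next
  case False
  define F where "F = (\<lambda>\<theta>. cis (of_int k * \<theta>) / (\<i> * of_int k))"
  have "((\<lambda>\<theta>. cis (of_int k * \<theta>)) has_integral F (2 * pi) - F 0) {0..2 * pi}"
  proof (rule fundamental_theorem_of_calculus)
    fix x :: real
    have "((\<lambda>x. exp (\<i> * of_int k * x) / (\<i> * of_int k)) has_field_derivative exp (\<i> * of_int k * of_real x)) (at (of_real x))"
      using False by (auto intro!: derivative_eq_intros)
    from has_vector_derivative_real_field[OF this]
    show "(F has_vector_derivative cis (of_int k * x)) (at x within {0..2 * pi})"
      by (simp add: F_def cis_conv_exp mult_ac)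
  qed simp
  moreover have "F (2 * pi) = F 0"
    using cis_multiple_2pi[of "of_int k"] by (simp add: F_def mult_ac)
  ultimately show ?thesis using False by simp
qed

lemma continuous_on_cis_comp: "continuous_on S f \<Longrightarrow> continuous_on S (\<lambda>x. cis (f x))"
  unfolding cis_conv_exp by (intro continuous_intros)

lemma uniform_limit_ztrans:
  assumes "summable (\<lambda>t. cmod (a t))"
  shows "uniform_limit S (\<lambda>n \<theta>. \<Sum>t<n. a t * cis (- (real t * \<theta>))) (\<lambda>\<theta>. ztrans a (cis \<theta>)) sequentially"
proof -
  have "uniform_limit S (\<lambda>n \<theta>. \<Sum>t<n. a t * cis (- (real t * \<theta>)))
      (\<lambda>\<theta>. \<Sum>t. a t * cis (- (real t * \<theta>))) sequentially"
    by (rule Weierstrass_m_test[OF _ assms]) (simp add: norm_mult)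
  moreover have "inverse (cis \<theta>) ^ t = cis (- (real t * \<theta>))" for \<theta> t
    by (simp add: Complex.DeMoivre)
  ultimately show ?thesis by (simp add: ztrans_def)
qed

text \<open>Absolute summability makes the partial sums converge uniformly, so integrals pass to the
  limit; for the partial sums the identity is orthogonality of the functions
  \<open>cis (k * \<theta>)\<close>.\<close>

lemma parseval:
  assumes a: "summable (\<lambda>t. cmod (a t))" and b: "summable (\<lambda>t. cmod (b t))"
  shows "((\<lambda>\<theta>. cnj (ztrans a (cis \<theta>)) * ztrans b (cis \<theta>)) has_integral
    2 * pi * (\<Sum>t. cnj (a t) * b t)) {0..2 * pi}"
    and "summable (\<lambda>t. cnj (a t) * b t)"
proof -
  define f where "f = (\<lambda>a n \<theta>. \<Sum>t<n. a t * cis (- (real t * \<theta>)))"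
  have cont: "continuous_on {0..2 * pi} (f a n)" for a n
    unfolding f_def by (intro continuous_intros continuous_on_cis_comp)
  have bdd: "bounded ((\<lambda>\<theta>. ztrans a (cis \<theta>)) ` {0..2 * pi})" if "summable (\<lambda>t. cmod (a t))" for a
    using uniform_limit_theorem[OF _ uniform_limit_ztrans[OF that, of "{0..2 * pi}"]] cont[of a]
    by (intro compact_imp_bounded compact_continuous_image) (auto simp: f_def)
  have "uniform_limit {0..2 * pi} (\<lambda>n \<theta>. cnj (f a n \<theta>) * f b n \<theta>)
      (\<lambda>\<theta>. cnj (ztrans a (cis \<theta>)) * ztrans b (cis \<theta>)) sequentially"
  proof (rule uniform_lim_mult)
    show "uniform_limit {0..2 * pi} (\<lambda>n \<theta>. cnj (f a n \<theta>)) (\<lambda>\<theta>. cnj (ztrans a (cis \<theta>))) sequentially"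
      unfolding f_def by (rule bounded_linear.uniform_limit[OF bounded_linear_cnj uniform_limit_ztrans[OF a]])
    show "uniform_limit {0..2 * pi} (f b) (\<lambda>\<theta>. ztrans b (cis \<theta>)) sequentially"
      unfolding f_def by (rule uniform_limit_ztrans[OF b])
    show "bounded ((\<lambda>\<theta>. cnj (ztrans a (cis \<theta>))) ` {0..2 * pi})"
      using bounded_linear_image[OF bdd[OF a] bounded_linear_cnj] by (simp add: image_image)
  qed (rule bdd[OF b])
  then obtain I J where I: "\<And>n. ((\<lambda>\<theta>. cnj (f a n \<theta>) * f b n \<theta>) has_integral I n) {0..2 * pi}"
    and J: "((\<lambda>\<theta>. cnj (ztrans a (cis \<theta>)) * ztrans b (cis \<theta>)) has_integral J) {0..2 * pi}"
    and lim: "I \<longlonglongrightarrow> J"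
    by (rule uniform_limit_integral) (auto intro!: continuous_intros cont)
  have I_eq: "I n = 2 * pi * (\<Sum>t<n. cnj (a t) * b t)" for n
  proof (rule has_integral_unique[OF I])
    have "((\<lambda>\<theta>. \<Sum>s<n. \<Sum>t<n. cnj (a s) * b t * cis (of_int (int s - int t) * \<theta>)) has_integral
      (\<Sum>s<n. \<Sum>t<n. cnj (a s) * b t * (if int s - int t = 0 then 2 * pi else 0))) {0..2 * pi}"
      by (intro has_integral_sum has_integral_mult_right has_integral_cis) auto
    moreover have "(\<Sum>s<n. \<Sum>t<n. cnj (a s) * b t * (if int s - int t = 0 then 2 * pi else 0))
        = 2 * pi * (\<Sum>t<n. cnj (a t) * b t)"
      by (simp add: if_distrib sum.delta sum_distrib_left mult_ac cong: if_cong)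
    moreover have "(\<Sum>s<n. \<Sum>t<n. cnj (a s) * b t * cis (of_int (int s - int t) * \<theta>))
        = cnj (f a n \<theta>) * f b n \<theta>" for \<theta>
    proof -
      have "cis (of_int (int s - int t) * \<theta>) = cnj (cis (- (real s * \<theta>))) * cis (- (real t * \<theta>))" for s t
        by (simp add: cis_cnj cis_mult algebra_simps)
      then show ?thesis
        unfolding f_def cnj_sum sum_product by (intro sum.cong) (simp_all add: mult_ac)
    qed
    ultimately show "((\<lambda>\<theta>. cnj (f a n \<theta>) * f b n \<theta>) has_integral
        2 * pi * (\<Sum>t<n. cnj (a t) * b t)) {0..2 * pi}" by simp
  qed
  have "(\<lambda>n. complex_of_real (1 / (2 * pi)) * I n) \<longlonglongrightarrow> complex_of_real (1 / (2 * pi)) * J"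
    by (intro tendsto_intros lim)
  then have s: "(\<lambda>t. cnj (a t) * b t) sums (complex_of_real (1 / (2 * pi)) * J)"
    by (simp add: sums_def I_eq)
  then show "summable (\<lambda>t. cnj (a t) * b t)" by (rule sums_summable)
  from s have "2 * pi * (\<Sum>t. cnj (a t) * b t) = J" by (simp flip: sums_unique)
  with J show "((\<lambda>\<theta>. cnj (ztrans a (cis \<theta>)) * ztrans b (cis \<theta>)) has_integral
    2 * pi * (\<Sum>t. cnj (a t) * b t)) {0..2 * pi}" by simp
qed

text \<open>The time-domain form of multiplication by \<open>1 - \<alpha> / z\<close>, whose modulus
  on the circle is \<open>cmod (z - \<alpha>)\<close>. The value 0 in the first case extends
  \<open>a\<close> by zero to negative times.\<close>

definition delay_diff :: "complex \<Rightarrow> (nat \<Rightarrow> complex) \<Rightarrow> nat \<Rightarrow> complex" where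
  "delay_diff \<alpha> a t = a t - \<alpha> * (case t of 0 \<Rightarrow> 0 | Suc s \<Rightarrow> a s)"

lemma delay_diff_summable:
  assumes "summable (\<lambda>t. cmod (a t))"
  shows "summable (\<lambda>t. cmod (delay_diff \<alpha> a t))"
proof -
  have "summable (\<lambda>t. cmod (case t of 0 \<Rightarrow> 0 | Suc s \<Rightarrow> a s))"
    by (subst summable_Suc_iff[symmetric]) (simp add: assms)
  then have "summable (\<lambda>t. cmod (a t) + cmod \<alpha> * cmod (case t of 0 \<Rightarrow> 0 | Suc s \<Rightarrow> a s))"
    by (intro summable_add assms summable_mult)
  then show ?thesis
    by (rule summable_comparison_test')
      (auto simp: delay_diff_def norm_mult intro: order_trans[OF norm_triangle_ineq4])
qed

lemma ztrans_delay_diff: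
  assumes "summable (\<lambda>t. cmod (a t))" "cmod z = 1"
  shows "ztrans (delay_diff \<alpha> a) z = (1 - \<alpha> * inverse z) * ztrans a z"
proof -
  note a = ztrans_sums[OF assms]
  have "(\<lambda>t. inverse z * (a t * inverse z ^ t)) sums (inverse z * ztrans a z)"
    by (rule sums_mult[OF a])
  then have "(\<lambda>t. (case t of 0 \<Rightarrow> 0 | Suc s \<Rightarrow> a s) * inverse z ^ t) sums (inverse z * ztrans a z)"
    by (subst sums_Suc_iff[where f = "\<lambda>t. (case t of 0 \<Rightarrow> 0 | Suc s \<Rightarrow> a s) * inverse z ^ t" and s = "inverse z * ztrans a z", simplified, symmetric])
      (simp add: mult_ac)
  from sums_diff[OF a sums_mult[OF this, of \<alpha>]]
  have "(\<lambda>t. delay_diff \<alpha> a t * inverse z ^ t) sums ((1 - \<alpha> * inverse z) * ztrans a z)"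
    by (simp add: delay_diff_def algebra_simps)
  then show ?thesis unfolding ztrans_def[of "delay_diff \<alpha> a"] by (rule sums_unique[symmetric])
qed

text \<open>With \<open>d\<close> the filtered sequence, \<open>a t\<close> is the sum of
  \<open>\<alpha> ^ j * d (t - j)\<close> over \<open>j \<le> t\<close>. Since
  \<open>cmod \<alpha> \<le> 1\<close>, adding \<open>1 + t\<close> such terms costs one
  power.\<close>

lemma growth_delay_diff:
  assumes "cmod \<alpha> \<le> 1" "\<And>t. cmod (delay_diff \<alpha> a t) \<le> M * (1 + real t) ^ m"
  shows "cmod (a t) \<le> M * (1 + real t) ^ Suc m"
proof (induction t)
  case 0
  then show ?case using assms(2)[of 0] by (simp add: delay_diff_def)
next
  case (Suc t)
  have M: "0 \<le> M" using order_trans[OF norm_ge_zero assms(2)[of 0]] by simp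
  have "a (Suc t) = delay_diff \<alpha> a (Suc t) + \<alpha> * a t" by (simp add: delay_diff_def)
  then have "cmod (a (Suc t)) \<le> cmod (delay_diff \<alpha> a (Suc t)) + cmod \<alpha> * cmod (a t)"
    by (metis norm_mult norm_triangle_ineq)
  also have "\<dots> \<le> M * (1 + real (Suc t)) ^ m + 1 * (M * (1 + real t) ^ Suc m)"
    using assms(2)[of "Suc t"] mult_mono[OF assms(1) Suc] by (intro add_mono) auto
  \<comment> \<open>One factor \<open>1 + t\<close> is kept unchanged, so that both summands
    together give exactly \<open>2 + t\<close> times the common power.\<close>
  also have "M * (1 + real t) ^ Suc m \<le> M * ((1 + real t) * (1 + real (Suc t)) ^ m)"
    using M by (auto intro!: mult_left_mono power_mono)
  also have "M * (1 + real (Suc t)) ^ m + 1 * \<dots> = M * (1 + real (Suc t)) ^ Suc m"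
    by (simp add: algebra_simps)
  finally show ?case by simp
qed

lemma foldr_delay_diff_summable:
  "summable (\<lambda>t. cmod (a t)) \<Longrightarrow> summable (\<lambda>t. cmod (foldr delay_diff as a t))"
  by (induction as) (auto intro: delay_diff_summable)

lemma cmod_ztrans_foldr_delay_diff:
  assumes "summable (\<lambda>t. cmod (a t))" "cmod z = 1"
  shows "cmod (ztrans (foldr delay_diff as a) z) = cmod (\<Prod>\<alpha>\<leftarrow>as. z - \<alpha>) * cmod (ztrans a z)"
proof (induction as)
  case (Cons \<alpha> as)
  have "z \<noteq> 0" using assms(2) by auto
  then have "1 - \<alpha> * inverse z = (z - \<alpha>) * inverse z" by (simp add: field_simps)
  then have "cmod (1 - \<alpha> * inverse z) = cmod (z - \<alpha>)"
    using assms(2) by (simp add: norm_mult norm_inverse)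
  then show ?case
    using Cons by (simp add: ztrans_delay_diff[OF foldr_delay_diff_summable[OF assms(1)] assms(2)] norm_mult)
qed simp

lemma growth_foldr_delay_diff:
  assumes "\<And>\<alpha>. \<alpha> \<in> set as \<Longrightarrow> cmod \<alpha> \<le> 1"
    and "\<And>t. cmod (foldr delay_diff as a t) \<le> M * (1 + real t) ^ m"
  shows "cmod (a t) \<le> M * (1 + real t) ^ (m + length as)"
  using assms
proof (induction as arbitrary: m)
  case (Cons \<alpha> as)
  have "cmod (foldr delay_diff as a t) \<le> M * (1 + real t) ^ Suc m" for t
    using Cons.prems by (intro growth_delay_diff[of \<alpha>]) auto
  then show ?case using Cons.IH[of "Suc m"] Cons.prems(1) by simp
qed simp

text \<open>Zeros of the weight on the unit circle cost only polynomial growth in time.\<close>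

lemma weighted_energy:
  assumes a: "summable (\<lambda>t. cmod (a t))" and as: "\<And>\<alpha>. \<alpha> \<in> set as \<Longrightarrow> cmod \<alpha> \<le> 1"
  obtains E where
    "((\<lambda>\<theta>. (cmod (\<Prod>\<alpha>\<leftarrow>as. cis \<theta> - \<alpha>) * cmod (ztrans a (cis \<theta>)))\<^sup>2) has_integral 2 * pi * E) {0..2 * pi}"
    "\<forall>t. cmod (a t) \<le> sqrt E * (1 + real t) ^ length as"
proof -
  define d where "d = foldr delay_diff as a"
  have d: "summable (\<lambda>t. cmod (d t))" unfolding d_def by (rule foldr_delay_diff_summable[OF a])
  \<comment> \<open>The energy of the filtered sequence: Parseval identifies it with the weighted
    integral, and every single term is at most \<open>sqrt E\<close>.\<close>
  define E where "E = (\<Sum>t. (cmod (d t))\<^sup>2)"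
  have eq: "cnj z * z = complex_of_real ((cmod z)\<^sup>2)" for z
    by (metis complex_norm_square mult.commute of_real_power)
  have "summable (\<lambda>t. complex_of_real ((cmod (d t))\<^sup>2))" using parseval(2)[OF d d] by (simp only: eq)
  then have s: "summable (\<lambda>t. (cmod (d t))\<^sup>2)" by (simp only: summable_complex_of_real)
  have "((\<lambda>\<theta>. cnj (ztrans d (cis \<theta>)) * ztrans d (cis \<theta>)) has_integral
    2 * pi * (\<Sum>t. cnj (d t) * d t)) {0..2 * pi}" by (rule parseval(1)[OF d d])
  then have "((\<lambda>\<theta>. complex_of_real ((cmod (ztrans d (cis \<theta>)))\<^sup>2)) has_integral
    complex_of_real (2 * pi * E)) {0..2 * pi}"
    unfolding eq E_def suminf_of_real[OF s, symmetric] by simp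
  from has_integral_linear[OF this bounded_linear_Re]
  have "((\<lambda>\<theta>. (cmod (ztrans d (cis \<theta>)))\<^sup>2) has_integral 2 * pi * E) {0..2 * pi}"
    by (simp add: o_def)
  then have 1: "((\<lambda>\<theta>. (cmod (\<Prod>\<alpha>\<leftarrow>as. cis \<theta> - \<alpha>) * cmod (ztrans a (cis \<theta>)))\<^sup>2) has_integral 2 * pi * E) {0..2 * pi}"
    by (simp add: d_def cmod_ztrans_foldr_delay_diff[OF a])
  have "cmod (d t) \<le> sqrt E * (1 + real t) ^ 0" for t
  proof -
    have "(cmod (d t))\<^sup>2 \<le> E"
      using sum_le_suminf[OF s, of "{t}"] by (simp add: E_def)
    then show ?thesis by (simp add: real_le_rsqrt)
  qed
  then have 2: "cmod (a t) \<le> sqrt E * (1 + real t) ^ length as" for t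
    using growth_foldr_delay_diff[OF as, of as a "sqrt E" 0 t] by (simp add: d_def)
  from 1 2 show thesis by (intro that) auto
qed

section \<open>Powers of a Schur matrix\<close>

text \<open>With \<open>w = 1 / z\<close> the region in the definition of \<open>schur\<close>
  becomes the closed unit disc, and infinity becomes the regular point \<open>w = 0\<close>, around
  which the resolvent can be expanded.\<close>

definition pencil :: "real^'n^'n \<Rightarrow> complex \<Rightarrow> complex^'n^'n" where
  "pencil A w = mat 1 - (\<chi> i j. w * complex_of_real (A $ i $ j))"

text \<open>For \<open>w \<noteq> 0\<close> a kernel vector of \<open>I - w A\<close> is also one of
  \<open>I / w - A\<close>, which is invertible.\<close>

lemma pencil_det_nz:
  assumes "schur A" "cmod w \<le> 1" shows "det (pencil A w) \<noteq> 0"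
proof
  assume "det (pencil A w) = 0"
  then obtain u where u: "u \<noteq> 0" "pencil A w *v u = 0" by (rule det_zero_kernel)
  show False
  proof (cases "w = 0")
    case True
    then have "pencil A w = mat 1" by (simp add: pencil_def vec_eq_iff)
    with u show False by simp
  next
    case False
    let ?N = "mat (inverse w) - cmat A"
    have "cmod (inverse w) \<ge> 1"
      using assms(2) False by (simp add: norm_inverse one_le_inverse)
    then have inv: "invertible ?N" using assms(1) by (simp add: schur_def)
    have "?N = (\<chi> i j. inverse w * pencil A w $ i $ j)"
      using False by (simp add: vec_eq_iff pencil_def cmat_def mat_def algebra_simps)
    then have "?N *v u = inverse w *s (pencil A w *v u)"
      by (simp add: matrix_vector_mult_def vec_eq_iff sum_distrib_left mult_ac)
    with u(2) have "?N *v u = 0" by simp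
    then have "matrix_inv ?N *v (?N *v u) = 0" by simp
    with u(1) show False by (simp add: matrix_vector_mul_assoc matrix_inv_inverse[OF inv])
  qed
qed

text \<open>The resolvent \<open>(I - w A)\<^sup>-\<^sup>1\<close> is holomorphic beyond the closed unit disc and its Taylor
  coefficients are the powers of \<open>A\<close>.\<close>

lemma schur_power_decay:
  fixes A :: "real^'n^'n"
  assumes "schur A"
  obtains C \<rho> where "0 \<le> C" "0 < \<rho>" "\<rho> < 1"
    "\<And>t x. norm ((((*v) A) ^^ t) x) \<le> C * \<rho> ^ t * norm x"
proof -
  let ?D = "\<lambda>w. det (pencil A w)"
  have hol_entry: "(\<lambda>w. pencil A w $ i $ j) holomorphic_on S" for i j S
    by (auto simp: pencil_def mat_def intro!: holomorphic_intros)
  have hol_det: "?D holomorphic_on S" for S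
    unfolding det_def by (intro holomorphic_intros hol_entry)
  have "open {w. ?D w \<noteq> 0}"
    using open_Collect_neq[OF holomorphic_on_imp_continuous_on[OF hol_det] continuous_on_const] by simp
  moreover have "cball 0 1 \<subseteq> {w. ?D w \<noteq> 0}" using pencil_det_nz[OF assms] by auto
  \<comment> \<open>Compactness of the closed disc gives a uniform margin, hence a larger disc of
    radius \<open>1 + \<epsilon>\<close> free of zeros of the determinant.\<close>
  ultimately obtain \<epsilon> where \<epsilon>: "\<epsilon> > 0" "(\<Union>x\<in>cball 0 1. cball x \<epsilon>) \<subseteq> {w. ?D w \<noteq> 0}"
    using compact_subset_open_imp_cball_epsilon_subset[OF compact_cball] by metis
  define r where "r = 1 + \<epsilon>"
  have nz: "?D w \<noteq> 0" if "w \<in> ball 0 r" for w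
  proof (cases "cmod w \<le> 1")
    case True
    then show ?thesis by (rule pencil_det_nz[OF assms])
  next
    case False
    \<comment> \<open>Radial projection to the unit circle, which moves \<open>w\<close> by less
      than \<epsilon>.\<close>
    let ?v = "sgn w"
    have "w \<noteq> 0" using False by auto
    then have "?v \<in> cball 0 1" by (simp add: norm_sgn)
    moreover have "dist ?v w \<le> \<epsilon>"
    proof -
      have "w = cmod w *\<^sub>R ?v" using \<open>w \<noteq> 0\<close> by (simp add: sgn_div_norm)
      then have "?v - w = (1 - cmod w) *\<^sub>R ?v" by (metis scaleR_left_diff_distrib scaleR_one)
      then have "dist ?v w = \<bar>1 - cmod w\<bar>" using \<open>w \<noteq> 0\<close> by (simp add: dist_norm norm_sgn)
      then show ?thesis using that False by (simp add: r_def)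
    qed
    ultimately have "w \<in> (\<Union>x\<in>cball 0 1. cball x \<epsilon>)" by (intro UN_I[of ?v]) auto
    then show ?thesis using \<epsilon>(2) by blast
  qed
  define f where "f i j w = matrix_inv (pencil A w) $ i $ j" for i j and w :: complex
  have "(\<lambda>w. det (\<chi> r c. if c = i then axis j 1 $ r else pencil A w $ r $ c) / ?D w) holomorphic_on ball 0 r" for i j
  proof (intro holomorphic_intros hol_det)
    have "(\<lambda>w. (\<chi> r c. if c = i then axis j 1 $ r else pencil A w $ r $ c) $ r' $ c') holomorphic_on ball 0 r" for r' c'
      by (cases "c' = i") (auto intro: hol_entry)
    then show "(\<lambda>w. det (\<chi> r c. if c = i then axis j 1 $ r else pencil A w $ r $ c)) holomorphic_on ball 0 r"
      unfolding det_def by (intro holomorphic_intros)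
  qed (use nz in auto)
  then have hol: "f i j holomorphic_on ball 0 r" for i j
    by (rule holomorphic_transform) (use nz in \<open>auto simp: f_def matrix_inv_entry invertible_det_nz\<close>)
  define F where "F i j = fps_expansion (f i j) 0" for i j
  have r: "0 < r" using \<epsilon>(1) by (simp add: r_def)
  have exp: "f i j has_fps_expansion F i j" for i j
    unfolding F_def by (rule has_fps_expansion_fps_expansion[OF _ _ hol]) (use r in auto)
  have rad: "ereal r \<le> fps_conv_radius (F i j)" for i j
    by (rule holomorphic_on_imp_fps_conv_radius_ge[OF exp]) (use hol in simp)
  \<comment> \<open>The equation \<open>(I - w A) R(w) = I\<close> for the resolvent, read in formal
    power series. Comparing coefficients gives the recursion satisfied by the powers of
    \<open>A\<close>.\<close>
  have F_eq: "F i j - fps_X * (\<Sum>k\<in>UNIV. fps_const (complex_of_real (A $ i $ k)) * F k j)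
      = fps_const (if i = j then 1 else 0)" for i j
  proof (rule fps_expansion_unique_complex)
    show "(\<lambda>w. f i j w - w * (\<Sum>k\<in>UNIV. complex_of_real (A $ i $ k) * f k j w)) has_fps_expansion
        F i j - fps_X * (\<Sum>k\<in>UNIV. fps_const (complex_of_real (A $ i $ k)) * F k j)"
      by (intro fps_expansion_intros exp)
    have "\<forall>\<^sub>F w in nhds 0. f i j w - w * (\<Sum>k\<in>UNIV. complex_of_real (A $ i $ k) * f k j w) = (if i = j then 1 else 0)"
      unfolding eventually_nhds
    proof (intro exI[of _ "ball 0 r"] conjI ballI)
      fix w :: complex assume "w \<in> ball 0 r"
      then have "pencil A w ** matrix_inv (pencil A w) = mat 1"
        using nz by (intro matrix_inv_inverse) (simp add: invertible_det_nz)
      then have "(pencil A w ** matrix_inv (pencil A w)) $ i $ j = mat 1 $ i $ j" by simp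
      then have "(\<Sum>k\<in>UNIV. (mat 1 $ i $ k - w * complex_of_real (A $ i $ k)) * f k j w) = mat 1 $ i $ j"
        by (simp add: matrix_matrix_mult_def pencil_def f_def)
      moreover have "(\<Sum>k\<in>UNIV. (mat 1 $ i $ k - w * complex_of_real (A $ i $ k)) * f k j w)
          = (\<Sum>k\<in>UNIV. mat 1 $ i $ k * f k j w) - w * (\<Sum>k\<in>UNIV. complex_of_real (A $ i $ k) * f k j w)"
        by (simp add: sum_subtractf sum_distrib_left algebra_simps)
      moreover have "(\<Sum>k\<in>UNIV. mat 1 $ i $ k * f k j w) = f i j w"
        by (simp add: mat_def if_distrib[of "\<lambda>x. x * _"] cong: if_cong)
      ultimately show "f i j w - w * (\<Sum>k\<in>UNIV. complex_of_real (A $ i $ k) * f k j w) = (if i = j then 1 else 0)"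
        by (simp add: mat_def)
    qed (use r in auto)
    from has_fps_expansion_cong[OF this refl, THEN iffD2, OF has_fps_expansion_const]
    show "(\<lambda>w. f i j w - w * (\<Sum>k\<in>UNIV. complex_of_real (A $ i $ k) * f k j w)) has_fps_expansion
      fps_const (if i = j then 1 else 0)" .
  qed
  have coeff: "fps_nth (F i j) t = complex_of_real (((((*v) A) ^^ t) (axis j 1)) $ i)" for i j t
  proof (induction t arbitrary: i)
    case 0
    show ?case using arg_cong[OF F_eq[of i j], of "\<lambda>f. fps_nth f 0"] by (auto simp: axis_def)
  next
    case (Suc t)
    have "fps_nth (F i j) (Suc t) = (\<Sum>k\<in>UNIV. complex_of_real (A $ i $ k) * fps_nth (F k j) t)"
      using arg_cong[OF F_eq[of i j], of "\<lambda>f. fps_nth f (Suc t)"]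
      by (simp add: fps_sum_nth)
    then show ?case by (simp add: Suc matrix_vector_mult_def)
  qed
  \<comment> \<open>Any number strictly between 1 and \<open>r\<close> would do: the terms of the
    series at \<open>s\<close> are bounded, so its coefficients decay like \<open>\<rho> ^ t\<close>
    for \<open>\<rho> = 1 / s\<close>.\<close>
  define s where "s = 1 + \<epsilon> / 2"
  have s: "1 < s" "s < r" using \<epsilon>(1) by (auto simp: s_def r_def)
  have "\<exists>B. \<forall>t. cmod (fps_nth (F i j) t * of_real s ^ t) \<le> B" for i j
  proof -
    have "ereal (norm (complex_of_real s)) < fps_conv_radius (F i j)"
      using s rad[of i j] by (intro less_le_trans[OF _ rad]) simp
    from summable_fps[OF this] have "Bseq (\<lambda>t. fps_nth (F i j) t * of_real s ^ t)"
      by (rule summable_imp_Bseq)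
    then show ?thesis by (auto simp: Bseq_def)
  qed
  then obtain B where B: "\<And>i j t. cmod (fps_nth (F i j) t * of_real s ^ t) \<le> B i j" by metis
  have B0: "0 \<le> B i j" for i j using order_trans[OF norm_ge_zero B] .
  define \<rho> where "\<rho> = inverse s"
  have \<rho>: "0 < \<rho>" "\<rho> < 1" using s by (auto simp: \<rho>_def inverse_less_1_iff)
  have entry: "\<bar>((((*v) A) ^^ t) (axis j 1)) $ i\<bar> \<le> B i j * \<rho> ^ t" for i j t
    using B[of i j t] s by (simp add: coeff \<rho>_def norm_mult norm_power power_inverse field_simps)
  define C where "C = (\<Sum>j\<in>UNIV. \<Sum>i\<in>UNIV. B i j)"
  have lin: "linear (((*v) A) ^^ t)" for t
    by (induction t) (auto intro: linear_compose[unfolded o_def] matrix_vector_mul_linear simp: linear_id[unfolded id_def] id_def o_def)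
  have "norm ((((*v) A) ^^ t) x) \<le> C * \<rho> ^ t * norm x" for t x
  proof -
    interpret L: linear "((*v) A) ^^ t" by (rule lin)
    have "x = (\<Sum>j\<in>UNIV. x $ j *\<^sub>R axis j 1)"
      by (simp add: vec_eq_iff axis_def if_distrib cong: if_cong)
    then have "norm ((((*v) A) ^^ t) x) = norm (\<Sum>j\<in>UNIV. x $ j *\<^sub>R (((*v) A) ^^ t) (axis j 1))"
      by (metis (mono_tags, lifting) L.scaleR L.sum sum.cong)
    also have "\<dots> \<le> (\<Sum>j\<in>UNIV. norm x * (\<Sum>i\<in>UNIV. B i j * \<rho> ^ t))"
    proof (intro sum_norm_le)
      fix j
      have "norm ((((*v) A) ^^ t) (axis j 1)) \<le> (\<Sum>i\<in>UNIV. B i j * \<rho> ^ t)"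
        by (rule order_trans[OF norm_le_l1_cart]) (intro sum_mono entry)
      then show "norm (x $ j *\<^sub>R (((*v) A) ^^ t) (axis j 1)) \<le> norm x * (\<Sum>i\<in>UNIV. B i j * \<rho> ^ t)"
        using component_le_norm_cart[of x j] by (simp add: mult_mono)
    qed
    also have "\<dots> = C * \<rho> ^ t * norm x"
      by (simp add: C_def sum_distrib_left sum_distrib_right mult_ac)
    finally show ?thesis .
  qed
  moreover have "0 \<le> C" using B0 by (simp add: C_def sum_nonneg)
  ultimately show thesis using \<rho> by (intro that)
qed

section \<open>Trajectories\<close>

definition energy :: "(nat \<Rightarrow> real^'m) \<Rightarrow> real" where
  "energy u = (\<Sum>t. (norm (u t))\<^sup>2)"

lemma l2D: "u \<in> l2 \<Longrightarrow> summable (\<lambda>t. (norm (u t))\<^sup>2)"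
  by (simp add: l2_def)

lemma energy_nonneg: "u \<in> l2 \<Longrightarrow> 0 \<le> energy u"
  unfolding energy_def by (intro suminf_nonneg l2D) auto

lemma l2dist_eq_energy: "l2dist u u' = sqrt (energy (\<lambda>t. u t - u' t))"
  by (simp add: l2dist_def energy_def)

lemma zero_in_l2: "(\<lambda>t. 0) \<in> l2"
  by (simp add: l2_def)

lemma power2_sum_le: "(a + b)\<^sup>2 \<le> 2 * a\<^sup>2 + 2 * (b::real)\<^sup>2"
  using zero_le_power2[of "a - b"] by (simp add: power2_eq_square algebra_simps)

lemma l2_add_scaleR:
  assumes "u \<in> l2" "h \<in> l2" shows "(\<lambda>t. u t + c *\<^sub>R h t) \<in> l2"
proof -
  have "summable (\<lambda>t. 2 * (norm (u t))\<^sup>2 + 2 * (c\<^sup>2 * (norm (h t))\<^sup>2))"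
    using assms[THEN l2D] by (intro summable_add summable_mult)
  moreover have "(norm (u t + c *\<^sub>R h t))\<^sup>2 \<le> 2 * (norm (u t))\<^sup>2 + 2 * (c\<^sup>2 * (norm (h t))\<^sup>2)" for t
  proof -
    have "(norm (u t + c *\<^sub>R h t))\<^sup>2 \<le> (norm (u t) + norm (c *\<^sub>R h t))\<^sup>2"
      by (intro power_mono norm_triangle_ineq) simp
    also have "\<dots> \<le> 2 * (norm (u t))\<^sup>2 + 2 * (norm (c *\<^sub>R h t))\<^sup>2" by (rule power2_sum_le)
    finally show ?thesis by (simp add: power_mult_distrib)
  qed
  ultimately show ?thesis unfolding l2_def by (auto intro: summable_comparison_test')
qed

lemma l2_diff: "u \<in> l2 \<Longrightarrow> h \<in> l2 \<Longrightarrow> (\<lambda>t. u t - h t) \<in> l2"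
  using l2_add_scaleR[of u h "-1"] by simp

lemma l2_cauchy_schwarz:
  assumes "u \<in> l2" "h \<in> l2"
  shows "summable (\<lambda>t. norm (u t) * norm (h t))"
    and "(\<Sum>t. norm (u t) * norm (h t)) \<le> sqrt (energy u) * sqrt (energy h)"
proof -
  have le: "(\<Sum>t<n. norm (u t) * norm (h t)) \<le> sqrt (energy u) * sqrt (energy h)" for n
  proof -
    have "(\<Sum>t<n. norm (u t) * norm (h t)) \<le> L2_set (\<lambda>t. norm (u t)) {..<n} * L2_set (\<lambda>t. norm (h t)) {..<n}"
      using L2_set_mult_ineq[of "\<lambda>t. norm (u t)" "\<lambda>t. norm (h t)" "{..<n}"] by simp
    also have "\<dots> \<le> sqrt (energy u) * sqrt (energy h)"
      unfolding L2_set_def energy_def using assms[THEN l2D]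
      by (intro mult_mono real_sqrt_le_mono sum_le_suminf) (auto intro: sum_nonneg suminf_nonneg)
    finally show ?thesis .
  qed
  show s: "summable (\<lambda>t. norm (u t) * norm (h t))"
    by (rule summableI_nonneg_bounded[OF _ le]) simp
  show "(\<Sum>t. norm (u t) * norm (h t)) \<le> sqrt (energy u) * sqrt (energy h)"
    by (rule suminf_le_const[OF s le])
qed

definition bform :: "real^'m^'m \<Rightarrow> (nat \<Rightarrow> real^'m) \<Rightarrow> (nat \<Rightarrow> real^'m) \<Rightarrow> real" where
  "bform Q s s' = (\<Sum>t. s t \<bullet> (Q *v s' t))"

lemma inner_matrix_le:
  fixes Q :: "real^'n^'m"
  shows "\<bar>x \<bullet> (Q *v y)\<bar> \<le> onorm ((*v) Q) * (norm x * norm y)"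
proof -
  have "\<bar>x \<bullet> (Q *v y)\<bar> \<le> norm x * norm (Q *v y)" by (rule Cauchy_Schwarz_ineq2)
  also have "\<dots> \<le> norm x * (onorm ((*v) Q) * norm y)"
    by (rule mult_left_mono[OF onorm[OF matrix_vector_mul_bounded_linear]]) simp
  finally show ?thesis by (simp add: mult_ac)
qed

lemma bform_summable:
  assumes "s \<in> l2" "s' \<in> l2" shows "summable (\<lambda>t. s t \<bullet> (Q *v s' t))"
  by (rule summable_comparison_test'[OF summable_mult[OF l2_cauchy_schwarz(1)[OF assms]]])
    (use inner_matrix_le in auto)

lemma bform_le:
  assumes "s \<in> l2" "s' \<in> l2"
  shows "\<bar>bform Q s s'\<bar> \<le> onorm ((*v) Q) * (sqrt (energy s) * sqrt (energy s'))"
proof -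
  note cs = l2_cauchy_schwarz[OF assms]
  have Q: "0 \<le> onorm ((*v) Q)" by (intro onorm_pos_le matrix_vector_mul_bounded_linear)
  have sm: "summable (\<lambda>t. norm (s t \<bullet> (Q *v s' t)))"
    by (rule summable_comparison_test'[OF summable_mult[OF cs(1)]]) (use inner_matrix_le in auto)
  have "\<bar>bform Q s s'\<bar> \<le> (\<Sum>t. norm (s t \<bullet> (Q *v s' t)))"
    unfolding bform_def using summable_norm[OF sm] by simp
  also have "\<dots> \<le> (\<Sum>t. onorm ((*v) Q) * (norm (s t) * norm (s' t)))"
    by (rule suminf_le[OF _ sm summable_mult[OF cs(1)]]) (use inner_matrix_le in auto)
  also have "\<dots> = onorm ((*v) Q) * (\<Sum>t. norm (s t) * norm (s' t))"
    by (rule suminf_mult[OF cs(1)])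
  also have "\<dots> \<le> onorm ((*v) Q) * (sqrt (energy s) * sqrt (energy s'))"
    by (rule mult_left_mono[OF cs(2) Q])
  finally show ?thesis .
qed

lemma bform_add_left:
  assumes "s \<in> l2" "h \<in> l2" "s' \<in> l2"
  shows "bform Q (\<lambda>t. s t + c *\<^sub>R h t) s' = bform Q s s' + c * bform Q h s'"
proof -
  have "(\<lambda>t. s t \<bullet> (Q *v s' t) + c * (h t \<bullet> (Q *v s' t))) sums (bform Q s s' + c * bform Q h s')"
    unfolding bform_def by (intro sums_add sums_mult summable_sums bform_summable assms)
  then show ?thesis
    unfolding bform_def[of Q "\<lambda>t. s t + c *\<^sub>R h t"] by (simp add: inner_add_left sums_iff)
qed

lemma bform_sym:
  assumes "transpose Q = Q" shows "bform Q s s' = bform Q s' s"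
proof -
  have "x \<bullet> (Q *v y) = y \<bullet> (Q *v x)" for x y
    by (metis assms dot_lmul_matrix inner_commute transpose_matrix_vector)
  then show ?thesis unfolding bform_def by presburger
qed

lemma bform_add_right:
  assumes "transpose Q = Q" "s \<in> l2" "h \<in> l2" "s' \<in> l2"
  shows "bform Q s' (\<lambda>t. s t + c *\<^sub>R h t) = bform Q s' s + c * bform Q s' h"
  using bform_add_left[OF assms(2-4)] by (simp add: bform_sym[OF assms(1), of s'])

text \<open>Expanded around the limits, every remaining term contains a difference and vanishes by
  \<open>bform_le\<close>. This carries inequalities for truncated inputs over to
  \<open>l2\<close>.\<close>

lemma bform_tendsto:
  assumes Q: "transpose Q = Q" and l2: "\<And>n. f n \<in> l2" "s \<in> l2" "\<And>n. f' n \<in> l2" "s' \<in> l2"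
    and lim: "(\<lambda>n. energy (\<lambda>t. f n t - s t)) \<longlonglongrightarrow> 0" "(\<lambda>n. energy (\<lambda>t. f' n t - s' t)) \<longlonglongrightarrow> 0"
  shows "(\<lambda>n. bform Q (f n) (f' n)) \<longlonglongrightarrow> bform Q s s'"
proof -
  define d where "d n t = f n t - s t" for n t
  define d' where "d' n t = f' n t - s' t" for n t
  have d: "d n \<in> l2" "d' n \<in> l2" for n
    unfolding d_def[abs_def] d'_def[abs_def] by (intro l2_diff l2)+
  have to0: "(\<lambda>n. bform Q (g n) (g' n)) \<longlonglongrightarrow> 0"
    if "\<And>n. g n \<in> l2" "\<And>n. g' n \<in> l2" "(\<lambda>n. sqrt (energy (g n)) * sqrt (energy (g' n))) \<longlonglongrightarrow> 0" for g g'
    by (rule Lim_null_comparison[OF always_eventually tendsto_mult_right_zero[OF that(3)]])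
      (use bform_le[OF that(1,2)] in auto)
  have e: "(\<lambda>n. sqrt (energy (d n))) \<longlonglongrightarrow> 0" "(\<lambda>n. sqrt (energy (d' n))) \<longlonglongrightarrow> 0"
    using tendsto_real_sqrt[OF lim(1)] tendsto_real_sqrt[OF lim(2)]
    by (simp_all add: d_def[abs_def] d'_def[abs_def])
  have "(\<lambda>n. bform Q s s' + bform Q s (d' n) + bform Q (d n) s' + bform Q (d n) (d' n))
      \<longlonglongrightarrow> bform Q s s' + 0 + 0 + 0"
    by (intro tendsto_add to0 d l2 tendsto_const tendsto_mult_right_zero tendsto_mult_left_zero
        tendsto_mult_zero e)
  moreover have "bform Q s s' + bform Q s (d' n) + bform Q (d n) s' + bform Q (d n) (d' n)
      = bform Q (f n) (f' n)" for n
  proof -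
    have "f n = (\<lambda>t. s t + 1 *\<^sub>R d n t)" "f' n = (\<lambda>t. s' t + 1 *\<^sub>R d' n t)" by (auto simp: d_def d'_def)
    then have "bform Q (f n) (f' n) = bform Q (\<lambda>t. s t + 1 *\<^sub>R d n t) (\<lambda>t. s' t + 1 *\<^sub>R d' n t)" by simp
    also have "\<dots> = bform Q s s' + bform Q s (d' n) + bform Q (d n) s' + bform Q (d n) (d' n)"
      by (simp only: bform_add_left[OF l2(2) d(1) l2_add_scaleR[OF l2(4) d(2)]]
          bform_add_right[OF Q l2(4) d(2) l2(2)] bform_add_right[OF Q l2(4) d(2) d(1)]) simp
    finally show ?thesis ..
  qed
  ultimately show ?thesis by simp
qed

section \<open>Scalar recursions that majorise the norm of the state\<close>

primrec lowpass :: "real \<Rightarrow> real \<Rightarrow> (nat \<Rightarrow> real) \<Rightarrow> nat \<Rightarrow> real" where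
  "lowpass \<rho> y b 0 = y"
| "lowpass \<rho> y b (Suc t) = \<rho> * lowpass \<rho> y b t + b t"

text \<open>Summing the recursion up to \<open>n\<close> reproduces the partial sum on the right
  with factor \<open>\<rho> < 1\<close>; absorbing it leaves a bound independent of
  \<open>n\<close>.\<close>

lemma contraction_sum:
  fixes f b :: "nat \<Rightarrow> real"
  assumes "\<And>t. f (Suc t) \<le> \<rho> * f t + b t" "\<And>t. 0 \<le> f t" "\<And>t. 0 \<le> b t" "summable b" "\<rho> < 1"
  shows "summable f" and "suminf f \<le> (f 0 + suminf b) / (1 - \<rho>)"
proof -
  have le: "(\<Sum>t<n. f t) \<le> (f 0 + suminf b) / (1 - \<rho>)" for n
  proof -
    have "(\<Sum>t<n. f t) \<le> (\<Sum>t<Suc n. f t)" using assms(2) by simp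
    also have "\<dots> = f 0 + (\<Sum>t<n. f (Suc t))" by (rule sum.lessThan_Suc_shift)
    also have "\<dots> \<le> f 0 + (\<Sum>t<n. \<rho> * f t + b t)" by (intro add_left_mono sum_mono assms(1))
    also have "\<dots> \<le> f 0 + \<rho> * (\<Sum>t<n. f t) + suminf b"
      using sum_le_suminf[OF assms(4), of "{..<n}"] assms(3) by (simp add: sum.distrib sum_distrib_left)
    finally show ?thesis using assms(5) by (simp add: field_simps)
  qed
  show s: "summable f" by (rule summableI_nonneg_bounded[OF assms(2) le])
  show "suminf f \<le> (f 0 + suminf b) / (1 - \<rho>)" by (rule suminf_le_const[OF s le])
qed

context
  fixes \<rho> y :: real and b :: "nat \<Rightarrow> real"
  assumes \<rho>: "0 \<le> \<rho>" "\<rho> < 1" and y: "0 \<le> y" and b: "\<And>t. 0 \<le> b t"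
begin

lemma lowpass_nonneg: "0 \<le> lowpass \<rho> y b t"
  by (induction t) (use \<rho> y b in auto)

lemma lowpass_summable: "summable b \<Longrightarrow> summable (lowpass \<rho> y b)"
  by (rule contraction_sum(1)[of _ \<rho> b]) (use \<rho> b lowpass_nonneg in auto)

lemma lowpass_square:
  assumes "summable (\<lambda>t. (b t)\<^sup>2)"
  shows "summable (\<lambda>t. (lowpass \<rho> y b t)\<^sup>2)"
    and "(\<Sum>t. (lowpass \<rho> y b t)\<^sup>2) \<le> (y\<^sup>2 + (\<Sum>t. (b t)\<^sup>2) / (1 - \<rho>)) / (1 - \<rho>)"
proof -
  \<comment> \<open>Convexity of the square with weights \<rho> and \<open>1 - \<rho>\<close>,
    applied to the values \<open>lowpass \<rho> y b t\<close> and
    \<open>b t / (1 - \<rho>)\<close>.\<close>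
  have step: "(lowpass \<rho> y b (Suc t))\<^sup>2 \<le> \<rho> * (lowpass \<rho> y b t)\<^sup>2 + (b t)\<^sup>2 / (1 - \<rho>)" for t
  proof -
    let ?u = "lowpass \<rho> y b t" and ?s = "1 - \<rho>"
    have s: "0 < ?s" using \<rho> by simp
    have "?s * (\<rho> * ?u\<^sup>2 + (b t)\<^sup>2 / ?s - (\<rho> * ?u + b t)\<^sup>2) = \<rho> * (?s * ?u - b t)\<^sup>2"
      using s by (simp add: power2_eq_square field_simps)
    then have "0 \<le> ?s * (\<rho> * ?u\<^sup>2 + (b t)\<^sup>2 / ?s - (\<rho> * ?u + b t)\<^sup>2)" using \<rho> by simp
    then show ?thesis using s by (simp add: zero_le_mult_iff)
  qed
  note * = contraction_sum[of "\<lambda>t. (lowpass \<rho> y b t)\<^sup>2" \<rho> "\<lambda>t. (b t)\<^sup>2 / (1 - \<rho>)", OF step]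
  show "summable (\<lambda>t. (lowpass \<rho> y b t)\<^sup>2)"
    by (rule *(1)) (use \<rho> assms in \<open>auto intro: summable_divide\<close>)
  have "(\<Sum>t. (lowpass \<rho> y b t)\<^sup>2) \<le> ((lowpass \<rho> y b 0)\<^sup>2 + (\<Sum>t. (b t)\<^sup>2 / (1 - \<rho>))) / (1 - \<rho>)"
    by (rule *(2)) (use \<rho> assms in \<open>auto intro: summable_divide\<close>)
  then show "(\<Sum>t. (lowpass \<rho> y b t)\<^sup>2) \<le> (y\<^sup>2 + (\<Sum>t. (b t)\<^sup>2) / (1 - \<rho>)) / (1 - \<rho>)"
    using suminf_divide[OF assms, of "1 - \<rho>"] by simp
qed

text \<open>Here \<rho> is simply estimated by 1, which turns the recursion into a plain sum and
  costs one power.\<close>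

lemma lowpass_growth:
  assumes "y = 0" "\<And>t. b t \<le> M * (1 + real t) ^ m"
  shows "lowpass \<rho> y b t \<le> M * (1 + real t) ^ Suc m"
proof (induction t)
  have M: "0 \<le> M" using order_trans[OF b assms(2)[of 0]] by simp
  {
    case 0
    then show ?case using M assms(1) by simp
  next
    case (Suc t)
    have "\<rho> * lowpass \<rho> y b t \<le> 1 * lowpass \<rho> y b t"
      using \<rho> lowpass_nonneg by (intro mult_right_mono) auto
    then have "lowpass \<rho> y b (Suc t) \<le> M * (1 + real t) ^ Suc m + M * (1 + real t) ^ m"
      using Suc assms(2)[of t] by simp
    also have "\<dots> = M * ((1 + real (Suc t)) * (1 + real t) ^ m)" by (simp add: algebra_simps)
    also have "\<dots> \<le> M * ((1 + real (Suc t)) * (1 + real (Suc t)) ^ m)"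
      using M by (intro mult_left_mono power_mono) auto
    finally show ?case by simp
  }
qed

end

lemma summable_poly_geometric:
  fixes \<rho> :: real
  assumes "0 < \<rho>" "\<rho> < 1"
  shows "summable (\<lambda>t. \<rho> ^ t * (1 + real t) ^ m)"
proof -
  have "(\<lambda>n. \<rho> * (1 + inverse (real (Suc n))) ^ m) \<longlonglongrightarrow> \<rho> * (1 + 0) ^ m"
    by (intro tendsto_intros LIMSEQ_inverse_real_of_nat)
  moreover have "\<rho> * (1 + 0) ^ m < (1 + \<rho>) / 2" using assms by simp
  ultimately have "\<forall>\<^sub>F n in sequentially. \<rho> * (1 + inverse (real (Suc n))) ^ m < (1 + \<rho>) / 2"
    by (rule order_tendstoD)
  then obtain N where N: "\<And>n. N \<le> n \<Longrightarrow> \<rho> * (1 + inverse (real (Suc n))) ^ m < (1 + \<rho>) / 2"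
    by (auto simp: eventually_sequentially)
  show ?thesis
  proof (rule summable_ratio_test)
    fix n assume "N \<le> n"
    have "1 + real (Suc n) = (1 + inverse (real (Suc n))) * real (Suc n)"
      unfolding distrib_right by simp
    then have "1 + real (Suc n) = (1 + inverse (real (Suc n))) * (1 + real n)" by simp
    then have "\<rho> ^ Suc n * (1 + real (Suc n)) ^ m
        = \<rho> * (1 + inverse (real (Suc n))) ^ m * (\<rho> ^ n * (1 + real n) ^ m)"
      by (simp only: power_mult_distrib power_Suc mult_ac)
    also have "\<dots> \<le> (1 + \<rho>) / 2 * (\<rho> ^ n * (1 + real n) ^ m)"
      using N[OF \<open>N \<le> n\<close>] assms by (intro mult_right_mono) auto
    finally show "norm (\<rho> ^ Suc n * (1 + real (Suc n)) ^ m) \<le> (1 + \<rho>) / 2 * norm (\<rho> ^ n * (1 + real n) ^ m)"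
      using assms by (simp add: norm_mult norm_power)
  qed (use assms in simp)
qed

lemma sum_UNIV_sum: "(\<Sum>i\<in>(UNIV :: ('a::finite + 'b::finite) set). f i) = (\<Sum>i\<in>UNIV. f (Inl i)) + (\<Sum>i\<in>UNIV. f (Inr i))"
  unfolding UNIV_Plus_UNIV[symmetric] by (subst sum.Plus) (simp_all add: o_def)

lemma norm_stack: "(norm (stack x v w))\<^sup>2 = (norm x)\<^sup>2 + (norm v)\<^sup>2 + (norm w)\<^sup>2"
  unfolding norm_power2_vec sum_UNIV_sum by (simp add: stack_def)

lemma norm_stack_le: "norm (stack x v w) \<le> norm x + norm v + norm w"
proof (rule power2_le_imp_le)
  show "(norm (stack x v w))\<^sup>2 \<le> (norm x + norm v + norm w)\<^sup>2"
    unfolding norm_stack by (simp add: power2_eq_square distrib_left distrib_right)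
qed simp

lemma stack_add_scaleR:
  "stack (x + c *\<^sub>R x') (v + c *\<^sub>R v') (w + c *\<^sub>R w') = stack x v w + c *\<^sub>R stack x' v' w'"
  by (simp add: stack_def vec_eq_iff split: sum.split)

section \<open>State trajectories of a stable system\<close>

locale schur_system =
  fixes A :: "real^'n^'n" and B1 :: "real^'k^'n" and B2 :: "real^'q^'n"
  assumes schur: "schur A"
begin

definition sig :: "real^'n \<Rightarrow> (nat \<Rightarrow> real^'k) \<Rightarrow> (nat \<Rightarrow> real^'q) \<Rightarrow> nat \<Rightarrow> real^('n+'k+'q)" where
  "sig a v w t = stack (traj A B1 B2 a v w t) (v t) (w t)"

lemma traj_add_scaleR:
  "traj A B1 B2 (a + c *\<^sub>R a') (\<lambda>t. v t + c *\<^sub>R v' t) (\<lambda>t. w t + c *\<^sub>R w' t) t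
    = traj A B1 B2 a v w t + c *\<^sub>R traj A B1 B2 a' v' w' t"
  by (induction t) (auto simp: matrix_vector_right_distrib matrix_vector_mult_scaleR algebra_simps)

lemma sig_add_scaleR:
  "sig (a + c *\<^sub>R a') (\<lambda>t. v t + c *\<^sub>R v' t) (\<lambda>t. w t + c *\<^sub>R w' t) = (\<lambda>t. sig a v w t + c *\<^sub>R sig a' v' w' t)"
  unfolding sig_def traj_add_scaleR stack_add_scaleR by simp

text \<open>One pair \<rho>, \<open>C\<close> serves all initial states and inputs, so the constants
  derived from it are uniform. The same majorant then yields energy, summability and growth
  estimates.\<close>

definition response_gain :: "real \<Rightarrow> real \<Rightarrow> bool" where
  "response_gain \<rho> C \<longleftrightarrow> 0 < \<rho> \<and> \<rho> < 1 \<and> 0 \<le> C \<and>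
    (\<forall>a v w t. norm (traj A B1 B2 a v w t)
      \<le> lowpass \<rho> (C * norm a) (\<lambda>t. C * (norm (v t) + norm (w t))) t)"

lemma response_gainD:
  assumes "response_gain \<rho> C"
  shows "0 < \<rho>" "\<rho> < 1" "0 \<le> C"
    "norm (traj A B1 B2 a v w t) \<le> lowpass \<rho> (C * norm a) (\<lambda>t. C * (norm (v t) + norm (w t))) t"
  using assms by (simp_all add: response_gain_def)

text \<open>The induction bounds all powers of \<open>A\<close> applied to the state at once. This
  amounts to the adapted norm given by the supremum over \<open>k\<close> of
  \<open>norm (A^k x) / \<rho>^k\<close>, in which \<open>A\<close> contracts by \<rho>; the claim
  is the case \<open>k = 0\<close>.\<close>

lemma response_gain_exists: "\<exists>\<rho> C. response_gain \<rho> C"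
proof -
  obtain C \<rho> where C: "0 \<le> C" "0 < \<rho>" "\<rho> < 1"
    "\<And>t x. norm ((((*v) A) ^^ t) x) \<le> C * \<rho> ^ t * norm x"
    using schur_power_decay[OF schur] by metis
  define K where "K = 1 + onorm ((*v) B1) + onorm ((*v) B2)"
  have on: "0 \<le> onorm ((*v) B1)" "0 \<le> onorm ((*v) B2)"
    by (intro onorm_pos_le matrix_vector_mul_bounded_linear)+
  then have K: "1 \<le> K" by (simp add: K_def)
  have B: "norm (B1 *v x + B2 *v x') \<le> K * (norm x + norm x')" for x x'
  proof -
    have "norm (B1 *v x + B2 *v x') \<le> onorm ((*v) B1) * norm x + onorm ((*v) B2) * norm x'"
      by (intro norm_triangle_le add_mono onorm[OF matrix_vector_mul_bounded_linear])
    also have "\<dots> \<le> K * norm x + K * norm x'"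
      using on by (intro add_mono mult_right_mono) (auto simp: K_def)
    finally show ?thesis by (simp add: algebra_simps)
  qed
  have "norm ((((*v) A) ^^ k) (traj A B1 B2 a v w t))
      \<le> \<rho> ^ k * lowpass \<rho> (C * K * norm a) (\<lambda>t. C * K * (norm (v t) + norm (w t))) t" for a v w t k
  proof (induction t arbitrary: k)
    case 0
    have "C * norm a * 1 \<le> C * norm a * K" using C(1) K by (intro mult_left_mono) auto
    then have "\<rho> ^ k * (C * norm a) \<le> \<rho> ^ k * (C * K * norm a)"
      using C(2) by (intro mult_left_mono) (auto simp: mult_ac)
    then show ?case using C(4)[of k a] by (simp add: mult_ac)
  next
    case (Suc t)
    let ?x = "traj A B1 B2 a v w t" and ?b = "B1 *v v t + B2 *v w t"
    have lin: "(((*v) A) ^^ k) (x + x') = (((*v) A) ^^ k) x + (((*v) A) ^^ k) x'" for x x'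
      by (induction k) (auto simp: matrix_vector_right_distrib)
    have "(((*v) A) ^^ k) (traj A B1 B2 a v w (Suc t)) = (((*v) A) ^^ Suc k) ?x + (((*v) A) ^^ k) ?b"
      by (simp only: traj.simps add.assoc lin funpow_Suc_right comp_apply)
    then have "norm ((((*v) A) ^^ k) (traj A B1 B2 a v w (Suc t)))
        \<le> norm ((((*v) A) ^^ Suc k) ?x) + norm ((((*v) A) ^^ k) ?b)" by (metis norm_triangle_ineq)
    moreover have "norm ((((*v) A) ^^ k) ?b) \<le> \<rho> ^ k * (C * K * (norm (v t) + norm (w t)))"
    proof -
      have "C * \<rho> ^ k * norm ?b \<le> C * \<rho> ^ k * (K * (norm (v t) + norm (w t)))"
        using C by (intro mult_left_mono B) auto
      with C(4)[of k ?b] show ?thesis by (simp add: mult_ac)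
    qed
    ultimately show ?case using Suc[of "Suc k"] by (simp add: algebra_simps)
  qed
  from this[of 0] show ?thesis
    unfolding response_gain_def using C K by (intro exI[of _ \<rho>] exI[of _ "C * K"]) simp
qed

lemma sig_energy:
  obtains K where "0 \<le> K" "\<forall>a v w. v \<in> l2 \<longrightarrow> w \<in> l2 \<longrightarrow>
    sig a v w \<in> l2 \<and> energy (sig a v w) \<le> K * ((norm a)\<^sup>2 + energy v + energy w)"
proof -
  obtain \<rho> C where gain: "response_gain \<rho> C" using response_gain_exists by blast
  note C = response_gainD[OF gain]
  \<comment> \<open>The 1 covers the inputs inside the stacked signal; the rest is
    \<open>lowpass_square\<close> with \<open>y = C * norm a\<close> and with
    \<open>(b t)\<^sup>2\<close> estimated by \<open>2 * C\<^sup>2\<close> times the squared norms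
    of the inputs.\<close>
  define K where "K = 1 + (C\<^sup>2 + 2 * C\<^sup>2 / (1 - \<rho>)) / (1 - \<rho>)"
  have main: "sig a v w \<in> l2 \<and> energy (sig a v w) \<le> K * ((norm a)\<^sup>2 + energy v + energy w)"
    if l2: "v \<in> l2" "w \<in> l2" for a v w
  proof -
    define b where "b = (\<lambda>t. C * (norm (v t) + norm (w t)))"
    define f where "f = lowpass \<rho> (C * norm a) b"
    have b0: "0 \<le> b t" for t using C by (simp add: b_def)
    note vs = l2D[OF l2(1)] and ws = l2D[OF l2(2)]
    have b2: "(b t)\<^sup>2 \<le> 2 * C\<^sup>2 * ((norm (v t))\<^sup>2 + (norm (w t))\<^sup>2)" for t
    proof -
      have "(b t)\<^sup>2 = C\<^sup>2 * (norm (v t) + norm (w t))\<^sup>2" by (simp add: b_def power_mult_distrib)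
      also have "\<dots> \<le> C\<^sup>2 * (2 * (norm (v t))\<^sup>2 + 2 * (norm (w t))\<^sup>2)"
        by (intro mult_left_mono power2_sum_le) simp
      finally show ?thesis by (simp add: algebra_simps)
    qed
    have bs': "summable (\<lambda>t. 2 * C\<^sup>2 * ((norm (v t))\<^sup>2 + (norm (w t))\<^sup>2))"
      by (intro summable_mult summable_add vs ws)
    have bs: "summable (\<lambda>t. (b t)\<^sup>2)"
      by (rule summable_comparison_test'[OF bs']) (use b2 in auto)
    have "(\<Sum>t. (b t)\<^sup>2) \<le> (\<Sum>t. 2 * C\<^sup>2 * ((norm (v t))\<^sup>2 + (norm (w t))\<^sup>2))"
      by (rule suminf_le[OF b2 bs bs'])
    also have "\<dots> = 2 * C\<^sup>2 * (energy v + energy w)"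
      unfolding energy_def suminf_add[OF vs ws] by (rule suminf_mult[OF summable_add[OF vs ws]])
    finally have bE: "(\<Sum>t. (b t)\<^sup>2) \<le> 2 * C\<^sup>2 * (energy v + energy w)" .
    have f: "summable (\<lambda>t. (f t)\<^sup>2)"
      "(\<Sum>t. (f t)\<^sup>2) \<le> ((C * norm a)\<^sup>2 + (\<Sum>t. (b t)\<^sup>2) / (1 - \<rho>)) / (1 - \<rho>)"
      unfolding f_def by (intro lowpass_square; use C b0 bs in simp)+
    have le: "(norm (sig a v w t))\<^sup>2 \<le> (f t)\<^sup>2 + (norm (v t))\<^sup>2 + (norm (w t))\<^sup>2" for t
    proof -
      have "(norm (traj A B1 B2 a v w t))\<^sup>2 \<le> (f t)\<^sup>2"
        unfolding f_def b_def by (intro power_mono C) simp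
      then show ?thesis by (simp add: sig_def norm_stack)
    qed
    have s': "summable (\<lambda>t. (f t)\<^sup>2 + (norm (v t))\<^sup>2 + (norm (w t))\<^sup>2)"
      by (intro summable_add f vs ws)
    have s: "summable (\<lambda>t. (norm (sig a v w t))\<^sup>2)"
      by (rule summable_comparison_test'[OF s']) (use le in auto)
    have "energy (sig a v w) \<le> (\<Sum>t. (f t)\<^sup>2 + (norm (v t))\<^sup>2 + (norm (w t))\<^sup>2)"
      unfolding energy_def by (rule suminf_le[OF le s s'])
    also have "\<dots> = (\<Sum>t. (f t)\<^sup>2) + energy v + energy w"
      unfolding energy_def using suminf_add[OF summable_add[OF f(1) vs] ws] suminf_add[OF f(1) vs] by simp
    also have "(\<Sum>t. (f t)\<^sup>2) \<le> (C\<^sup>2 * (norm a)\<^sup>2 + 2 * C\<^sup>2 * (energy v + energy w) / (1 - \<rho>)) / (1 - \<rho>)"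
      by (rule order_trans[OF f(2)])
        (use C(2) bE in \<open>auto intro!: divide_right_mono simp: power_mult_distrib\<close>)
    also have "\<dots> + energy v + energy w \<le> K * ((norm a)\<^sup>2 + energy v + energy w)"
    proof -
      let ?s = "1 - \<rho>" let ?e = "energy v + energy w"
      have e: "0 \<le> ?e" by (rule add_nonneg_nonneg[OF energy_nonneg[OF l2(1)] energy_nonneg[OF l2(2)]])
      have "K * ((norm a)\<^sup>2 + ?e) - ((C\<^sup>2 * (norm a)\<^sup>2 + 2 * C\<^sup>2 * ?e / ?s) / ?s + ?e)
          = (norm a)\<^sup>2 + C\<^sup>2 * ?e / ?s + 2 * C\<^sup>2 * (norm a)\<^sup>2 / ?s / ?s"
        by (simp add: K_def algebra_simps add_divide_distrib)
      moreover have "0 \<le> (norm a)\<^sup>2 + C\<^sup>2 * ?e / ?s + 2 * C\<^sup>2 * (norm a)\<^sup>2 / ?s / ?s"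
        using mult_nonneg_nonneg[OF zero_le_power2 e, of C] C(2) by simp
      ultimately show ?thesis by (simp add: add.assoc)
    qed
    finally show ?thesis using s by (simp add: l2_def)
  qed
  have "0 \<le> K" using C by (simp add: K_def)
  with main show thesis by (intro that) auto
qed

lemma sig_l2: "v \<in> l2 \<Longrightarrow> w \<in> l2 \<Longrightarrow> sig a v w \<in> l2"
  by (metis sig_energy)

lemma sig_summable_norm:
  assumes "summable (\<lambda>t. norm (v t))" "summable (\<lambda>t. norm (w t))"
  shows "summable (\<lambda>t. norm (sig a v w t))"
proof -
  obtain \<rho> C where gain: "response_gain \<rho> C" using response_gain_exists by blast
  note C = response_gainD[OF gain]
  have "summable (lowpass \<rho> (C * norm a) (\<lambda>t. C * (norm (v t) + norm (w t))))"
    by (intro lowpass_summable summable_mult summable_add assms) (use C in auto)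
  then have "summable (\<lambda>t. lowpass \<rho> (C * norm a) (\<lambda>t. C * (norm (v t) + norm (w t))) t + norm (v t) + norm (w t))"
    by (intro summable_add assms) simp
  then show ?thesis
    by (rule summable_comparison_test')
      (use C(4) in \<open>auto simp: sig_def intro!: order_trans[OF norm_stack_le]\<close>)
qed

text \<open>The free response decays exponentially, so it is paired boundedly even with inputs that are
  only controlled up to polynomial growth.\<close>

lemma free_response_pairing:
  obtains K where "0 \<le> K"
    "\<forall>v w M. v \<in> l2 \<longrightarrow> w \<in> l2 \<longrightarrow> (\<forall>t. norm (v t) + norm (w t) \<le> M * (1 + real t) ^ m) \<longrightarrow>
      \<bar>bform Q (sig a (\<lambda>t. 0) (\<lambda>t. 0)) (sig 0 v w)\<bar> \<le> K * M"
proof -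
  obtain \<rho> C where gain: "response_gain \<rho> C" using response_gain_exists by blast
  note C = response_gainD[OF gain]
  let ?f = "sig a (\<lambda>t. 0) (\<lambda>t. 0)"
  have f: "norm (?f t) \<le> C * norm a * \<rho> ^ t" for t
  proof -
    have "lowpass \<rho> (C * norm a) (\<lambda>t. 0) t = C * norm a * \<rho> ^ t" by (induction t) auto
    then show ?thesis
      using C(4)[of a "\<lambda>t. 0" "\<lambda>t. 0" t] norm_stack_le[of "traj A B1 B2 a (\<lambda>t. 0) (\<lambda>t. 0) t" "0 :: real^'k" "0 :: real^'q"]
      by (simp add: sig_def)
  qed
  \<comment> \<open>In \<open>C + 1\<close>, the \<open>C\<close> accounts for the forced state and
    the 1 for the inputs in the stacked signal.\<close>
  define L where "L = onorm ((*v) Q) * (C * norm a * (C + 1))"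
  have Q: "0 \<le> onorm ((*v) Q)" by (intro onorm_pos_le matrix_vector_mul_bounded_linear)
  have L: "0 \<le> L" using Q C(3) by (simp add: L_def)
  \<comment> \<open>\<open>Suc m\<close>, because the state may grow one power faster than its
    inputs.\<close>
  define K where "K = L * (\<Sum>t. \<rho> ^ t * (1 + real t) ^ Suc m)"
  have sm: "summable (\<lambda>t. \<rho> ^ t * (1 + real t) ^ Suc m)" by (rule summable_poly_geometric[OF C(1,2)])
  have K: "0 \<le> K" unfolding K_def using L C(1) by (intro mult_nonneg_nonneg suminf_nonneg sm) auto
  have "\<bar>bform Q ?f (sig 0 v w)\<bar> \<le> K * M"
    if l2: "v \<in> l2" "w \<in> l2" and M: "\<And>t. norm (v t) + norm (w t) \<le> M * (1 + real t) ^ m" for v w M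
  proof -
    have M0: "0 \<le> M" using order_trans[OF _ M[of 0], of 0] by simp
    have s: "norm (sig 0 v w t) \<le> (C + 1) * M * (1 + real t) ^ Suc m" for t
    proof -
      have "lowpass \<rho> (C * norm (0 :: real^'n)) (\<lambda>t. C * (norm (v t) + norm (w t))) t \<le> C * M * (1 + real t) ^ Suc m"
        by (rule lowpass_growth) (use C mult_left_mono[OF M C(3)] in \<open>auto simp: mult_ac\<close>)
      moreover have "M * (1 + real t) ^ m \<le> M * (1 + real t) ^ Suc m"
        using M0 by (intro mult_left_mono power_increasing) auto
      ultimately show ?thesis
        using C(4)[of 0 v w t] M[of t] norm_stack_le[of "traj A B1 B2 0 v w t" "v t" "w t"]
        by (simp add: sig_def algebra_simps)
    qed
    have le: "\<bar>?f t \<bullet> (Q *v sig 0 v w t)\<bar> \<le> L * M * (\<rho> ^ t * (1 + real t) ^ Suc m)" for t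
    proof -
      have "norm (?f t) * norm (sig 0 v w t) \<le> (C * norm a * \<rho> ^ t) * ((C + 1) * M * (1 + real t) ^ Suc m)"
        using C(1,3) by (intro mult_mono f s) auto
      from order_trans[OF inner_matrix_le mult_left_mono[OF this Q]] show ?thesis
        by (simp only: L_def mult_ac)
    qed
    have sm2: "summable (\<lambda>t. L * M * (\<rho> ^ t * (1 + real t) ^ Suc m))" by (rule summable_mult[OF sm])
    have sm3: "summable (\<lambda>t. norm (?f t \<bullet> (Q *v sig 0 v w t)))"
      by (rule summable_comparison_test'[OF sm2]) (use le in auto)
    have "\<bar>bform Q ?f (sig 0 v w)\<bar> \<le> (\<Sum>t. norm (?f t \<bullet> (Q *v sig 0 v w t)))"
      unfolding bform_def using summable_norm[OF sm3] by simp
    also have "\<dots> \<le> (\<Sum>t. L * M * (\<rho> ^ t * (1 + real t) ^ Suc m))"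
      by (rule suminf_le[OF _ sm3 sm2]) (use le in auto)
    also have "\<dots> = K * M" unfolding suminf_mult[OF sm] K_def by (simp add: mult_ac)
    finally show ?thesis .
  qed
  with K show thesis by (intro that) auto
qed

end

section \<open>Frequency domain\<close>

definition zvec :: "(nat \<Rightarrow> real^'m) \<Rightarrow> complex \<Rightarrow> complex^'m" where
  "zvec u z = (\<chi> i. ztrans (\<lambda>t. complex_of_real (u t $ i)) z)"

definition inp :: "complex^'k \<Rightarrow> complex^'q \<Rightarrow> complex^('k+'q)" where
  "inp V W = (\<chi> j. case j of Inl b \<Rightarrow> V $ b | Inr c \<Rightarrow> W $ c)"

lemma summable_component:
  assumes "summable (\<lambda>t. norm (u t))"
  shows "summable (\<lambda>t. cmod (complex_of_real (u t $ i)))"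
  by (rule summable_comparison_test'[OF assms]) (simp add: component_le_norm_cart)

lemma zvec_sums:
  assumes "summable (\<lambda>t. norm (u t))" "cmod z = 1"
  shows "(\<lambda>t. complex_of_real (u t $ i) * inverse z ^ t) sums zvec u z $ i"
  using ztrans_sums[OF summable_component[OF assms(1)] assms(2)] by (simp add: zvec_def)

lemma zvec_zero: "zvec (\<lambda>t. 0) z = 0"
  by (simp add: zvec_def ztrans_def vec_eq_iff)

text \<open>The shift rule has in general an extra term from \<open>u 0\<close>; here it vanishes.
  The rule is applied to states started at the origin.\<close>

lemma zvec_shift:
  assumes "summable (\<lambda>t. norm (u t))" "cmod z = 1" "u 0 = 0"
  shows "zvec (\<lambda>t. u (Suc t)) z = z *s zvec u z"
proof -
  have z: "z \<noteq> 0" using assms(2) by auto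
  have "zvec (\<lambda>t. u (Suc t)) z $ i = z * zvec u z $ i" for i
  proof -
    have "(\<lambda>t. complex_of_real (u (Suc t) $ i) * inverse z ^ Suc t) sums zvec u z $ i"
      by (rule sums_Suc_iff[where f = "\<lambda>t. complex_of_real (u t $ i) * inverse z ^ t", THEN iffD2])
        (use zvec_sums[OF assms(1,2), of i] assms(3) in simp)
    from sums_mult[OF this, of z]
    have "(\<lambda>t. z * (complex_of_real (u (Suc t) $ i) * inverse z ^ Suc t)) sums (z * zvec u z $ i)" .
    moreover have "z * (c * inverse z ^ Suc t) = c * inverse z ^ t" for c t
      using z by (simp add: field_simps)
    ultimately have "(\<lambda>t. complex_of_real (u (Suc t) $ i) * inverse z ^ t) sums (z * zvec u z $ i)"
      by (simp only:)
    then show ?thesis by (simp add: zvec_def ztrans_def sums_iff)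
  qed
  then show ?thesis by (simp add: vec_eq_iff)
qed

lemma zvec_add:
  assumes "summable (\<lambda>t. norm (u t))" "summable (\<lambda>t. norm (u' t))" "cmod z = 1"
  shows "zvec (\<lambda>t. u t + u' t) z = zvec u z + zvec u' z"
proof -
  have "zvec (\<lambda>t. u t + u' t) z $ i = zvec u z $ i + zvec u' z $ i" for i
    using sums_add[OF zvec_sums[OF assms(1,3), of i] zvec_sums[OF assms(2,3), of i]]
    unfolding zvec_def[of "\<lambda>t. u t + u' t"] ztrans_def by (simp add: sums_iff algebra_simps)
  then show ?thesis by (simp add: vec_eq_iff)
qed

lemma zvec_matrix:
  assumes "summable (\<lambda>t. norm (u t))" "cmod z = 1"
  shows "zvec (\<lambda>t. M *v u t) z = cmat M *v zvec u z"
proof -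
  have "zvec (\<lambda>t. M *v u t) z $ i = (cmat M *v zvec u z) $ i" for i
  proof -
    have "(\<lambda>t. \<Sum>j\<in>UNIV. complex_of_real (M $ i $ j) * (complex_of_real (u t $ j) * inverse z ^ t))
        sums (\<Sum>j\<in>UNIV. complex_of_real (M $ i $ j) * zvec u z $ j)"
      by (intro sums_sum sums_mult zvec_sums assms)
    moreover have "(\<Sum>j\<in>UNIV. complex_of_real (M $ i $ j) * (complex_of_real (u t $ j) * inverse z ^ t))
        = complex_of_real ((M *v u t) $ i) * inverse z ^ t" for t
      by (simp add: matrix_vector_mult_def sum_distrib_left sum_distrib_right mult_ac)
    ultimately show ?thesis
      unfolding zvec_def[of "\<lambda>t. M *v u t"] ztrans_def
      by (simp add: sums_iff matrix_vector_mult_def cmat_def)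
  qed
  then show ?thesis by (simp add: vec_eq_iff)
qed

lemma sesq_ctrans_mult:
  fixes F :: "complex^'m^'n"
  shows "sesq (ctrans F ** N ** F) x y = sesq N (F *v x) (F *v y)"
proof -
  have left: "sesq (ctrans F ** M) x y = sesq M (F *v x) y" for M y
  proof -
    have "sesq (ctrans F ** M) x y = (\<Sum>i\<in>UNIV. \<Sum>k\<in>UNIV. cnj (x $ i) * (cnj (F $ k $ i) * (M *v y) $ k))"
    proof -
      have "(ctrans F *v y) $ i = (\<Sum>k\<in>UNIV. cnj (F $ k $ i) * y $ k)" for y i
        by (simp add: matrix_vector_mult_def ctrans_def)
      then show ?thesis
        unfolding sesq_def matrix_vector_mul_assoc[symmetric] by (simp add: sum_distrib_left)
    qed
    also have "\<dots> = (\<Sum>k\<in>UNIV. \<Sum>i\<in>UNIV. cnj (x $ i) * (cnj (F $ k $ i) * (M *v y) $ k))"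
      by (rule sum.swap)
    also have "\<dots> = sesq M (F *v x) y"
      by (simp add: sesq_def matrix_vector_mult_def[of F] sum_distrib_left sum_distrib_right mult_ac)
    finally show ?thesis .
  qed
  show ?thesis
    unfolding matrix_mul_assoc[symmetric] left by (simp add: sesq_def matrix_vector_mul_assoc)
qed

lemma parseval_bform:
  assumes s: "summable (\<lambda>t. norm (s t))" and s': "summable (\<lambda>t. norm (s' t))"
  shows "((\<lambda>\<theta>. sesq (cmat Q) (zvec s (cis \<theta>)) (zvec s' (cis \<theta>))) has_integral
    complex_of_real (2 * pi * bform Q s s')) {0..2 * pi}"
proof -
  let ?s = "\<lambda>i t. complex_of_real (s t $ i)" and ?s' = "\<lambda>i t. complex_of_real (s' t $ i)"
  define I where "I i j = (\<Sum>t. cnj (?s i t) * ?s' j t)" for i j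
  note P = parseval[OF summable_component[OF s] summable_component[OF s']]
  have 1: "((\<lambda>\<theta>. \<Sum>i\<in>UNIV. \<Sum>j\<in>UNIV. complex_of_real (Q $ i $ j) *
      (cnj (ztrans (?s i) (cis \<theta>)) * ztrans (?s' j) (cis \<theta>))) has_integral
      (\<Sum>i\<in>UNIV. \<Sum>j\<in>UNIV. complex_of_real (Q $ i $ j) * (2 * pi * I i j))) {0..2 * pi}"
    unfolding I_def by (intro has_integral_sum has_integral_mult_right P(1)) auto
  have 2: "(\<Sum>i\<in>UNIV. \<Sum>j\<in>UNIV. complex_of_real (Q $ i $ j) *
      (cnj (ztrans (?s i) z) * ztrans (?s' j) z)) = sesq (cmat Q) (zvec s z) (zvec s' z)" for z
    by (simp add: sesq_def matrix_vector_mult_def cmat_def zvec_def sum_distrib_left mult_ac)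
  have "(\<lambda>t. \<Sum>i\<in>UNIV. \<Sum>j\<in>UNIV. complex_of_real (Q $ i $ j) * (cnj (?s i t) * ?s' j t)) sums
      (\<Sum>i\<in>UNIV. \<Sum>j\<in>UNIV. complex_of_real (Q $ i $ j) * I i j)"
    unfolding I_def by (intro sums_sum sums_mult summable_sums P(2))
  moreover have "(\<Sum>i\<in>UNIV. \<Sum>j\<in>UNIV. complex_of_real (Q $ i $ j) * (cnj (?s i t) * ?s' j t))
      = complex_of_real (s t \<bullet> (Q *v s' t))" for t
    by (simp add: inner_vec_def matrix_vector_mult_def sum_distrib_left mult_ac)
  ultimately have *: "(\<lambda>t. complex_of_real (s t \<bullet> (Q *v s' t))) sums
      (\<Sum>i\<in>UNIV. \<Sum>j\<in>UNIV. complex_of_real (Q $ i $ j) * I i j)" by simp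
  then have "summable (\<lambda>t. s t \<bullet> (Q *v s' t))" by (simp only: sums_iff summable_complex_of_real)
  from sums_of_real[OF summable_sums[OF this], where 'a=complex]
  have "(\<Sum>i\<in>UNIV. \<Sum>j\<in>UNIV. complex_of_real (Q $ i $ j) * I i j) = complex_of_real (bform Q s s')"
    using sums_unique2[OF *] by (simp add: bform_def)
  moreover have "(\<Sum>i\<in>UNIV. \<Sum>j\<in>UNIV. complex_of_real (Q $ i $ j) * (2 * pi * I i j))
      = 2 * pi * (\<Sum>i\<in>UNIV. \<Sum>j\<in>UNIV. complex_of_real (Q $ i $ j) * I i j)"
    by (simp add: sum_distrib_left mult_ac)
  ultimately have "(\<Sum>i\<in>UNIV. \<Sum>j\<in>UNIV. complex_of_real (Q $ i $ j) * (2 * pi * I i j))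
      = complex_of_real (2 * pi * bform Q s s')"
    by simp
  with 1 show ?thesis by (simp add: 2)
qed

text \<open>The weighted modulus of one component of the transform is dominated by the form, so
  integration gives \<open>E \<le> p / c\<close> for its weighted energy. The factor
  \<open>CARD('m)\<close> passes from components to the norm.\<close>

lemma circle_growth:
  fixes M :: "complex \<Rightarrow> complex^'m^'m" and u :: "nat \<Rightarrow> real^'m"
  assumes u: "summable (\<lambda>t. norm (u t))" and as: "\<And>\<alpha>. \<alpha> \<in> set as \<Longrightarrow> cmod \<alpha> \<le> 1" and c: "0 < c"
    and lower: "\<And>z U. cmod z = 1 \<Longrightarrow> c * (cmod (\<Prod>\<alpha>\<leftarrow>as. z - \<alpha>) * norm U)\<^sup>2 \<le> Re (cquad (M z) U)"
    and int: "((\<lambda>\<theta>. cquad (M (cis \<theta>)) (zvec u (cis \<theta>))) has_integral complex_of_real (2 * pi * p)) {0..2 * pi}"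
  shows "norm (u t) \<le> CARD('m) * sqrt (p / c) * (1 + real t) ^ length as"
proof -
  have comp: "\<bar>u t $ i\<bar> \<le> sqrt (p / c) * (1 + real t) ^ length as" for i
  proof -
    obtain E where E: "((\<lambda>\<theta>. (cmod (\<Prod>\<alpha>\<leftarrow>as. cis \<theta> - \<alpha>) *
        cmod (ztrans (\<lambda>t. complex_of_real (u t $ i)) (cis \<theta>)))\<^sup>2) has_integral 2 * pi * E) {0..2 * pi}"
      "\<forall>t. cmod (complex_of_real (u t $ i)) \<le> sqrt E * (1 + real t) ^ length as"
      using weighted_energy[OF summable_component[OF u, of i] as] .
    have "c * (2 * pi * E) \<le> 2 * pi * p"
    proof (rule has_integral_le[OF has_integral_mult_right[OF E(1)]])
      show "((\<lambda>\<theta>. Re (cquad (M (cis \<theta>)) (zvec u (cis \<theta>)))) has_integral 2 * pi * p) {0..2 * pi}"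
        using has_integral_linear[OF int bounded_linear_Re] by (simp add: o_def)
      fix \<theta> :: real
      have "cmod (ztrans (\<lambda>t. complex_of_real (u t $ i)) (cis \<theta>)) \<le> norm (zvec u (cis \<theta>))"
        using Finite_Cartesian_Product.norm_nth_le[of "zvec u (cis \<theta>)" i] by (simp add: zvec_def)
      then have "c * (cmod (\<Prod>\<alpha>\<leftarrow>as. cis \<theta> - \<alpha>) * cmod (ztrans (\<lambda>t. complex_of_real (u t $ i)) (cis \<theta>)))\<^sup>2
          \<le> c * (cmod (\<Prod>\<alpha>\<leftarrow>as. cis \<theta> - \<alpha>) * norm (zvec u (cis \<theta>)))\<^sup>2"
        using c by (intro mult_left_mono power_mono) auto
      also have "\<dots> \<le> Re (cquad (M (cis \<theta>)) (zvec u (cis \<theta>)))" by (rule lower) simp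
      finally show "c * (cmod (\<Prod>\<alpha>\<leftarrow>as. cis \<theta> - \<alpha>) * cmod (ztrans (\<lambda>t. complex_of_real (u t $ i)) (cis \<theta>)))\<^sup>2
          \<le> Re (cquad (M (cis \<theta>)) (zvec u (cis \<theta>)))" .
    qed
    then have "2 * pi * (c * E) \<le> 2 * pi * p" by (simp add: mult_ac)
    then have "c * E \<le> p" by (rule mult_left_le_imp_le) simp
    then have "E \<le> p / c" using c by (simp add: field_simps)
    then have "sqrt E * (1 + real t) ^ length as \<le> sqrt (p / c) * (1 + real t) ^ length as"
      by (intro mult_right_mono) auto
    from order_trans[OF spec[OF E(2), of t] this] show ?thesis by (simp only: norm_of_real)
  qed
  have "norm (u t) \<le> (\<Sum>i\<in>UNIV. \<bar>u t $ i\<bar>)" by (rule norm_le_l1_cart)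
  also have "\<dots> \<le> (\<Sum>(i::'m)\<in>UNIV. sqrt (p / c) * (1 + real t) ^ length as)" by (intro sum_mono comp)
  finally show ?thesis by (simp add: mult_ac)
qed

text \<open>Finite support gives absolute summability, as Parseval demands, while the truncations
  approximate every element of \<open>l2\<close> in energy.\<close>

definition trunc :: "nat \<Rightarrow> (nat \<Rightarrow> real^'m) \<Rightarrow> nat \<Rightarrow> real^'m" where
  "trunc T u t = (if t < T then u t else 0)"

lemma trunc_summable_norm: "summable (\<lambda>t. norm (trunc T u t))"
  by (rule summable_finite[of "{..<T}"]) (auto simp: trunc_def)

lemma trunc_l2: "trunc T u \<in> l2"
  unfolding l2_def mem_Collect_eq by (rule summable_finite[of "{..<T}"]) (auto simp: trunc_def)

lemma trunc_zero: "trunc T (\<lambda>t. 0) = (\<lambda>t. 0)"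
  by (simp add: trunc_def fun_eq_iff)

lemma energy_trunc_tendsto:
  assumes "u \<in> l2" shows "(\<lambda>T. energy (\<lambda>t. trunc T u t - u t)) \<longlonglongrightarrow> 0"
proof -
  let ?f = "\<lambda>t. (norm (u t))\<^sup>2"
  have "energy (\<lambda>t. trunc T u t - u t) = energy u - (\<Sum>t<T. ?f t)" for T
  proof -
    have "(\<lambda>t. ?f t - (if t \<in> {..<T} then ?f t else 0)) sums (energy u - (\<Sum>t<T. ?f t))"
      unfolding energy_def by (intro sums_diff summable_sums l2D assms sums_If_finite_set) simp
    moreover have "?f t - (if t \<in> {..<T} then ?f t else 0) = (norm (trunc T u t - u t))\<^sup>2" for t
      by (simp add: trunc_def)
    ultimately show ?thesis unfolding energy_def[of "\<lambda>t. trunc T u t - u t"] by (simp add: sums_iff)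
  qed
  moreover have "(\<lambda>T. energy u - (\<Sum>t<T. ?f t)) \<longlonglongrightarrow> energy u - energy u"
    using summable_LIMSEQ[OF l2D[OF assms]] by (intro tendsto_intros) (simp add: energy_def)
  ultimately show ?thesis by simp
qed

section \<open>Blocks of the frequency matrix\<close>

lemma cquad_Pi11: "cquad (Pi11 P) V = sesq P (inp V 0) (inp V 0)"
  by (simp add: cquad_def sesq_def matrix_vector_mult_def sum_UNIV_sum inp_def Pi11_def)

lemma cquad_Pi22: "cquad (Pi22 P) W = sesq P (inp 0 W) (inp 0 W)"
  by (simp add: cquad_def sesq_def matrix_vector_mult_def sum_UNIV_sum inp_def Pi22_def)

lemma cquad_Pi_mod:
  "cquad (Pi_mod \<epsilon> P) (inp V W) = sesq P (inp V 0) (inp V 0)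
    + \<epsilon> * (sesq P (inp V 0) (inp 0 W) + sesq P (inp 0 W) (inp V 0)) - sesq P (inp 0 W) (inp 0 W)"
  by (simp add: cquad_def sesq_def matrix_vector_mult_def sum_UNIV_sum inp_def Pi_mod_def
      sum_distrib_left sum.distrib sum_negf algebra_simps)

lemma psd_Pi11:
  assumes "psd (Pi_mod \<epsilon> P)" shows "psd (Pi11 P)"
proof -
  have "cquad (Pi11 P) V = cquad (Pi_mod \<epsilon> P) (inp V 0)" for V
    unfolding cquad_Pi_mod cquad_Pi11 by (simp add: sesq_def inp_def matrix_vector_mult_def sum_UNIV_sum)
  moreover have "hermitian (Pi11 P)"
    unfolding hermitian_def ctrans_def Pi11_def vec_eq_iff
  proof (intro allI)
    fix i j
    have "ctrans (Pi_mod \<epsilon> P) $ Inl i $ Inl j = Pi_mod \<epsilon> P $ Inl i $ Inl j"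
      using assms by (simp add: psd_def hermitian_def)
    then show "(\<chi> i j. cnj ((\<chi> i j. P $ Inl i $ Inl j) $ j $ i)) $ i $ j = (\<chi> i j. P $ Inl i $ Inl j) $ i $ j"
      by (simp add: ctrans_def Pi_mod_def)
  qed
  ultimately show ?thesis using assms by (simp add: psd_def)
qed

lemma cquad_uminus: "cquad (- M) u = - cquad M u"
  by (simp add: cquad_def matrix_vector_mult_def sum_negf)

lemma psd_neg_Pi22:
  assumes "psd (Pi_mod \<epsilon> P)" shows "psd (- Pi22 P)"
proof -
  have "cquad (- Pi22 P) W = cquad (Pi_mod \<epsilon> P) (inp 0 W)" for W
    unfolding cquad_Pi_mod cquad_Pi22 cquad_uminus
    by (simp add: sesq_def inp_def matrix_vector_mult_def sum_UNIV_sum)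
  moreover have "hermitian (- Pi22 P)"
    unfolding hermitian_def ctrans_def Pi22_def vec_eq_iff
  proof (intro allI)
    fix i j
    have "ctrans (Pi_mod \<epsilon> P) $ Inr i $ Inr j = Pi_mod \<epsilon> P $ Inr i $ Inr j"
      using assms by (simp add: psd_def hermitian_def)
    then show "(\<chi> i j. cnj ((- (\<chi> i j. P $ Inr i $ Inr j)) $ j $ i)) $ i $ j = (- (\<chi> i j. P $ Inr i $ Inr j)) $ i $ j"
      by (simp add: ctrans_def Pi_mod_def)
  qed
  ultimately show ?thesis using assms by (simp add: psd_def)
qed

lemma posdef_uminus: "negdef M \<Longrightarrow> posdef (- M)"
  by (auto simp: negdef_def posdef_def cquad_uminus hermitian_def ctrans_def vec_eq_iff)

context schur_system
begin

text \<open>The transfer matrix from the inputs to the stacked signal. As the outer factor of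
  \<open>Pi_mat\<close> it shows that the latter evaluates \<open>Q\<close> on transforms of
  trajectories started at the origin.\<close>

definition freq :: "complex \<Rightarrow> complex^('k+'q)^('n+'k+'q)" where
  "freq z = (\<chi> r c. case r of Inl i \<Rightarrow> (matrix_inv (mat z - cmat A) ** cmat (hcat B1 B2)) $ i $ c
    | Inr j \<Rightarrow> (if j = c then 1 else 0))"

lemma Pi_mat_eq: "Pi_mat A B1 B2 Q z = ctrans (freq z) ** cmat Q ** freq z"
  by (simp add: Pi_mat_def freq_def Let_def)

lemma invertible_circle: "cmod z = 1 \<Longrightarrow> invertible (mat z - cmat A)"
  using schur by (simp add: schur_def)

lemma circle_rational_Pi: "circle_rational (\<lambda>z. Pi_mat A B1 B2 Q z $ i $ j)"
proof -
  have mat: "circle_rational (\<lambda>z. (mat z - cmat A) $ i $ j)" for i j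
  proof (cases "i = j")
    case True
    have "circle_rational (\<lambda>z. z + - cmat A $ i $ j)"
      by (rule circle_rational_add[OF circle_rational_ident circle_rational_const])
    with True show ?thesis by (simp add: mat_def)
  next
    case False
    then show ?thesis using circle_rational_const[of "- cmat A $ i $ j"] by (simp add: mat_def)
  qed
  have inv: "circle_rational (\<lambda>z. matrix_inv (mat z - cmat A) $ i $ j)" for i j
    by (rule circle_rational_matrix_inv[OF mat invertible_circle])
  have F: "circle_rational (\<lambda>z. freq z $ r $ c)" for r c
  proof (cases r)
    case (Inl i)
    have "circle_rational (\<lambda>z. \<Sum>k\<in>UNIV. matrix_inv (mat z - cmat A) $ i $ k * cmat (hcat B1 B2) $ k $ c)"
      by (intro circle_rational_sum circle_rational_mult inv circle_rational_const)
    with Inl show ?thesis by (simp add: freq_def matrix_matrix_mult_def)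
  next
    case (Inr k)
    then show ?thesis using circle_rational_const[of "if k = c then 1 else 0"] by (simp add: freq_def)
  qed
  have "circle_rational (\<lambda>z. \<Sum>k\<in>UNIV. (\<Sum>l\<in>UNIV. cnj (freq z $ l $ i) * cmat Q $ l $ k) * freq z $ k $ j)"
    by (intro circle_rational_sum circle_rational_mult circle_rational_cnj F circle_rational_const)
  then show ?thesis by (simp add: Pi_mat_eq matrix_matrix_mult_def ctrans_def)
qed

text \<open>Transforming the state equation gives \<open>z X = A X + B U\<close>, and the Schur
  property allows solving for \<open>X\<close>.\<close>

lemma zvec_sig:
  assumes v: "summable (\<lambda>t. norm (v t))" and w: "summable (\<lambda>t. norm (w t))" and z: "cmod z = 1"
  shows "zvec (sig 0 v w) z = freq z *v inp (zvec v z) (zvec w z)"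
proof -
  let ?x = "traj A B1 B2 0 v w" and ?U = "inp (zvec v z) (zvec w z)"
  have x: "summable (\<lambda>t. norm (?x t))"
  proof (rule summable_comparison_test'[OF sig_summable_norm[OF v w, of 0]])
    fix t
    have "(norm (?x t))\<^sup>2 \<le> (norm (sig 0 v w t))\<^sup>2" by (simp add: sig_def norm_stack)
    then have "norm (?x t) \<le> norm (sig 0 v w t)" by (rule power2_le_imp_le) simp
    then show "norm (norm (?x t)) \<le> norm (sig 0 v w t)" by simp
  qed
  have mv: "summable (\<lambda>t. norm (M *v u t))" if "summable (\<lambda>t. norm (u t))" for M :: "real^'b^'c" and u
    by (rule summable_comparison_test'[OF summable_mult[OF that, of "onorm ((*v) M)"]])
      (simp add: onorm[OF matrix_vector_mul_bounded_linear])
  have "z *s zvec ?x z = zvec (\<lambda>t. ?x (Suc t)) z"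
    by (rule zvec_shift[OF x z, symmetric]) simp
  also have "\<dots> = zvec (\<lambda>t. (A *v ?x t + B1 *v v t) + B2 *v w t) z" by simp
  also have "\<dots> = zvec (\<lambda>t. A *v ?x t + B1 *v v t) z + zvec (\<lambda>t. B2 *v w t) z"
    by (rule zvec_add[OF _ mv[OF w] z], rule summable_comparison_test'[OF summable_add[OF mv[OF x, of A] mv[OF v, of B1]]])
      (simp add: norm_triangle_ineq)
  also have "\<dots> = cmat A *v zvec ?x z + cmat B1 *v zvec v z + cmat B2 *v zvec w z"
    by (simp add: zvec_add[OF mv[OF x] mv[OF v] z] zvec_matrix[OF _ z] x v w)
  also have "\<dots> = cmat A *v zvec ?x z + cmat (hcat B1 B2) *v ?U"
    by (simp add: vec_eq_iff matrix_vector_mult_def sum_UNIV_sum cmat_def hcat_def inp_def)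
  finally have eq: "z *s zvec ?x z = cmat A *v zvec ?x z + cmat (hcat B1 B2) *v ?U" .
  have "mat z *v zvec ?x z = z *s zvec ?x z"
    by (simp add: vec_eq_iff matrix_vector_mult_def mat_def if_distrib[of "\<lambda>x. x * _"] cong: if_cong)
  with eq have "(mat z - cmat A) *v zvec ?x z = cmat (hcat B1 B2) *v ?U"
    by (simp add: matrix_vector_mult_diff_rdistrib)
  then have "matrix_inv (mat z - cmat A) *v ((mat z - cmat A) *v zvec ?x z)
      = (matrix_inv (mat z - cmat A) ** cmat (hcat B1 B2)) *v ?U"
    by (simp add: matrix_vector_mul_assoc)
  then have X: "zvec ?x z = (matrix_inv (mat z - cmat A) ** cmat (hcat B1 B2)) *v ?U"
    by (simp add: matrix_vector_mul_assoc matrix_inv_inverse[OF invertible_circle[OF z]])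
  show ?thesis
    unfolding vec_eq_iff
  proof
    fix r
    show "zvec (sig 0 v w) z $ r = (freq z *v ?U) $ r"
    proof (cases r)
      case (Inl i)
      have "zvec (sig 0 v w) z $ r = zvec ?x z $ i" by (simp add: zvec_def sig_def stack_def Inl)
      also have "\<dots> = (freq z *v ?U) $ r"
        unfolding X by (simp add: matrix_vector_mult_def freq_def Inl)
      finally show ?thesis .
    next
      case (Inr j)
      have "zvec (sig 0 v w) z $ r = ?U $ j"
        by (cases j) (simp_all add: zvec_def sig_def stack_def inp_def Inr)
      also have "\<dots> = (freq z *v ?U) $ r"
        by (simp add: matrix_vector_mult_def freq_def Inr if_distrib[of "\<lambda>x. x * _"] cong: if_cong)
      finally show ?thesis .
    qed
  qed
qed

lemma parseval_Pi:
  assumes "summable (\<lambda>t. norm (v t))" "summable (\<lambda>t. norm (w t))"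
    "summable (\<lambda>t. norm (v' t))" "summable (\<lambda>t. norm (w' t))"
  shows "((\<lambda>\<theta>. sesq (Pi_mat A B1 B2 Q (cis \<theta>)) (inp (zvec v (cis \<theta>)) (zvec w (cis \<theta>)))
      (inp (zvec v' (cis \<theta>)) (zvec w' (cis \<theta>)))) has_integral
    complex_of_real (2 * pi * bform Q (sig 0 v w) (sig 0 v' w'))) {0..2 * pi}"
  using parseval_bform[OF sig_summable_norm[OF assms(1,2), of 0] sig_summable_norm[OF assms(3,4), of 0], of Q]
  by (simp add: Pi_mat_eq sesq_ctrans_mult zvec_sig assms)

text \<open>The inputs are truncated, not the signals, so that trajectories remain trajectories. By
  linearity the error is the response to the truncation error, and \<open>sig_energy\<close> makes
  it small.\<close>

lemma bform_sig_trunc: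
  assumes Q: "transpose Q = Q" and l2: "v \<in> l2" "w \<in> l2" "v' \<in> l2" "w' \<in> l2"
  shows "(\<lambda>T. bform Q (sig 0 (trunc T v) (trunc T w)) (sig 0 (trunc T v') (trunc T w')))
    \<longlonglongrightarrow> bform Q (sig 0 v w) (sig 0 v' w')"
proof -
  obtain K where K: "0 \<le> K" "\<forall>a v w. v \<in> l2 \<longrightarrow> w \<in> l2 \<longrightarrow>
      sig a v w \<in> l2 \<and> energy (sig a v w) \<le> K * ((norm a)\<^sup>2 + energy v + energy w)"
    using sig_energy .
  have lim: "(\<lambda>T. energy (\<lambda>t. sig 0 (trunc T v) (trunc T w) t - sig 0 v w t)) \<longlonglongrightarrow> 0"
    if l2: "v \<in> l2" "w \<in> l2" for v w
  proof -
    let ?e = "\<lambda>T. energy (\<lambda>t. trunc T v t - v t) + energy (\<lambda>t. trunc T w t - w t)"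
    have eq: "(\<lambda>t. sig 0 (trunc T v) (trunc T w) t - sig 0 v w t)
        = sig 0 (\<lambda>t. trunc T v t - v t) (\<lambda>t. trunc T w t - w t)" for T
      using sig_add_scaleR[of 0 "-1" 0 "trunc T v" v "trunc T w" w, symmetric] by simp
    have d: "(\<lambda>t. trunc T v t - v t) \<in> l2" "(\<lambda>t. trunc T w t - w t) \<in> l2" for T
      by (intro l2_diff trunc_l2 l2)+
    have "(\<lambda>T. K * ?e T) \<longlonglongrightarrow> K * (0 + 0)"
      by (intro tendsto_intros energy_trunc_tendsto l2)
    then have to0: "(\<lambda>T. K * ?e T) \<longlonglongrightarrow> 0" by simp
    have le: "norm (energy (\<lambda>t. sig 0 (trunc T v) (trunc T w) t - sig 0 v w t)) \<le> K * ?e T" for T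
    proof -
      have "energy (sig 0 (\<lambda>t. trunc T v t - v t) (\<lambda>t. trunc T w t - w t)) \<le> K * ((norm (0 :: real^'n))\<^sup>2 + energy (\<lambda>t. trunc T v t - v t) + energy (\<lambda>t. trunc T w t - w t))"
        using K(2) d[of T] by blast
      moreover have "0 \<le> energy (sig 0 (\<lambda>t. trunc T v t - v t) (\<lambda>t. trunc T w t - w t))"
        by (rule energy_nonneg[OF sig_l2[OF d]])
      ultimately show ?thesis unfolding eq by simp
    qed
    show ?thesis by (rule Lim_null_comparison[OF always_eventually[OF allI[OF le]] to0])
  qed
  show ?thesis
    by (rule bform_tendsto[OF Q sig_l2[OF trunc_l2 trunc_l2] sig_l2[OF l2(1,2)]
          sig_l2[OF trunc_l2 trunc_l2] sig_l2[OF l2(3,4)] lim[OF l2(1,2)] lim[OF l2(3,4)]])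
qed

end

section \<open>The linear-quadratic game\<close>

locale lq_game = schur_system A B1 B2
  for A :: "real^'n^'n" and B1 :: "real^'k^'n" and B2 :: "real^'q^'n" +
  fixes Q :: "real^('n+'k+'q)^('n+'k+'q)" and \<epsilon> :: real and z0 :: complex
  assumes Q: "transpose Q = Q"
    and \<epsilon>: "\<epsilon> > 0" and z0: "cmod z0 = 1"
    and psd: "\<And>z. cmod z = 1 \<Longrightarrow> psd (Pi_mod \<epsilon> (Pi_mat A B1 B2 Q z))"
    and pos: "posdef (Pi11 (Pi_mat A B1 B2 Q z0))"
    and neg: "negdef (Pi22 (Pi_mat A B1 B2 Q z0))"
begin

abbreviation sv :: "(nat \<Rightarrow> real^'k) \<Rightarrow> nat \<Rightarrow> real^('n+'k+'q)" where
  "sv v \<equiv> sig 0 v (\<lambda>t. 0)"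

abbreviation sw :: "(nat \<Rightarrow> real^'q) \<Rightarrow> nat \<Rightarrow> real^('n+'k+'q)" where
  "sw w \<equiv> sig 0 (\<lambda>t. 0) w"

lemma sv_add: "sv (\<lambda>t. v t + c *\<^sub>R h t) = (\<lambda>t. sv v t + c *\<^sub>R sv h t)"
  using sig_add_scaleR[of 0 c 0 v h "\<lambda>t. 0" "\<lambda>t. 0"] by simp

lemma sw_add: "sw (\<lambda>t. w t + c *\<^sub>R h t) = (\<lambda>t. sw w t + c *\<^sub>R sw h t)"
  using sig_add_scaleR[of 0 c 0 "\<lambda>t. 0" "\<lambda>t. 0" w h] by simp

lemma sv_l2: "v \<in> l2 \<Longrightarrow> sv v \<in> l2"
  by (rule sig_l2[OF _ zero_in_l2])

lemma sw_l2: "w \<in> l2 \<Longrightarrow> sw w \<in> l2"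
  by (rule sig_l2[OF zero_in_l2])

text \<open>The frequency condition is evaluated at the transforms of \<open>v\<close> and
  \<open>w\<close> and integrated over the circle; Parseval turns the integral into
  \<open>2 * pi\<close> times this form.\<close>

lemma form_nonneg_summable:
  assumes "summable (\<lambda>t. norm (v t))" "summable (\<lambda>t. norm (w t))"
  shows "0 \<le> bform Q (sv v) (sv v) + 2 * \<epsilon> * bform Q (sv v) (sw w) - bform Q (sw w) (sw w)"
proof -
  let ?P = "\<lambda>\<theta>. Pi_mat A B1 B2 Q (cis \<theta>)"
  let ?V = "\<lambda>\<theta>. inp (zvec v (cis \<theta>)) 0" and ?W = "\<lambda>\<theta>. inp 0 (zvec w (cis \<theta>))"
  define E where "E = bform Q (sv v) (sv v) + \<epsilon> * (bform Q (sv v) (sw w) + bform Q (sw w) (sv v)) - bform Q (sw w) (sw w)"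
  have z: "summable (\<lambda>t. norm ((\<lambda>t. 0) t))" by simp
  have "((\<lambda>\<theta>. sesq (?P \<theta>) (?V \<theta>) (?V \<theta>)
      + \<epsilon> * (sesq (?P \<theta>) (?V \<theta>) (?W \<theta>) + sesq (?P \<theta>) (?W \<theta>) (?V \<theta>))
      - sesq (?P \<theta>) (?W \<theta>) (?W \<theta>)) has_integral
    (complex_of_real (2 * pi * bform Q (sv v) (sv v))
      + \<epsilon> * (complex_of_real (2 * pi * bform Q (sv v) (sw w)) + complex_of_real (2 * pi * bform Q (sw w) (sv v)))
      - complex_of_real (2 * pi * bform Q (sw w) (sw w)))) {0..2 * pi}"
    by (intro has_integral_diff has_integral_add has_integral_mult_right)
      (use parseval_Pi[OF assms(1) z assms(1) z, of Q] parseval_Pi[OF assms(1) z z assms(2), of Q]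
        parseval_Pi[OF z assms(2) assms(1) z, of Q] parseval_Pi[OF z assms(2) z assms(2), of Q]
        in \<open>simp_all only: zvec_zero\<close>)
  then have "((\<lambda>\<theta>. cquad (Pi_mod \<epsilon> (?P \<theta>)) (inp (zvec v (cis \<theta>)) (zvec w (cis \<theta>)))) has_integral
      complex_of_real (2 * pi * E)) {0..2 * pi}"
    unfolding cquad_Pi_mod E_def by (simp add: algebra_simps)
  from has_integral_linear[OF this bounded_linear_Re]
  have "((\<lambda>\<theta>. Re (cquad (Pi_mod \<epsilon> (?P \<theta>)) (inp (zvec v (cis \<theta>)) (zvec w (cis \<theta>))))) has_integral
      2 * pi * E) {0..2 * pi}" by (simp add: o_def)
  then have "0 \<le> 2 * pi * E"
    by (rule has_integral_nonneg) (use psd in \<open>simp add: psd_def\<close>)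
  then have "(2 * pi) * 0 \<le> (2 * pi) * E" by simp
  then have "0 \<le> E" by (rule mult_left_le_imp_le) simp
  then show ?thesis unfolding E_def bform_sym[OF Q, of "sw w" "sv v"] by (simp add: algebra_simps)
qed

lemma form_nonneg:
  assumes "v \<in> l2" "w \<in> l2"
  shows "0 \<le> bform Q (sv v) (sv v) + 2 * \<epsilon> * bform Q (sv v) (sw w) - bform Q (sw w) (sw w)"
proof (rule LIMSEQ_le_const)
  note lim = bform_sig_trunc[OF Q]
  show "(\<lambda>T. bform Q (sv (trunc T v)) (sv (trunc T v)) + 2 * \<epsilon> * bform Q (sv (trunc T v)) (sw (trunc T w))
      - bform Q (sw (trunc T w)) (sw (trunc T w))) \<longlonglongrightarrow>
    bform Q (sv v) (sv v) + 2 * \<epsilon> * bform Q (sv v) (sw w) - bform Q (sw w) (sw w)"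
    using lim[OF assms(1) zero_in_l2 assms(1) zero_in_l2] lim[OF assms(1) zero_in_l2 zero_in_l2 assms(2)]
      lim[OF zero_in_l2 assms(2) zero_in_l2 assms(2)]
    by (simp only: trunc_zero) (intro tendsto_intros)
  show "\<exists>N. \<forall>T\<ge>N. 0 \<le> bform Q (sv (trunc T v)) (sv (trunc T v))
      + 2 * \<epsilon> * bform Q (sv (trunc T v)) (sw (trunc T w)) - bform Q (sw (trunc T w)) (sw (trunc T w))"
    using form_nonneg_summable[OF trunc_summable_norm trunc_summable_norm] by blast
qed

text \<open>This also settles \<open>sw\<close> at zero, which abbreviates the same signal.\<close>

lemma sv_zero: "bform Q (sv (\<lambda>t. 0)) s = 0"
proof -
  have "traj A B1 B2 0 (\<lambda>t. 0) (\<lambda>t. 0) t = 0" for t by (induction t) auto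
  then show ?thesis by (simp add: bform_def sig_def stack_def inner_vec_def sum_UNIV_sum)
qed

lemma sv_zero_right: "bform Q s (sv (\<lambda>t. 0)) = 0"
  by (subst bform_sym[OF Q]) (rule sv_zero)

lemma p_nonneg: "v \<in> l2 \<Longrightarrow> 0 \<le> bform Q (sv v) (sv v)"
  using form_nonneg[OF _ zero_in_l2, of v] by (simp add: sv_zero sv_zero_right)

lemma r_nonneg: "w \<in> l2 \<Longrightarrow> 0 \<le> - bform Q (sw w) (sw w)"
  using form_nonneg[OF zero_in_l2, of w] by (simp add: sv_zero)

text \<open>Replacing \<open>w\<close> by \<open>s w\<close> in \<open>form_nonneg\<close> yields a
  nonnegative quadratic in \<open>s\<close>. Its middle coefficient carries \<epsilon>, and the
  discriminant bound produces the factor \<open>1 / \<epsilon>\<^sup>2\<close>.\<close>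

lemma cross_bound:
  assumes "v \<in> l2" "w \<in> l2"
  shows "(bform Q (sv v) (sw w))\<^sup>2 \<le> 1 / \<epsilon>\<^sup>2 * bform Q (sv v) (sv v) * - bform Q (sw w) (sw w)"
proof -
  have "(\<epsilon> * bform Q (sv v) (sw w))\<^sup>2 \<le> bform Q (sv v) (sv v) * - bform Q (sw w) (sw w)"
  proof (rule discriminant_le)
    fix s
    have sw: "(\<lambda>t. s *\<^sub>R w t) \<in> l2" using l2_add_scaleR[OF zero_in_l2 assms(2), of s] by simp
    have eq: "sw (\<lambda>t. s *\<^sub>R w t) = (\<lambda>t. sw (\<lambda>t. 0) t + s *\<^sub>R sw w t)"
      using sw_add[of "\<lambda>t. 0" s w] by simp
    have r: "bform Q x (sw (\<lambda>t. s *\<^sub>R w t)) = s * bform Q x (sw w)" if "x \<in> l2" for x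
      unfolding eq bform_add_right[OF Q sw_l2[OF zero_in_l2] sw_l2[OF assms(2)] that]
      by (simp add: sv_zero_right)
    have "bform Q (sw (\<lambda>t. s *\<^sub>R w t)) (sw (\<lambda>t. s *\<^sub>R w t)) = s * (s * bform Q (sw w) (sw w))"
      using r[OF sw_l2[OF sw]] bform_sym[OF Q, of "sw (\<lambda>t. s *\<^sub>R w t)" "sw w"] r[OF sw_l2[OF assms(2)]] by simp
    then show "0 \<le> bform Q (sv v) (sv v) + 2 * s * (\<epsilon> * bform Q (sv v) (sw w)) + s\<^sup>2 * - bform Q (sw w) (sw w)"
      using form_nonneg[OF assms(1) sw] r[OF sv_l2[OF assms(1)]] by (simp add: power2_eq_square mult_ac)
  qed (rule r_nonneg[OF assms(2)])
  then show ?thesis using \<epsilon> by (simp add: power_mult_distrib field_simps)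
qed

section \<open>Pointwise growth controlled by the two forms\<close>

lemma v_growth_summable:
  obtains L m where "0 \<le> L" "\<forall>v t. summable (\<lambda>t. norm (v t)) \<longrightarrow>
    norm (v t) \<le> L * sqrt (bform Q (sv v) (sv v)) * (1 + real t) ^ m"
proof -
  have "\<exists>c as. 0 < c \<and> (\<forall>a\<in>set as. cmod a \<le> 1) \<and> (\<forall>z u. cmod z = 1 \<longrightarrow>
      c * (cmod (\<Prod>a\<leftarrow>as. z - a) * norm u)\<^sup>2 \<le> Re (cquad (Pi11 (Pi_mat A B1 B2 Q z)) u))"
  proof (rule circle_psd_lower[of "\<lambda>z. Pi11 (Pi_mat A B1 B2 Q z)", OF _ psd_Pi11[OF psd] z0 pos])
    show "circle_rational (\<lambda>z. Pi11 (Pi_mat A B1 B2 Q z) $ i $ j)" for i j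
      using circle_rational_Pi[of Q "Inl i" "Inl j"] by (simp add: Pi11_def)
  qed blast+
  then obtain c as where c: "0 < c" "\<And>a. a \<in> set as \<Longrightarrow> cmod a \<le> 1"
    "\<And>z u. cmod z = 1 \<Longrightarrow>
      c * (cmod (\<Prod>a\<leftarrow>as. z - a) * norm u)\<^sup>2 \<le> Re (cquad (Pi11 (Pi_mat A B1 B2 Q z)) u)" by blast
  have z: "summable (\<lambda>t. norm ((\<lambda>t. 0) t))" by simp
  have "norm (v t) \<le> CARD('k) / sqrt c * sqrt (bform Q (sv v) (sv v)) * (1 + real t) ^ length as"
    if v: "summable (\<lambda>t. norm (v t))" for v t
  proof -
    have "((\<lambda>\<theta>. cquad (Pi11 (Pi_mat A B1 B2 Q (cis \<theta>))) (zvec v (cis \<theta>))) has_integral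
        complex_of_real (2 * pi * bform Q (sv v) (sv v))) {0..2 * pi}"
      using parseval_Pi[OF v z v z, of Q] by (simp only: cquad_Pi11 zvec_zero)
    from circle_growth[OF v c(2) c(1) c(3) this, of t] show ?thesis by (simp add: real_sqrt_divide)
  qed
  then show thesis using c(1) by (intro that[of "CARD('k) / sqrt c" "length as"]) auto
qed

lemma w_growth_summable:
  obtains L m where "0 \<le> L" "\<forall>w t. summable (\<lambda>t. norm (w t)) \<longrightarrow>
    norm (w t) \<le> L * sqrt (- bform Q (sw w) (sw w)) * (1 + real t) ^ m"
proof -
  have "\<exists>c as. 0 < c \<and> (\<forall>a\<in>set as. cmod a \<le> 1) \<and> (\<forall>z u. cmod z = 1 \<longrightarrow>
      c * (cmod (\<Prod>a\<leftarrow>as. z - a) * norm u)\<^sup>2 \<le> Re (cquad (- Pi22 (Pi_mat A B1 B2 Q z)) u))"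
  proof (rule circle_psd_lower[of "\<lambda>z. - Pi22 (Pi_mat A B1 B2 Q z)", OF _ psd_neg_Pi22[OF psd] z0 posdef_uminus[OF neg]])
    show "circle_rational (\<lambda>z. (- Pi22 (Pi_mat A B1 B2 Q z)) $ i $ j)" for i j
      using circle_rational_minus[OF circle_rational_Pi[of Q "Inr i" "Inr j"]] by (simp add: Pi22_def)
  qed blast+
  then obtain c as where c: "0 < c" "\<And>a. a \<in> set as \<Longrightarrow> cmod a \<le> 1"
    "\<And>z u. cmod z = 1 \<Longrightarrow>
      c * (cmod (\<Prod>a\<leftarrow>as. z - a) * norm u)\<^sup>2 \<le> Re (cquad (- Pi22 (Pi_mat A B1 B2 Q z)) u)" by blast
  have z: "summable (\<lambda>t. norm ((\<lambda>t. 0) t))" by simp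
  have "norm (w t) \<le> CARD('q) / sqrt c * sqrt (- bform Q (sw w) (sw w)) * (1 + real t) ^ length as"
    if w: "summable (\<lambda>t. norm (w t))" for w t
  proof -
    have "((\<lambda>\<theta>. cquad (- Pi22 (Pi_mat A B1 B2 Q (cis \<theta>))) (zvec w (cis \<theta>))) has_integral
        - complex_of_real (2 * pi * bform Q (sw w) (sw w))) {0..2 * pi}"
      unfolding cquad_uminus cquad_Pi22
      using has_integral_neg[OF parseval_Pi[OF z w z w, of Q]] by (simp only: zvec_zero)
    then have "((\<lambda>\<theta>. cquad (- Pi22 (Pi_mat A B1 B2 Q (cis \<theta>))) (zvec w (cis \<theta>))) has_integral
        complex_of_real (2 * pi * - bform Q (sw w) (sw w))) {0..2 * pi}" by simp
    from circle_growth[OF w c(2) c(1) c(3) this, of t] show ?thesis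
      by (simp only: real_sqrt_divide) (simp add: field_simps)
  qed
  then show thesis using c(1) by (intro that[of "CARD('q) / sqrt c" "length as"]) auto
qed

text \<open>For fixed \<open>t\<close>, truncation at any \<open>T > t\<close> leaves
  \<open>u t\<close> unchanged, so only the right-hand side moves in the limit.\<close>

lemma growth_limit:
  assumes "\<And>T. norm (trunc T u t) \<le> L * sqrt (f T) * R" "f \<longlonglongrightarrow> F"
  shows "norm (u t) \<le> L * sqrt F * R"
proof (rule LIMSEQ_le_const)
  show "(\<lambda>T. L * sqrt (f T) * R) \<longlonglongrightarrow> L * sqrt F * R" by (intro tendsto_intros assms(2))
  have "norm (u t) \<le> L * sqrt (f T) * R" if "Suc t \<le> T" for T
    using assms(1)[of T] that by (simp add: trunc_def)
  then show "\<exists>N. \<forall>T\<ge>N. norm (u t) \<le> L * sqrt (f T) * R" by blast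
qed

lemma v_growth:
  obtains L m where "0 \<le> L" "\<forall>v t. v \<in> l2 \<longrightarrow>
    norm (v t) \<le> L * sqrt (bform Q (sv v) (sv v)) * (1 + real t) ^ m"
proof -
  obtain L m where L: "0 \<le> L" "\<forall>v t. summable (\<lambda>t. norm (v t)) \<longrightarrow>
    norm (v t) \<le> L * sqrt (bform Q (sv v) (sv v)) * (1 + real t) ^ m" using v_growth_summable .
  have "norm (v t) \<le> L * sqrt (bform Q (sv v) (sv v)) * (1 + real t) ^ m" if v: "v \<in> l2" for v t
  proof (rule growth_limit)
    show "norm (trunc T v t) \<le> L * sqrt (bform Q (sv (trunc T v)) (sv (trunc T v))) * (1 + real t) ^ m" for T
      using L(2)[rule_format, OF trunc_summable_norm] .
    show "(\<lambda>T. bform Q (sv (trunc T v)) (sv (trunc T v))) \<longlonglongrightarrow> bform Q (sv v) (sv v)"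
      using bform_sig_trunc[OF Q v zero_in_l2 v zero_in_l2] by (simp only: trunc_zero)
  qed
  then show thesis using L(1) by (intro that) auto
qed

lemma w_growth:
  obtains L m where "0 \<le> L" "\<forall>w t. w \<in> l2 \<longrightarrow>
    norm (w t) \<le> L * sqrt (- bform Q (sw w) (sw w)) * (1 + real t) ^ m"
proof -
  obtain L m where L: "0 \<le> L" "\<forall>w t. summable (\<lambda>t. norm (w t)) \<longrightarrow>
    norm (w t) \<le> L * sqrt (- bform Q (sw w) (sw w)) * (1 + real t) ^ m" using w_growth_summable .
  have "norm (w t) \<le> L * sqrt (- bform Q (sw w) (sw w)) * (1 + real t) ^ m" if w: "w \<in> l2" for w t
  proof (rule growth_limit)
    show "norm (trunc T w t) \<le> L * sqrt (- bform Q (sw (trunc T w)) (sw (trunc T w))) * (1 + real t) ^ m" for T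
      using L(2)[rule_format, OF trunc_summable_norm] .
    show "(\<lambda>T. - bform Q (sw (trunc T w)) (sw (trunc T w))) \<longlonglongrightarrow> - bform Q (sw w) (sw w)"
      using tendsto_minus[OF bform_sig_trunc[OF Q zero_in_l2 w zero_in_l2 w]] by (simp only: trunc_zero)
  qed
  then show thesis using L(1) by (intro that) auto
qed

text \<open>The pairing bound is linear in the growth constant, and \<open>v_growth\<close> permits
  \<open>L * sqrt (bform Q (sv v) (sv v))\<close> for it, which is a multiple of the
  seminorm.\<close>

lemma l_bound:
  obtains K where "0 \<le> K" "\<forall>v\<in>l2. (bform Q (sig a (\<lambda>t. 0) (\<lambda>t. 0)) (sv v))\<^sup>2 \<le> K * bform Q (sv v) (sv v)"
proof -
  obtain L m where L: "0 \<le> L" "\<forall>v t. v \<in> l2 \<longrightarrow>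
    norm (v t) \<le> L * sqrt (bform Q (sv v) (sv v)) * (1 + real t) ^ m" using v_growth .
  obtain K where K: "0 \<le> K" "\<forall>v w M. v \<in> l2 \<longrightarrow> w \<in> l2 \<longrightarrow>
      (\<forall>t. norm (v t) + norm (w t) \<le> M * (1 + real t) ^ m) \<longrightarrow>
      \<bar>bform Q (sig a (\<lambda>t. 0) (\<lambda>t. 0)) (sig 0 v w)\<bar> \<le> K * M"
    using free_response_pairing .
  have "(bform Q (sig a (\<lambda>t. 0) (\<lambda>t. 0)) (sv v))\<^sup>2 \<le> (K * L)\<^sup>2 * bform Q (sv v) (sv v)" if v: "v \<in> l2" for v
  proof -
    have "\<bar>bform Q (sig a (\<lambda>t. 0) (\<lambda>t. 0)) (sv v)\<bar> \<le> K * (L * sqrt (bform Q (sv v) (sv v)))"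
      by (rule K(2)[rule_format, OF v zero_in_l2]) (use L(2) v in simp)
    then have "\<bar>bform Q (sig a (\<lambda>t. 0) (\<lambda>t. 0)) (sv v)\<bar>\<^sup>2 \<le> (K * (L * sqrt (bform Q (sv v) (sv v))))\<^sup>2"
      by (rule power_mono) simp
    then show ?thesis using p_nonneg[OF v] by (simp add: power_mult_distrib)
  qed
  then show thesis by (intro that[of "(K * L)\<^sup>2"]) auto
qed

lemma m_bound:
  obtains K where "0 \<le> K" "\<forall>w\<in>l2. (bform Q (sig a (\<lambda>t. 0) (\<lambda>t. 0)) (sw w))\<^sup>2 \<le> K * - bform Q (sw w) (sw w)"
proof -
  obtain L m where L: "0 \<le> L" "\<forall>w t. w \<in> l2 \<longrightarrow>
    norm (w t) \<le> L * sqrt (- bform Q (sw w) (sw w)) * (1 + real t) ^ m" using w_growth .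
  obtain K where K: "0 \<le> K" "\<forall>v w M. v \<in> l2 \<longrightarrow> w \<in> l2 \<longrightarrow>
      (\<forall>t. norm (v t) + norm (w t) \<le> M * (1 + real t) ^ m) \<longrightarrow>
      \<bar>bform Q (sig a (\<lambda>t. 0) (\<lambda>t. 0)) (sig 0 v w)\<bar> \<le> K * M"
    using free_response_pairing .
  have "(bform Q (sig a (\<lambda>t. 0) (\<lambda>t. 0)) (sw w))\<^sup>2 \<le> (K * L)\<^sup>2 * - bform Q (sw w) (sw w)" if w: "w \<in> l2" for w
  proof -
    have "\<bar>bform Q (sig a (\<lambda>t. 0) (\<lambda>t. 0)) (sw w)\<bar> \<le> K * (L * sqrt (- bform Q (sw w) (sw w)))"
      by (rule K(2)[rule_format, OF zero_in_l2 w]) (use L(2) w in simp)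
    then have "\<bar>bform Q (sig a (\<lambda>t. 0) (\<lambda>t. 0)) (sw w)\<bar>\<^sup>2 \<le> (K * (L * sqrt (- bform Q (sw w) (sw w))))\<^sup>2"
      by (rule power_mono) simp
    moreover have "(sqrt (- bform Q (sw w) (sw w)))\<^sup>2 = - bform Q (sw w) (sw w)"
      by (rule real_sqrt_pow2[OF r_nonneg[OF w]])
    ultimately show ?thesis unfolding power2_abs power_mult_distrib by (simp only: mult.assoc)
  qed
  then show thesis by (intro that[of "(K * L)\<^sup>2"]) auto
qed

lemma quad_game_exists:
  "\<exists>K. quad_game l2 l2 (\<lambda>v. bform Q (sv v) (sv v)) (\<lambda>v. bform Q (sig a (\<lambda>t. 0) (\<lambda>t. 0)) (sv v))
    (\<lambda>v h. bform Q (sv v) (sv h)) (\<lambda>w. - bform Q (sw w) (sw w))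
    (\<lambda>w. bform Q (sig a (\<lambda>t. 0) (\<lambda>t. 0)) (sw w)) (\<lambda>w h. - bform Q (sw w) (sw h))
    (\<lambda>v w. bform Q (sv v) (sw w)) (1 / \<epsilon>\<^sup>2) K"
proof -
  let ?f = "sig a (\<lambda>t. 0) (\<lambda>t. 0)"
  have f: "?f \<in> l2" by (rule sig_l2[OF zero_in_l2 zero_in_l2])
  obtain K1 where K1: "0 \<le> K1" "\<forall>v\<in>l2. (bform Q ?f (sv v))\<^sup>2 \<le> K1 * bform Q (sv v) (sv v)" using l_bound .
  obtain K2 where K2: "0 \<le> K2" "\<forall>w\<in>l2. (bform Q ?f (sw w))\<^sup>2 \<le> K2 * - bform Q (sw w) (sw w)" using m_bound .
  note [simp] = bform_add_left bform_add_right[OF Q] sv_l2 sw_l2 l2_add_scaleR f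
  have square: "bform Q (\<lambda>t. s t + c *\<^sub>R h t) (\<lambda>t. s t + c *\<^sub>R h t) = bform Q s s + 2 * c * bform Q s h + c\<^sup>2 * bform Q h h"
    if "s \<in> l2" "h \<in> l2" for s h c
    using that by (simp add: bform_sym[OF Q, of h s] power2_eq_square algebra_simps)
  \<comment> \<open>One constant has to serve both linear terms; the sum does so because both forms
    are nonnegative.\<close>
  have "quad_game l2 l2 (\<lambda>v. bform Q (sv v) (sv v)) (\<lambda>v. bform Q ?f (sv v))
    (\<lambda>v h. bform Q (sv v) (sv h)) (\<lambda>w. - bform Q (sw w) (sw w))
    (\<lambda>w. bform Q ?f (sw w)) (\<lambda>w h. - bform Q (sw w) (sw h))
    (\<lambda>v w. bform Q (sv v) (sw w)) (1 / \<epsilon>\<^sup>2) (K1 + K2)"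
  proof
    show "(bform Q ?f (sv v))\<^sup>2 \<le> (K1 + K2) * bform Q (sv v) (sv v)" if "v \<in> l2" for v
      using K1(2) K2(1) that mult_nonneg_nonneg[OF K2(1) p_nonneg[OF that]] by (fastforce simp: distrib_right)
    show "(bform Q ?f (sw w))\<^sup>2 \<le> (K1 + K2) * - bform Q (sw w) (sw w)" if "w \<in> l2" for w
      using K2(2)[rule_format, OF that] mult_nonneg_nonneg[OF K1(1) r_nonneg[OF that]]
      unfolding distrib_right by linarith
    show "- bform Q (sw (\<lambda>t. v t + s *\<^sub>R h t)) (sw (\<lambda>t. v t + s *\<^sub>R h t))
      = - bform Q (sw v) (sw v) + 2 * s * - bform Q (sw v) (sw h) + s\<^sup>2 * - bform Q (sw h) (sw h)"
      if "v \<in> l2" "h \<in> l2" for v h s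
      unfolding sw_add square[OF sw_l2[OF that(1)] sw_l2[OF that(2)]] by simp
    show "bform Q (sv (\<lambda>t. v t + s *\<^sub>R h t)) (sv (\<lambda>t. v t + s *\<^sub>R h t))
      = bform Q (sv v) (sv v) + 2 * s * bform Q (sv v) (sv h) + s\<^sup>2 * bform Q (sv h) (sv h)"
      if "v \<in> l2" "h \<in> l2" for v h s
      unfolding sv_add by (rule square[OF sv_l2[OF that(1)] sv_l2[OF that(2)]])
    show "(bform Q (sv v) (sw w))\<^sup>2 \<le> 1 / \<epsilon>\<^sup>2 * bform Q (sv v) (sv v) * - bform Q (sw w) (sw w)"
      if "v \<in> l2" "w \<in> l2" for v w by (rule cross_bound[OF that])
  qed (use K1(1) K2(1) in \<open>auto simp: zero_in_l2 sv_add sw_add intro: p_nonneg r_nonneg[simplified]\<close>)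
  then show ?thesis by blast
qed

end

lemma scaled_square_less:
  fixes M \<eta> x :: real
  assumes "0 < M" "0 < \<eta>" "0 \<le> x" "x < sqrt (\<eta> / M)"
  shows "M * x\<^sup>2 < \<eta>"
proof -
  have "x\<^sup>2 < (sqrt (\<eta> / M))\<^sup>2" using assms(3,4) by (intro power_strict_mono) auto
  then show ?thesis using assms(1,2) by (simp add: field_simps)
qed

section \<open>The cost as an instance of the abstract game\<close>

context lq_game
begin

lemma gfun_eq_bform: "gfun A B1 B2 Q a v w = bform Q (sig a v w) (sig a v w)"
  by (simp add: gfun_def bform_def sigma_def sig_def)

text \<open>Superposition: the signal is the free response plus the two forced responses, and
  symmetry of \<open>Q\<close> merges the mixed terms in pairs.\<close>

lemma gfun_expand:
  fixes a :: "real^'n"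
  assumes "v \<in> l2" "w \<in> l2"
  defines "f \<equiv> sig a (\<lambda>t. 0) (\<lambda>t. 0)"
  shows "gfun A B1 B2 Q a v w = bform Q (sv v) (sv v) + 2 * bform Q (sv v) (sw w)
    - (- bform Q (sw w) (sw w)) + 2 * bform Q f (sv v) + 2 * bform Q f (sw w) + bform Q f f"
proof -
  have f: "f \<in> l2" unfolding f_def by (rule sig_l2[OF zero_in_l2 zero_in_l2])
  note v = sv_l2[OF assms(1)] and w = sw_l2[OF assms(2)]
  let ?u = "\<lambda>t. sv v t + 1 *\<^sub>R sw w t"
  have u: "?u \<in> l2" by (rule l2_add_scaleR[OF v w])
  have "sig a v w = (\<lambda>t. f t + 1 *\<^sub>R ?u t)"
    using sig_add_scaleR[of a 1 0 "\<lambda>t. 0" v "\<lambda>t. 0" w] sig_add_scaleR[of 0 1 0 v "\<lambda>t. 0" "\<lambda>t. 0" w]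
    by (simp add: f_def)
  then have "gfun A B1 B2 Q a v w = bform Q (\<lambda>t. f t + 1 *\<^sub>R ?u t) (\<lambda>t. f t + 1 *\<^sub>R ?u t)"
    unfolding gfun_eq_bform by simp
  also have "\<dots> = bform Q f f + 2 * bform Q f ?u + bform Q ?u ?u"
    using bform_sym[OF Q, of ?u f]
    by (simp only: bform_add_left[OF f u l2_add_scaleR[OF f u]] bform_add_right[OF Q f u f] bform_add_right[OF Q f u u]
        mult_1 mult_2 add.assoc)
  also have "bform Q f ?u = bform Q f (sv v) + bform Q f (sw w)"
    by (simp only: bform_add_right[OF Q v w f] mult_1)
  also have "bform Q ?u ?u = bform Q (sv v) (sv v) + 2 * bform Q (sv v) (sw w) + bform Q (sw w) (sw w)"
    using bform_sym[OF Q, of "sw w" "sv v"]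
    by (simp only: bform_add_left[OF v w u] bform_add_right[OF Q v w v] bform_add_right[OF Q v w w]
        mult_1 mult_2 add.assoc)
  finally show ?thesis by simp
qed

text \<open>Sequences close in norm are close in the seminorms, so the seminorm continuity of the
  envelopes implies norm continuity.\<close>

lemma form_le_l2dist:
  obtains M where "0 < M"
    "\<forall>v\<in>l2. \<forall>v'\<in>l2. bform Q (sv (\<lambda>t. v' t - v t)) (sv (\<lambda>t. v' t - v t)) \<le> M * (l2dist v' v)\<^sup>2"
    "\<forall>w\<in>l2. \<forall>w'\<in>l2. - bform Q (sw (\<lambda>t. w' t - w t)) (sw (\<lambda>t. w' t - w t)) \<le> M * (l2dist w' w)\<^sup>2"
proof -
  obtain K where K: "0 \<le> K" "\<forall>a v w. v \<in> l2 \<longrightarrow> w \<in> l2 \<longrightarrow>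
      sig a v w \<in> l2 \<and> energy (sig a v w) \<le> K * ((norm a)\<^sup>2 + energy v + energy w)"
    using sig_energy .
  define N where "N = onorm ((*v) Q)"
  have N: "0 \<le> N" unfolding N_def by (intro onorm_pos_le matrix_vector_mul_bounded_linear)
  have zero: "energy (\<lambda>t. 0) = 0" by (simp add: energy_def)
  \<comment> \<open>The added 1 makes the constant strictly positive, so that it can serve as a
    divisor in the choice of radius.\<close>
  have le: "\<bar>bform Q (sig 0 v w) (sig 0 v w)\<bar> \<le> (N * K + 1) * (energy v + energy w)"
    if "v \<in> l2" "w \<in> l2" for v w
  proof -
    have s: "sig 0 v w \<in> l2" by (rule sig_l2[OF that])
    have "\<bar>bform Q (sig 0 v w) (sig 0 v w)\<bar> \<le> N * energy (sig 0 v w)"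
      using bform_le[OF s s, of Q] energy_nonneg[OF s] by (simp add: N_def)
    also have "\<dots> \<le> N * (K * ((norm (0 :: real^'n))\<^sup>2 + energy v + energy w))"
      using K(2) that N by (intro mult_left_mono) blast+
    also have "\<dots> \<le> (N * K + 1) * (energy v + energy w)"
      using energy_nonneg[OF that(1)] energy_nonneg[OF that(2)] by (simp add: algebra_simps)
    finally show ?thesis .
  qed
  show thesis
  proof (rule that[of "N * K + 1"])
    show "0 < N * K + 1" using N K(1) by (simp add: add_nonneg_pos)
    show "\<forall>v\<in>l2. \<forall>v'\<in>l2. bform Q (sv (\<lambda>t. v' t - v t)) (sv (\<lambda>t. v' t - v t)) \<le> (N * K + 1) * (l2dist v' v)\<^sup>2"
    proof (intro ballI)
      fix v v' :: "nat \<Rightarrow> real^'k" assume "v \<in> l2" "v' \<in> l2"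
      then have d: "(\<lambda>t. v' t - v t) \<in> l2" by (intro l2_diff)
      show "bform Q (sv (\<lambda>t. v' t - v t)) (sv (\<lambda>t. v' t - v t)) \<le> (N * K + 1) * (l2dist v' v)\<^sup>2"
        using le[OF d zero_in_l2] energy_nonneg[OF d] by (simp add: l2dist_eq_energy zero)
    qed
    show "\<forall>w\<in>l2. \<forall>w'\<in>l2. - bform Q (sw (\<lambda>t. w' t - w t)) (sw (\<lambda>t. w' t - w t)) \<le> (N * K + 1) * (l2dist w' w)\<^sup>2"
    proof (intro ballI)
      fix w w' :: "nat \<Rightarrow> real^'q" assume "w \<in> l2" "w' \<in> l2"
      then have d: "(\<lambda>t. w' t - w t) \<in> l2" by (intro l2_diff)
      show "- bform Q (sw (\<lambda>t. w' t - w t)) (sw (\<lambda>t. w' t - w t)) \<le> (N * K + 1) * (l2dist w' w)\<^sup>2"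
        using le[OF zero_in_l2 d] energy_nonneg[OF d] by (simp add: l2dist_eq_energy zero)
    qed
  qed
qed

lemma saddle_value:
  "(\<forall>w \<in> l2. \<bar>INF v\<in>l2. ereal (gfun A B1 B2 Q a v w)\<bar> \<noteq> \<infinity>)
   \<and> (\<forall>w \<in> l2. \<forall>e>0. \<exists>d>0. \<forall>w' \<in> l2. l2dist w' w < d \<longrightarrow>
        \<bar>real_of_ereal (INF v\<in>l2. ereal (gfun A B1 B2 Q a v w'))
          - real_of_ereal (INF v\<in>l2. ereal (gfun A B1 B2 Q a v w))\<bar> < e)
   \<and> (\<forall>v \<in> l2. \<bar>SUP w\<in>l2. ereal (gfun A B1 B2 Q a v w)\<bar> \<noteq> \<infinity>)
   \<and> (\<forall>v \<in> l2. \<forall>e>0. \<exists>d>0. \<forall>v' \<in> l2. l2dist v' v < d \<longrightarrow>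
        \<bar>real_of_ereal (SUP w\<in>l2. ereal (gfun A B1 B2 Q a v' w))
          - real_of_ereal (SUP w\<in>l2. ereal (gfun A B1 B2 Q a v w))\<bar> < e)
   \<and> (INF v\<in>l2. SUP w\<in>l2. ereal (gfun A B1 B2 Q a v w))
       = (SUP w\<in>l2. INF v\<in>l2. ereal (gfun A B1 B2 Q a v w))"
proof -
  let ?f = "sig a (\<lambda>t. 0) (\<lambda>t. 0)"
  obtain K where K: "quad_game l2 l2 (\<lambda>v. bform Q (sv v) (sv v)) (\<lambda>v. bform Q ?f (sv v))
    (\<lambda>v h. bform Q (sv v) (sv h)) (\<lambda>w. - bform Q (sw w) (sw w))
    (\<lambda>w. bform Q ?f (sw w)) (\<lambda>w h. - bform Q (sw w) (sw h))
    (\<lambda>v w. bform Q (sv v) (sw w)) (1 / \<epsilon>\<^sup>2) K"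
    using quad_game_exists by blast
  \<comment> \<open>The additive constant of the game is the cost of the free response
    alone.\<close>
  interpret G: quad_game l2 l2 "\<lambda>v. bform Q (sv v) (sv v)" "\<lambda>v. bform Q ?f (sv v)"
    "\<lambda>v h. bform Q (sv v) (sv h)" "\<lambda>w. - bform Q (sw w) (sw w)"
    "\<lambda>w. bform Q ?f (sw w)" "\<lambda>w h. - bform Q (sw w) (sw h)"
    "\<lambda>v w. bform Q (sv v) (sw w)" "bform Q ?f ?f" "1 / \<epsilon>\<^sup>2" K
    by (rule K)
  have g: "gfun A B1 B2 Q a v w = G.g v w" if "v \<in> l2" "w \<in> l2" for v w
    unfolding G.g_def by (rule gfun_expand[OF that])
  have inf: "(INF v\<in>l2. ereal (gfun A B1 B2 Q a v w)) = ereal (G.inf_val w)" if "w \<in> l2" for w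
    using G.INF_ereal[OF that] by (simp add: g that cong: INF_cong_simp)
  have sup: "(SUP w\<in>l2. ereal (gfun A B1 B2 Q a v w)) = ereal (G.sup_val v)" if "v \<in> l2" for v
    using G.SUP_ereal[OF that] by (simp add: g that cong: SUP_cong_simp)
  obtain M where M: "0 < M"
    "\<forall>v\<in>l2. \<forall>v'\<in>l2. bform Q (sv (\<lambda>t. v' t - v t)) (sv (\<lambda>t. v' t - v t)) \<le> M * (l2dist v' v)\<^sup>2"
    "\<forall>w\<in>l2. \<forall>w'\<in>l2. - bform Q (sw (\<lambda>t. w' t - w t)) (sw (\<lambda>t. w' t - w t)) \<le> M * (l2dist w' w)\<^sup>2"
    using form_le_l2dist .
  have dist: "0 \<le> l2dist u u'" if "u \<in> l2" "u' \<in> l2" for u u' :: "nat \<Rightarrow> real^'b"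
    unfolding l2dist_eq_energy using energy_nonneg[OF l2_diff[OF that]] by simp
  have cont_inf: "\<exists>d>0. \<forall>w' \<in> l2. l2dist w' w < d \<longrightarrow> \<bar>G.inf_val w' - G.inf_val w\<bar> < e"
    if w: "w \<in> l2" and e: "e > 0" for w e
  proof -
    obtain \<eta> where \<eta>: "0 < \<eta>" "\<forall>w'. w' \<in> l2 \<longrightarrow>
      - bform Q (sw (\<lambda>t. w' t - w t)) (sw (\<lambda>t. w' t - w t)) < \<eta> \<longrightarrow> \<bar>G.inf_val w' - G.inf_val w\<bar> < e"
      using G.inf_val_continuous[OF w e] .
    have "\<bar>G.inf_val w' - G.inf_val w\<bar> < e" if w': "w' \<in> l2" and d: "l2dist w' w < sqrt (\<eta> / M)" for w'
      using \<eta>(2) M(3) w w' scaled_square_less[OF M(1) \<eta>(1) dist[OF w' w] d] by (meson le_less_trans)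
    then show ?thesis using \<eta>(1) M(1) by (intro exI[of _ "sqrt (\<eta> / M)"]) auto
  qed
  have cont_sup: "\<exists>d>0. \<forall>v' \<in> l2. l2dist v' v < d \<longrightarrow> \<bar>G.sup_val v' - G.sup_val v\<bar> < e"
    if v: "v \<in> l2" and e: "e > 0" for v e
  proof -
    obtain \<eta> where \<eta>: "0 < \<eta>" "\<forall>v'. v' \<in> l2 \<longrightarrow>
      bform Q (sv (\<lambda>t. v' t - v t)) (sv (\<lambda>t. v' t - v t)) < \<eta> \<longrightarrow> \<bar>G.sup_val v' - G.sup_val v\<bar> < e"
      using G.sup_val_continuous[OF v e] .
    have "\<bar>G.sup_val v' - G.sup_val v\<bar> < e" if v': "v' \<in> l2" and d: "l2dist v' v < sqrt (\<eta> / M)" for v'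
      using \<eta>(2) M(2) v v' scaled_square_less[OF M(1) \<eta>(1) dist[OF v' v] d] by (meson le_less_trans)
    then show ?thesis using \<eta>(1) M(1) by (intro exI[of _ "sqrt (\<eta> / M)"]) auto
  qed
  have "(INF v\<in>l2. SUP w\<in>l2. ereal (gfun A B1 B2 Q a v w))
      = (SUP w\<in>l2. INF v\<in>l2. ereal (gfun A B1 B2 Q a v w))"
    using G.minimax by (simp add: g cong: INF_cong_simp SUP_cong_simp)
  then show ?thesis using cont_inf cont_sup by (simp add: inf sup)
qed

end

theorem theorem2p1:
  fixes A :: "real^'n^'n" and B1 :: "real^'k^'n" and B2 :: "real^'q^'n"
    and Q :: "real^('n+'k+'q)^('n+'k+'q)" and \<epsilon> :: real and z0 :: complex
  assumes "schur A"
    and "transpose Q = Q"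
    and "\<epsilon> > 0" and "cmod z0 = 1"
    and "\<forall>z. cmod z = 1 \<longrightarrow> psd (Pi_mod \<epsilon> (Pi_mat A B1 B2 Q z))"
    and "posdef (Pi11 (Pi_mat A B1 B2 Q z0))"
    and "negdef (Pi22 (Pi_mat A B1 B2 Q z0))"
  shows "\<forall>a :: real^'n.
     (\<forall>w \<in> l2. \<bar>INF v\<in>l2. ereal (gfun A B1 B2 Q a v w)\<bar> \<noteq> \<infinity>)
   \<and> (\<forall>w \<in> l2. \<forall>e>0. \<exists>d>0. \<forall>w' \<in> l2. l2dist w' w < d \<longrightarrow>
        \<bar>real_of_ereal (INF v\<in>l2. ereal (gfun A B1 B2 Q a v w'))
          - real_of_ereal (INF v\<in>l2. ereal (gfun A B1 B2 Q a v w))\<bar> < e)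
   \<and> (\<forall>v \<in> l2. \<bar>SUP w\<in>l2. ereal (gfun A B1 B2 Q a v w)\<bar> \<noteq> \<infinity>)
   \<and> (\<forall>v \<in> l2. \<forall>e>0. \<exists>d>0. \<forall>v' \<in> l2. l2dist v' v < d \<longrightarrow>
        \<bar>real_of_ereal (SUP w\<in>l2. ereal (gfun A B1 B2 Q a v' w))
          - real_of_ereal (SUP w\<in>l2. ereal (gfun A B1 B2 Q a v w))\<bar> < e)
   \<and> (INF v\<in>l2. SUP w\<in>l2. ereal (gfun A B1 B2 Q a v w))
       = (SUP w\<in>l2. INF v\<in>l2. ereal (gfun A B1 B2 Q a v w))"
proof -
  interpret lq_game A B1 B2 Q \<epsilon> z0
    using assms by unfold_locales auto
  show ?thesis by (intro allI saddle_value)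
qed

end
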